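(* Let $Q$ be a second-countable, compact, Hausdorff $(l+n)$-dimensional topological stratified pseudomanifold, let $\lambda:\mathcal S(Q)^{\mathrm{op}}\to\mathcal T$ be a characteristic functor on $Q$ with values in the subtori of $T^m$ ($m\ge n$), and let $c\in H^2(Q;\mathbb Z^m)$. Then the canonical model $X(Q,\lambda,c)$ is a locally standard $T$-pseudomanifold.
   Context: **Conventions.** $U(1)=\{z\in\mathbb C:|z|=1\}$, $\mathbb C^\times=\mathbb C\setminus\{0\}$, $T=T^m\cong U(1)^m$; a subtorus is a connected closed subgroup. A map $f$ between $T^m$-spaces is weakly $T$-equivariant if $f(tx)=\psi(t)f(x)$ for some automorphism $\psi$ of $T^m$. For compact Hausdorff $L$, $\mathring c(L)=L\times[0,1)/(L\times\{0\})$; $\mathring c(\emptyset)$ is a point. **Topological stratified pseudomanifold** (Hausdorff, defined inductively on dimension). A $0$-dimensional one is a discrete set of points. For $n,l\ge0$, $l+n\ne0$, an $(l+n)$-dimensional one is a Hausdorff space $Q$ with a filtration $Q=Q_{l+n}\supsetneq Q_{l+n-1}\supset\cdots\supset Q_l\supsetneq Q_{l-1}=\emptyset$ such that for $0\le i\le n$: (1) each connected component of $Q_{l+i}\setminus Q_{l+i-1}$, if nonempty, is an $(l+i)$-dimensional topological manifold; (2) $Q_{l+n}\setminus Q_{l+n-1}$ is dense in $Q$; (3) each $p\in Q_{l+i}\setminus Q_{l+i-1}$ has an open neighborhood $U_p$, an $(n-i-1)$-dimensional compact topological stratified pseudomanifold $L_p$ (possibly empty), and a homeomorphism $\varphi_p:U_p\to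 O_p\times\mathring c(L_p)$, $O_p\subset\mathbb R^{l+i}$ contractible open, restricting to homeomorphisms $U_p\cap Q_{l+i+j+1}\to O_p\times\mathring c((L_p)_j)$ for $-1\le j\le n-i-1$. Connected components of $Q_{l+i}\setminus Q_{l+i-1}$ are the strata of dimension $l+i$. **Characteristic functor.** $\mathcal S(Q)$ is the poset category of strata of $Q$, ordered by $S_1\le S_2$ iff $S_1\subset\overline{S_2}$; $\mathcal T$ is the category of subtori of $T^m$ with inclusions as morphisms. A characteristic functor is a functor $\lambda:\mathcal S(Q)^{\mathrm{op}}\to\mathcal T$ such that $\lambda(S)$ is an $i$-dimensional subtorus for each $(l+n-i)$-dimensional stratum $S$. (It is not assumed here that the top strata is homotopy equivalent to $Q$.) **Canonical model.** $X(Q,\lambda,c)=P_c/{\sim}$ with the quotient topology, where $\xi:P_c\to Q$ is the principal $T^m$-bundle with Chern class $c$, and $x\sim y$ iff $\xi(x)=\xi(y)=:p$ and $x,y$ lie in the same $\lambda(S)$-orbit, $S$ being the stratum containing $p$. The $T^m$-action is induced from $P_c$. **Filtration by orbit dimension.** Let $X$ be a second-countable compact Hausdorff space (not necessarily connected) with a continuous $T^m$-action, all of whose isotropy groups $T_x$ are subtori. Given integers $l\ge 0$, $0\le n\le m$, put $X_{l+2i+(m-n)}=X_{l+2i+1+(m-n)}=\{x\in X:\dim T(x)\le i+(m-n)\}$, where $T(x)$ is the orbit of $x$. The filtration by orbit dimension is $\mathfrak X: X=X_{l+m+n}\supset X_{l+2(n-1)+(m-n)}\supset\cdots\supset X_{l+2i+(m-n)}\supset\cdots\supset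 X_{l+(m-n)}\supset\emptyset$. Standing assumptions (part of being a locally standard $T$-pseudomanifold): (1) $(X,\mathfrak X)$ is a manifold stratified space, i.e. it is a stratified space (filtered by closed subspaces, satisfying the frontier condition: $S\cap\overline{S'}\neq\emptyset$ implies $S\subset\overline{S'}$ for strata $S,S'$) and $X_{l+2i+(m-n)}\setminus X_{l+2(i-1)+(m-n)}$ is an $(l+2i+(m-n))$-dimensional topological manifold (possibly empty) for each $i$; (2) $\{x:\dim T(x)\le (m-n)-1\}=\emptyset$; (3) $X_{l+m+n}\supsetneq X_{l+m+n-2}$ (there are free orbits). Strata are connected components of the successive differences. **Locally standard $T$-pseudomanifold.** An $(l+m+n)$-dimensional locally standard $T$-pseudomanifold $(X,\mathfrak X)$ is defined by induction on $l+n$. For $n=l=0$: $X$ is a (finite) disjoint union of copies of $T^m$ with the multiplication action. For $n,l\ge0$, $l+n\ne0$: (1) $X_{l+m+n}\setminus X_{l+m+n-2}$ is dense in $X$; (2) for any $x\in X_{l+2i+(m-n)}\setminus X_{l+2(i-1)+(m-n)}$ there is a triple $(U_x,L_x,\varphi_x)$ where (a) $U_x$ is a $T$-invariant open neighborhood of $x$; (b) $L_x$ is a $(2n-2i-1)$-dimensional compact locally standard $T_x$-pseudomanifold, possibly empty, with an action of $T_x\cong T^{n-i}$; (c) $\varphi_x:U_x\to O^l\times(\Omega\times U(1)^{m-n})\times\mathring c(L_x)$ is a weakly equivariant homeomorphism, with $O^l\subset\mathbb R^l$ contractible open, $\Omega\subset(\mathbb C^\times)^i$ open and $U(1)^i$-invariant,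 and $T^m$ acting on the target via an isomorphism $T^m\cong T^m/T_x\times T_x\cong U(1)^{i+(m-n)}\times T^{n-i}$, where $U(1)^{i+(m-n)}$ acts on $\Omega\times U(1)^{m-n}$ by standard multiplication and $T_x$ acts on $\mathring c(L_x)$ through the $L_x$-factor, trivially on $[0,1)$. The cone is filtered by $(\mathring c(L_x))_{j+1}=\mathring c((L_x)_j)$, $-1\le j\le 2n-2i-1$. *)

theory Defs
  imports "HOL-Analysis.Analysis" "HOL-Homology.Homology"
begin

section \<open>Topological preliminaries\<close>

definition quotient_topology :: "'a topology \<Rightarrow> ('a \<Rightarrow> 'b) \<Rightarrow> 'b topology" where
  "quotient_topology X f =
     topology (\<lambda>U. U \<subseteq> f ` topspace X \<and> openin X {x \<in> topspace X. f x \<in> U})"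

lemma openin_quotient_topology:
  "openin (quotient_topology X f) U \<longleftrightarrow>
     U \<subseteq> f ` topspace X \<and> openin X {x \<in> topspace X. f x \<in> U}"
proof -
  have "istopology (\<lambda>U. U \<subseteq> f ` topspace X \<and> openin X {x \<in> topspace X. f x \<in> U})"
    unfolding istopology_def
  proof (intro conjI allI impI)
    fix S T
    assume "S \<subseteq> f ` topspace X \<and> openin X {x \<in> topspace X. f x \<in> S}"
      and "T \<subseteq> f ` topspace X \<and> openin X {x \<in> topspace X. f x \<in> T}"
    moreover have "{x \<in> topspace X. f x \<in> S \<inter> T} =
        {x \<in> topspace X. f x \<in> S} \<inter> {x \<in> topspace X. f x \<in> T}"
      by auto
    ultimately show "S \<inter> T \<subseteq> f ` topspace X" "openin X {x \<in> topspace X. f x \<in> S \<inter> T}"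
      by auto
  next
    fix K
    assume K: "\<forall>S\<in>K. S \<subseteq> f ` topspace X \<and> openin X {x \<in> topspace X. f x \<in> S}"
    then show "\<Union>K \<subseteq> f ` topspace X"
      by blast
    have "{x \<in> topspace X. f x \<in> \<Union>K} = (\<Union>S\<in>K. {x \<in> topspace X. f x \<in> S})"
      by auto
    then show "openin X {x \<in> topspace X. f x \<in> \<Union>K}"
      using K by auto
  qed
  then show ?thesis
    by (simp add: quotient_topology_def topology_inverse')
qed

text \<open>
  The open cone on \<open>L\<close>.  The point \<open>None\<close> is the apex, the class of \<open>L \<times> {0}\<close>; it is adjoined
  also when \<open>L\<close> is empty, so that the cone on the empty space is a point.
\<close>

definition cone_proj :: "'a \<times> real \<Rightarrow> ('a \<times> real) option" where
  "cone_proj p = (if snd p = 0 then None else Some p)"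

definition cone_set :: "'a set \<Rightarrow> ('a \<times> real) option set" where
  "cone_set A = insert None (cone_proj ` (A \<times> {0..<1}))"

definition half_open_cylinder :: "'a topology \<Rightarrow> ('a \<times> real) topology" where
  "half_open_cylinder L = prod_topology L (top_of_set {0..<1})"

definition open_cone :: "'a topology \<Rightarrow> ('a \<times> real) option topology" where
  "open_cone L = topology (\<lambda>U. U \<subseteq> cone_set (topspace L) \<and>
     openin (half_open_cylinder L) {p \<in> topspace (half_open_cylinder L). cone_proj p \<in> U})"

lemma openin_open_cone:
  "openin (open_cone L) U \<longleftrightarrow> U \<subseteq> cone_set (topspace L) \<and>
     openin (half_open_cylinder L) {p \<in> topspace (half_open_cylinder L). cone_proj p \<in> U}"
proof -
  have "istopology (\<lambda>U. U \<subseteq> cone_set (topspace L) \<and>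
     openin (half_open_cylinder L) {p \<in> topspace (half_open_cylinder L). cone_proj p \<in> U})"
    (is "istopology (\<lambda>U. U \<subseteq> ?C \<and> openin ?Y (?pre U))")
    unfolding istopology_def
  proof (intro conjI allI impI)
    fix S T
    assume "S \<subseteq> ?C \<and> openin ?Y (?pre S)" and "T \<subseteq> ?C \<and> openin ?Y (?pre T)"
    moreover have "?pre (S \<inter> T) = ?pre S \<inter> ?pre T"
      by auto
    ultimately show "S \<inter> T \<subseteq> ?C" "openin ?Y (?pre (S \<inter> T))"
      by auto
  next
    fix K
    assume K: "\<forall>S\<in>K. S \<subseteq> ?C \<and> openin ?Y (?pre S)"
    then show "\<Union>K \<subseteq> ?C"
      by blast
    have "?pre (\<Union>K) = (\<Union>S\<in>K. ?pre S)"
      by auto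
    then show "openin ?Y (?pre (\<Union>K))"
      using K by auto
  qed
  then show ?thesis
    by (simp add: open_cone_def topology_inverse')
qed

definition topological_manifold :: "nat \<Rightarrow> 'a topology \<Rightarrow> bool" where
  "topological_manifold k X \<longleftrightarrow>
     Hausdorff_space X \<and> second_countable X \<and>
     (\<forall>x\<in>topspace X. \<exists>U V. openin X U \<and> x \<in> U \<and> openin (Euclidean_space k) V \<and>
        subtopology X U homeomorphic_space subtopology (Euclidean_space k) V)"


section \<open>Tori\<close>

text \<open>
  Points of \<open>U(1)^k\<close> and of \<open>(\<complex> - {0})^k\<close> are sequences whose coordinates of index \<open>\<ge> k\<close> are
  equal to 1, so the product of both groups is the coordinatewise product of sequences.  The
  type \<open>nat \<Rightarrow> complex\<close> carries the product topology.
\<close>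

type_synonym cvec = "nat \<Rightarrow> complex"

definition cmult :: "cvec \<Rightarrow> cvec \<Rightarrow> cvec" where
  "cmult s t = (\<lambda>j. s j * t j)"

definition torus :: "nat \<Rightarrow> cvec set" where
  "torus m = {t. (\<forall>j<m. cmod (t j) = 1) \<and> (\<forall>j\<ge>m. t j = 1)}"

definition cstar :: "nat \<Rightarrow> cvec set" where
  "cstar k = {w. (\<forall>j<k. w j \<noteq> 0) \<and> (\<forall>j\<ge>k. w j = 1)}"

definition torus_group :: "nat \<Rightarrow> cvec monoid" where
  "torus_group m = \<lparr>carrier = torus m, monoid.mult = cmult, one = (\<lambda>_. 1)\<rparr>"

abbreviation torus_space :: "nat \<Rightarrow> cvec topology" where
  "torus_space m \<equiv> top_of_set (torus m)"

definition top_group_iso ::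
  "('a, 'c) monoid_scheme \<Rightarrow> 'a topology \<Rightarrow> ('b, 'd) monoid_scheme \<Rightarrow> 'b topology \<Rightarrow>
   ('a \<Rightarrow> 'b) \<Rightarrow> bool" where
  "top_group_iso G TG H TH f \<longleftrightarrow> f \<in> iso G H \<and> homeomorphic_map TG TH f"

definition subtorus :: "nat \<Rightarrow> cvec set \<Rightarrow> bool" where
  "subtorus m H \<longleftrightarrow>
     subgroup H (torus_group m) \<and> closedin (torus_space m) H \<and> connected H"

definition subtorus_of_dim :: "nat \<Rightarrow> nat \<Rightarrow> cvec set \<Rightarrow> bool" where
  "subtorus_of_dim m k H \<longleftrightarrow> subtorus m H \<and>
     (\<exists>f. top_group_iso (torus_group k) (torus_space k)
            (torus_group m\<lparr>carrier := H\<rparr>) (top_of_set H) f)"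

definition torus_action :: "nat \<Rightarrow> 'a topology \<Rightarrow> (cvec \<Rightarrow> 'a \<Rightarrow> 'a) \<Rightarrow> bool" where
  "torus_action m X act \<longleftrightarrow>
     continuous_map (prod_topology (torus_space m) X) X (\<lambda>(t, x). act t x) \<and>
     (\<forall>x\<in>topspace X. act (\<lambda>_. 1) x = x) \<and>
     (\<forall>s\<in>torus m. \<forall>t\<in>torus m. \<forall>x\<in>topspace X. act (cmult s t) x = act s (act t x))"

definition isotropy :: "nat \<Rightarrow> (cvec \<Rightarrow> 'a \<Rightarrow> 'a) \<Rightarrow> 'a \<Rightarrow> cvec set" where
  "isotropy m act x = {t \<in> torus m. act t x = x}"

definition torus_orbit :: "nat \<Rightarrow> (cvec \<Rightarrow> 'a \<Rightarrow> 'a) \<Rightarrow> 'a \<Rightarrow> 'a set" where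
  "torus_orbit m act x = (\<lambda>t. act t x) ` torus m"

definition orbit_dim :: "nat \<Rightarrow> 'a topology \<Rightarrow> (cvec \<Rightarrow> 'a \<Rightarrow> 'a) \<Rightarrow> 'a \<Rightarrow> nat" where
  "orbit_dim m X act x =
     (THE k. topological_manifold k (subtopology X (torus_orbit m act x)))"

definition weakly_equivariant ::
  "nat \<Rightarrow> 'a set \<Rightarrow> (cvec \<Rightarrow> 'a \<Rightarrow> 'a) \<Rightarrow> (cvec \<Rightarrow> 'b \<Rightarrow> 'b) \<Rightarrow> ('a \<Rightarrow> 'b) \<Rightarrow> bool" where
  "weakly_equivariant m A act act' f \<longleftrightarrow>
     (\<exists>\<psi>. top_group_iso (torus_group m) (torus_space m) (torus_group m) (torus_space m) \<psi> \<and>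
        (\<forall>t\<in>torus m. \<forall>x\<in>A. f (act t x) = act' (\<psi> t) (f x)))"


section \<open>Topological stratified pseudomanifolds\<close>

text \<open>
  A filtration is a family \<open>F\<close> indexed by the integers, of which the members with index
  \<open>\<le> l + n\<close> matter; those of index less than \<open>l\<close> are empty.
\<close>

definition filtration :: "nat \<Rightarrow> nat \<Rightarrow> 'a topology \<Rightarrow> (int \<Rightarrow> 'a set) \<Rightarrow> bool" where
  "filtration l n Q F \<longleftrightarrow>
     (\<forall>k<int l. F k = {}) \<and>
     (\<forall>k\<le>int (l + n). closedin Q (F k) \<and> F (k - 1) \<subseteq> F k) \<and>
     F (int (l + n)) = topspace Q \<and>
     F (int (l + n) - 1) \<subset> F (int (l + n)) \<and>
     F (int l - 1) \<subset> F (int l)"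

definition strata_of_dim :: "'a topology \<Rightarrow> (int \<Rightarrow> 'a set) \<Rightarrow> nat \<Rightarrow> 'a set set" where
  "strata_of_dim Q F k = connected_components_of (subtopology Q (F (int k) - F (int k - 1)))"

definition strata :: "nat \<Rightarrow> nat \<Rightarrow> 'a topology \<Rightarrow> (int \<Rightarrow> 'a set) \<Rightarrow> 'a set set" where
  "strata l n Q F = (\<Union>i\<le>n. strata_of_dim Q F (l + i))"

definition cone_chart ::
  "nat \<Rightarrow> nat \<Rightarrow> 'a topology \<Rightarrow> (int \<Rightarrow> 'a set) \<Rightarrow> nat \<Rightarrow> 'a \<Rightarrow>
   'a set \<Rightarrow> (nat \<Rightarrow> real) set \<Rightarrow> 'a topology \<Rightarrow> (int \<Rightarrow> 'a set) \<Rightarrow>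
   ('a \<Rightarrow> (nat \<Rightarrow> real) \<times> ('a \<times> real) option) \<Rightarrow> bool" where
  "cone_chart l n Q F i p U B L G \<phi> \<longleftrightarrow>
     openin Q U \<and> p \<in> U \<and>
     openin (Euclidean_space (l + i)) B \<and>
     contractible_space (subtopology (Euclidean_space (l + i)) B) \<and>
     homeomorphic_map (subtopology Q U)
       (prod_topology (subtopology (Euclidean_space (l + i)) B) (open_cone L)) \<phi> \<and>
     (\<forall>j. -1 \<le> j \<and> j \<le> int n - int i - 1 \<longrightarrow>
        \<phi> ` (U \<inter> F (int l + int i + j + 1)) = B \<times> cone_set (G j))"

text \<open>
  In \<open>stratified_pseudomanifold l n Q F\<close> the dimension is \<open>l + n\<close> and \<open>l\<close> is the least
  dimension of a stratum.  The link \<open>L\<close> may have any least stratum dimension \<open>l'\<close>; for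
  \<open>i = n\<close> it has dimension \<open>-1\<close>, that is, it is empty.  Taking links of the same type as \<open>Q\<close>
  is no restriction: a link embeds into \<open>Q\<close> as a slice at a fixed cone parameter.
\<close>

inductive stratified_pseudomanifold ::
  "nat \<Rightarrow> nat \<Rightarrow> 'a topology \<Rightarrow> (int \<Rightarrow> 'a set) \<Rightarrow> bool" where
  discrete:
  "\<lbrakk>filtration 0 0 Q F; Q = discrete_topology (topspace Q)\<rbrakk>
   \<Longrightarrow> stratified_pseudomanifold 0 0 Q F"
| conical:
  "\<lbrakk>l + n \<noteq> 0;
    Hausdorff_space Q;
    filtration l n Q F;
    \<forall>i\<le>n. \<forall>S\<in>strata_of_dim Q F (l + i). topological_manifold (l + i) (subtopology Q S);
    Q closure_of (F (int (l + n)) - F (int (l + n) - 1)) = topspace Q;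
    \<forall>i\<le>n. \<forall>p \<in> F (int (l + i)) - F (int (l + i) - 1).
      \<exists>U B L G \<phi>. compact_space L \<and>
        ((i = n \<and> topspace L = {} \<and> (\<forall>j. G j = {})) \<or>
         (i < n \<and> (\<exists>l' n'. l' + n' = n - i - 1 \<and> stratified_pseudomanifold l' n' L G))) \<and>
        cone_chart l n Q F i p U B L G \<phi>\<rbrakk>
   \<Longrightarrow> stratified_pseudomanifold l n Q F"

text \<open>
  Both categories are posets, so a functor from the opposite of the strata poset to the subtori
  is an order-reversing assignment.
\<close>

definition characteristic_functor ::
  "nat \<Rightarrow> nat \<Rightarrow> nat \<Rightarrow> 'a topology \<Rightarrow> (int \<Rightarrow> 'a set) \<Rightarrow> ('a set \<Rightarrow> cvec set) \<Rightarrow> bool" where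
  "characteristic_functor m l n Q F lam \<longleftrightarrow>
     (\<forall>i\<le>n. \<forall>S\<in>strata_of_dim Q F (l + n - i). subtorus_of_dim m i (lam S)) \<and>
     (\<forall>S1\<in>strata l n Q F. \<forall>S2\<in>strata l n Q F.
        S1 \<subseteq> Q closure_of S2 \<longrightarrow> lam S2 \<subseteq> lam S1)"


section \<open>Singular cohomology\<close>

definition cochain_group ::
  "nat \<Rightarrow> 'a topology \<Rightarrow> ('c, 'd) monoid_scheme \<Rightarrow> ('a chain \<Rightarrow> 'c) monoid" where
  "cochain_group p X A =
     \<lparr>carrier = hom (chain_group p X) A \<inter> extensional (singular_chain_set p X),
      monoid.mult = (\<lambda>\<phi> \<psi>. \<lambda>c\<in>singular_chain_set p X. \<phi> c \<otimes>\<^bsub>A\<^esub> \<psi> c),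
      one = (\<lambda>c\<in>singular_chain_set p X. \<one>\<^bsub>A\<^esub>)\<rparr>"

definition coboundary :: "nat \<Rightarrow> 'a topology \<Rightarrow> ('a chain \<Rightarrow> 'c) \<Rightarrow> 'a chain \<Rightarrow> 'c" where
  "coboundary p X \<phi> = (\<lambda>c\<in>singular_chain_set (Suc p) X. \<phi> (chain_boundary (Suc p) c))"

definition cocycle_group ::
  "nat \<Rightarrow> 'a topology \<Rightarrow> ('c, 'd) monoid_scheme \<Rightarrow> ('a chain \<Rightarrow> 'c) monoid" where
  "cocycle_group p X A = (cochain_group p X A)
     \<lparr>carrier := {\<phi> \<in> carrier (cochain_group p X A).
                    coboundary p X \<phi> = \<one>\<^bsub>cochain_group (Suc p) X A\<^esub>}\<rparr>"

definition coboundary_set ::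
  "nat \<Rightarrow> 'a topology \<Rightarrow> ('c, 'd) monoid_scheme \<Rightarrow> ('a chain \<Rightarrow> 'c) set" where
  "coboundary_set p X A =
     (if p = 0 then {\<one>\<^bsub>cochain_group 0 X A\<^esub>}
      else coboundary (p - 1) X ` carrier (cochain_group (p - 1) X A))"

definition cohomology_group ::
  "nat \<Rightarrow> 'a topology \<Rightarrow> ('c, 'd) monoid_scheme \<Rightarrow> ('a chain \<Rightarrow> 'c) set monoid" where
  "cohomology_group p X A = cocycle_group p X A Mod coboundary_set p X A"

abbreviation int_power :: "nat \<Rightarrow> (nat \<Rightarrow> int) monoid" where
  "int_power m \<equiv> product_group {..<m} (\<lambda>_. integer_group)"


section \<open>Principal torus bundles and their Chern class\<close>

definition principal_torus_bundle ::
  "nat \<Rightarrow> 'q topology \<Rightarrow> 'p topology \<Rightarrow> ('p \<Rightarrow> 'q) \<Rightarrow> (cvec \<Rightarrow> 'p \<Rightarrow> 'p) \<Rightarrow> bool" where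
  "principal_torus_bundle m Q P \<xi> \<rho> \<longleftrightarrow>
     continuous_map P Q \<xi> \<and> torus_action m P \<rho> \<and>
     (\<forall>q\<in>topspace Q. \<exists>U h. openin Q U \<and> q \<in> U \<and>
        homeomorphic_map (subtopology P {x \<in> topspace P. \<xi> x \<in> U})
          (prod_topology (subtopology Q U) (torus_space m)) h \<and>
        (\<forall>x\<in>topspace P. \<xi> x \<in> U \<longrightarrow> fst (h x) = \<xi> x \<and>
           (\<forall>t\<in>torus m. h (\<rho> t x) = (\<xi> x, cmult t (snd (h x))))))"

definition exp_torus :: "nat \<Rightarrow> (nat \<Rightarrow> real) \<Rightarrow> cvec" where
  "exp_torus m \<theta> = (\<lambda>j. if j < m then cis (2 * pi * \<theta> j) else 1)"

definition simplex_vertex :: "nat \<Rightarrow> nat \<Rightarrow> real" where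
  "simplex_vertex k = (\<lambda>i. if i = k then 1 else 0)"

definition simplex_lift ::
  "nat \<Rightarrow> 'p topology \<Rightarrow> ('p \<Rightarrow> 'q) \<Rightarrow>
   ((nat \<Rightarrow> real) \<Rightarrow> 'q) \<Rightarrow> ((nat \<Rightarrow> real) \<Rightarrow> 'p) \<Rightarrow> bool" where
  "simplex_lift p P \<xi> \<sigma> \<sigma>' \<longleftrightarrow> singular_simplex p P \<sigma>' \<and> simplex_map p \<xi> \<sigma>' = \<sigma>"

text \<open>
  The Chern class is the primary obstruction to a section.  Choose lifts \<open>s\<^sub>0\<close>, \<open>s\<^sub>1\<close> to \<open>P\<close> of
  the singular simplices of dimension 0 and 1, compatible with faces (a section over the
  1-skeleton), and a lift \<open>s\<^sub>2 \<tau>\<close> of every singular 2-simplex \<open>\<tau>\<close> (a trivialisation of the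
  bundle pulled back by \<open>\<tau>\<close>).  On the \<open>k\<close>-th side of \<open>\<tau>\<close> the section is
  \<open>exp (2 \<pi> i \<theta> \<tau> k)\<close> times the trivialisation, and the obstruction cocycle takes on \<open>\<tau>\<close>
  the degree of the resulting map from the boundary circle to the torus, that is, the
  alternating sum of the increments of \<open>\<theta> \<tau> k\<close> along the sides.
\<close>

definition obstruction_cocycle ::
  "nat \<Rightarrow> 'q topology \<Rightarrow> 'p topology \<Rightarrow> ('p \<Rightarrow> 'q) \<Rightarrow> (cvec \<Rightarrow> 'p \<Rightarrow> 'p) \<Rightarrow>
   ('q chain \<Rightarrow> nat \<Rightarrow> int) \<Rightarrow> bool" where
  "obstruction_cocycle m Q P \<xi> \<rho> \<kappa> \<longleftrightarrow>
     \<kappa> \<in> carrier (cocycle_group 2 Q (int_power m)) \<and>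
     (\<exists>s\<^sub>0 s\<^sub>1 s\<^sub>2 \<theta>.
        (\<forall>v. singular_simplex 0 Q v \<longrightarrow> simplex_lift 0 P \<xi> v (s\<^sub>0 v)) \<and>
        (\<forall>\<sigma>. singular_simplex 1 Q \<sigma> \<longrightarrow> simplex_lift 1 P \<xi> \<sigma> (s\<^sub>1 \<sigma>) \<and>
           (\<forall>k\<le>1. singular_face 1 k (s\<^sub>1 \<sigma>) = s\<^sub>0 (singular_face 1 k \<sigma>))) \<and>
        (\<forall>\<tau>. singular_simplex 2 Q \<tau> \<longrightarrow> simplex_lift 2 P \<xi> \<tau> (s\<^sub>2 \<tau>) \<and>
           (\<forall>k\<le>2.
              (\<forall>j<m. continuous_on (standard_simplex 1) (\<lambda>x. \<theta> \<tau> k x j)) \<and>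
              (\<forall>x\<in>standard_simplex 1.
                 s\<^sub>1 (singular_face 2 k \<tau>) x =
                 \<rho> (exp_torus m (\<theta> \<tau> k x)) (singular_face 2 k (s\<^sub>2 \<tau>) x))) \<and>
           (\<forall>j<m. real_of_int (\<kappa> (frag_of \<tau>) j) =
              (\<Sum>k\<le>2. (-1) ^ k *
                 (\<theta> \<tau> k (simplex_vertex 1) j - \<theta> \<tau> k (simplex_vertex 0) j)))))"

definition has_chern_class ::
  "nat \<Rightarrow> 'q topology \<Rightarrow> 'p topology \<Rightarrow> ('p \<Rightarrow> 'q) \<Rightarrow> (cvec \<Rightarrow> 'p \<Rightarrow> 'p) \<Rightarrow>
   ('q chain \<Rightarrow> nat \<Rightarrow> int) set \<Rightarrow> bool" where
  "has_chern_class m Q P \<xi> \<rho> c \<longleftrightarrow>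
     (\<exists>\<kappa>. obstruction_cocycle m Q P \<xi> \<rho> \<kappa> \<and>
        c = coboundary_set 2 Q (int_power m) #>\<^bsub>cocycle_group 2 Q (int_power m)\<^esub> \<kappa>)"


section \<open>The canonical model\<close>

definition model_class ::
  "nat \<Rightarrow> nat \<Rightarrow> 'q topology \<Rightarrow> (int \<Rightarrow> 'q set) \<Rightarrow> ('q set \<Rightarrow> cvec set) \<Rightarrow>
   'p topology \<Rightarrow> ('p \<Rightarrow> 'q) \<Rightarrow> (cvec \<Rightarrow> 'p \<Rightarrow> 'p) \<Rightarrow> 'p \<Rightarrow> 'p set" where
  "model_class l n Q F lam P \<xi> \<rho> x =
     {y \<in> topspace P. \<xi> x = \<xi> y \<and>
        (\<exists>S\<in>strata l n Q F. \<xi> x \<in> S \<and> (\<exists>t\<in>lam S. y = \<rho> t x))}"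

definition canonical_model ::
  "nat \<Rightarrow> nat \<Rightarrow> 'q topology \<Rightarrow> (int \<Rightarrow> 'q set) \<Rightarrow> ('q set \<Rightarrow> cvec set) \<Rightarrow>
   'p topology \<Rightarrow> ('p \<Rightarrow> 'q) \<Rightarrow> (cvec \<Rightarrow> 'p \<Rightarrow> 'p) \<Rightarrow> 'p set topology" where
  "canonical_model l n Q F lam P \<xi> \<rho> = quotient_topology P (model_class l n Q F lam P \<xi> \<rho>)"

text \<open>
  The torus is commutative, so \<open>\<rho> t\<close> maps the class of \<open>x\<close> onto the class of \<open>\<rho> t x\<close>.
\<close>

definition model_action :: "(cvec \<Rightarrow> 'p \<Rightarrow> 'p) \<Rightarrow> cvec \<Rightarrow> 'p set \<Rightarrow> 'p set" where
  "model_action \<rho> t C = \<rho> t ` C"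


section \<open>Locally standard torus pseudomanifolds\<close>

text \<open>
  The filtration by orbit dimension, with members
  \<open>X\<^sub>k = X\<^sub>k\<^sub>+\<^sub>1 = {x. dim T(x) \<le> i + (m - n)}\<close> for \<open>k = l + 2 i + (m - n)\<close>.
\<close>

definition orbit_filtration ::
  "nat \<Rightarrow> nat \<Rightarrow> nat \<Rightarrow> 'a topology \<Rightarrow> (cvec \<Rightarrow> 'a \<Rightarrow> 'a) \<Rightarrow> int \<Rightarrow> 'a set" where
  "orbit_filtration l n m X act k =
     {x \<in> topspace X. int (orbit_dim m X act x) \<le>
        (k - int l - (int m - int n)) div 2 + (int m - int n)}"

definition orbit_stratum ::
  "nat \<Rightarrow> nat \<Rightarrow> nat \<Rightarrow> 'a topology \<Rightarrow> (cvec \<Rightarrow> 'a \<Rightarrow> 'a) \<Rightarrow> nat \<Rightarrow> 'a set" where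
  "orbit_stratum l n m X act i =
     orbit_filtration l n m X act (int l + 2 * int i + (int m - int n)) -
     orbit_filtration l n m X act (int l + 2 * (int i - 1) + (int m - int n))"

definition orbit_strata ::
  "nat \<Rightarrow> nat \<Rightarrow> nat \<Rightarrow> 'a topology \<Rightarrow> (cvec \<Rightarrow> 'a \<Rightarrow> 'a) \<Rightarrow> 'a set set" where
  "orbit_strata l n m X act =
     (\<Union>i\<le>n. connected_components_of (subtopology X (orbit_stratum l n m X act i)))"

definition orbit_stratified ::
  "nat \<Rightarrow> nat \<Rightarrow> nat \<Rightarrow> 'a topology \<Rightarrow> (cvec \<Rightarrow> 'a \<Rightarrow> 'a) \<Rightarrow> bool" where
  "orbit_stratified l n m X act \<longleftrightarrow>
     n \<le> m \<and>
     second_countable X \<and> compact_space X \<and> Hausdorff_space X \<and>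
     torus_action m X act \<and>
     (\<forall>x\<in>topspace X. subtorus m (isotropy m act x)) \<and>
     (\<forall>k. closedin X (orbit_filtration l n m X act k)) \<and>
     (\<forall>S\<in>orbit_strata l n m X act. \<forall>S'\<in>orbit_strata l n m X act.
        S \<inter> X closure_of S' \<noteq> {} \<longrightarrow> S \<subseteq> X closure_of S') \<and>
     (\<forall>i\<le>n. topological_manifold (l + 2 * i + (m - n))
        (subtopology X (orbit_stratum l n m X act i))) \<and>
     {x \<in> topspace X. int (orbit_dim m X act x) \<le> int m - int n - 1} = {} \<and>
     orbit_filtration l n m X act (int (l + m + n) - 2) \<subset>
       orbit_filtration l n m X act (int (l + m + n))"

definition cone_action ::
  "(cvec \<Rightarrow> 'a \<Rightarrow> 'a) \<Rightarrow> cvec \<Rightarrow> ('a \<times> real) option \<Rightarrow> ('a \<times> real) option" where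
  "cone_action act t = map_option (\<lambda>(y, r). (act t y, r))"

text \<open>
  The action of \<open>U(1)^i \<times> U(1)^(m-n) \<times> T^(n-i)\<close> on the local model
  \<open>O \<times> (\<Omega> \<times> U(1)^(m-n)) \<times> cone L\<close>.
\<close>

definition local_model_action ::
  "(cvec \<Rightarrow> 'a \<Rightarrow> 'a) \<Rightarrow> cvec \<times> cvec \<times> cvec \<Rightarrow>
   (nat \<Rightarrow> real) \<times> (cvec \<times> cvec) \<times> ('a \<times> real) option \<Rightarrow>
   (nat \<Rightarrow> real) \<times> (cvec \<times> cvec) \<times> ('a \<times> real) option" where
  "local_model_action actL = (\<lambda>(s, u, r) (b, (w, v), q).
     (b, (cmult s w, cmult u v), cone_action actL r q))"

text \<open>
  In the following, \<open>\<alpha>\<close> is the isomorphism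
  \<open>T^m \<cong> T^m/T\<^sub>x \<times> T\<^sub>x \<cong> U(1)^(i+(m-n)) \<times> T^(n-i)\<close>; it identifies \<open>T\<^sub>x\<close> with the factor
  \<open>T^(n-i)\<close>, which acts on the link by \<open>actL\<close>.  The last conjunct says that \<open>\<phi>\<close> respects
  the filtrations, the cone being filtered by the cones on the \<open>G j\<close>.
\<close>

definition torus_cone_chart ::
  "nat \<Rightarrow> nat \<Rightarrow> nat \<Rightarrow> 'a topology \<Rightarrow> (cvec \<Rightarrow> 'a \<Rightarrow> 'a) \<Rightarrow> nat \<Rightarrow> 'a \<Rightarrow>
   'a set \<Rightarrow> (nat \<Rightarrow> real) set \<Rightarrow> cvec set \<Rightarrow>
   'a topology \<Rightarrow> (cvec \<Rightarrow> 'a \<Rightarrow> 'a) \<Rightarrow> (int \<Rightarrow> 'a set) \<Rightarrow>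
   (cvec \<Rightarrow> cvec \<times> cvec \<times> cvec) \<Rightarrow>
   ('a \<Rightarrow> (nat \<Rightarrow> real) \<times> (cvec \<times> cvec) \<times> ('a \<times> real) option) \<Rightarrow> bool" where
  "torus_cone_chart l n m X act i x U B \<Omega> L actL G \<alpha> \<phi> \<longleftrightarrow>
     openin X U \<and> x \<in> U \<and> (\<forall>t\<in>torus m. \<forall>y\<in>U. act t y \<in> U) \<and>
     openin (Euclidean_space l) B \<and>
     contractible_space (subtopology (Euclidean_space l) B) \<and>
     openin (top_of_set (cstar i)) \<Omega> \<and> (\<forall>s\<in>torus i. \<forall>w\<in>\<Omega>. cmult s w \<in> \<Omega>) \<and>
     top_group_iso (torus_group m) (torus_space m)
       (torus_group i \<times>\<times> torus_group (m - n) \<times>\<times> torus_group (n - i))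
       (prod_topology (torus_space i) (prod_topology (torus_space (m - n)) (torus_space (n - i))))
       \<alpha> \<and>
     \<alpha> ` isotropy m act x = {\<lambda>_. 1} \<times> {\<lambda>_. 1} \<times> torus (n - i) \<and>
     homeomorphic_map (subtopology X U)
       (prod_topology (subtopology (Euclidean_space l) B)
         (prod_topology (prod_topology (top_of_set \<Omega>) (torus_space (m - n))) (open_cone L)))
       \<phi> \<and>
     weakly_equivariant m U act (\<lambda>t. local_model_action actL (\<alpha> t)) \<phi> \<and>
     (\<forall>j. -1 \<le> j \<and> j \<le> 2 * int n - 2 * int i - 1 \<longrightarrow>
        \<phi> ` (U \<inter> orbit_filtration l n m X act
                  (int l + 2 * int i + (int m - int n) + j + 1)) =
        B \<times> (\<Omega> \<times> torus (m - n)) \<times> cone_set (G j))"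

text \<open>
  \<open>locally_standard l n m X act\<close> describes a space of dimension \<open>l + m + n\<close> with an action of
  \<open>T^m\<close>.  The link, of dimension \<open>l' + (n - i) + n' = 2 n - 2 i - 1\<close>, may have any
  parameters \<open>l'\<close>, \<open>n'\<close> with that sum; for \<open>i = n\<close> it is empty.  As above, links may be taken
  of the same type as \<open>X\<close>.
\<close>

inductive locally_standard ::
  "nat \<Rightarrow> nat \<Rightarrow> nat \<Rightarrow> 'a topology \<Rightarrow> (cvec \<Rightarrow> 'a \<Rightarrow> 'a) \<Rightarrow> bool" where
  copies:
  "\<lbrakk>orbit_stratified 0 0 m X act;
    homeomorphic_map (prod_topology (torus_space m) (discrete_topology {..<N::nat})) X h;
    \<forall>t\<in>torus m. \<forall>s\<in>torus m. \<forall>a<N. act t (h (s, a)) = h (cmult t s, a)\<rbrakk>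
   \<Longrightarrow> locally_standard 0 0 m X act"
| conical:
  "\<lbrakk>l + n \<noteq> 0;
    orbit_stratified l n m X act;
    X closure_of (orbit_filtration l n m X act (int (l + m + n)) -
                  orbit_filtration l n m X act (int (l + m + n) - 2)) = topspace X;
    \<forall>i\<le>n. \<forall>x\<in>orbit_stratum l n m X act i.
      \<exists>U B \<Omega> L actL G \<alpha> \<phi>. compact_space L \<and>
        ((i = n \<and> topspace L = {} \<and> (\<forall>j. G j = {})) \<or>
         (i < n \<and> (\<exists>l' n'. l' + (n - i) + n' = 2 * n - 2 * i - 1 \<and>
            locally_standard l' n' (n - i) L actL \<and>
            G = orbit_filtration l' n' (n - i) L actL))) \<and>
        torus_cone_chart l n m X act i x U B \<Omega> L actL G \<alpha> \<phi>\<rbrakk>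
   \<Longrightarrow> locally_standard l n m X act"

end

theory Submission
  imports Defs
begin

text \<open>
  Near a point \<open>p\<close> of an \<open>(l + i)\<close>-dimensional stratum, \<open>Q\<close> is a box times a cone on a link \<open>L\<close>,
  and the isotropy groups \<open>\<lambda>(S)\<close> of nearby strata lie in \<open>H = \<lambda>(S\<^sub>p)\<close> by the frontier condition.
  Every subtorus is a direct factor: a Euclidean algorithm on the exponents of an embedding
  \<open>T^k \<rightarrow> T^m\<close> makes it standard after an automorphism.  Splitting \<open>H\<close> off \<open>T^m\<close> shows that the
  canonical model over this neighbourhood is the product of the box, the complementary torus and
  the cone on \<open>(L \<times> H)/~\<close>, which is a canonical model over \<open>L\<close> for the torus \<open>H\<close>; combining the torus
  \<open>U(1)^i\<close> with \<open>i\<close> of the box coordinates gives \<open>\<Omega>\<close>.  Induction on \<open>l + n\<close> finishes the proof.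
\<close>

section \<open>Homomorphisms of the circle\<close>

text \<open>The model over a link does not come with a bundle: it has to be found as a subspace of
  \<open>X\<close>, acted on by a subgroup of T^m. The induction therefore runs over the axioms of
  \<open>orbit_model\<close>, which speak of points instead of bundles and strata: a map to
  \<open>Q\<close> whose fibres are the orbits, local sections, and isotropy groups that are
  constant on connected parts of a layer and can only shrink nearby. A second obstacle is
  topological. A chart compares a quotient of (part of \<open>Q\<close>) x torus with a product that
  contains a cone, itself a quotient, and a product of quotient maps need not be a quotient map.
  Perfect maps are stable under products and composition. Both sides are therefore presented as
  perfect images of one space, and only the two kernels have to be compared; compactness of links,
  torus and \<open>X\<close> supplies the perfectness. The frontier condition and the invariance of
  orbit dimension are demanded of \<open>X\<close> but not given for \<open>Q\<close>: the first is
  read off from the cone charts, the second rests on invariance of domain.\<close>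

lemma additive_continuous_real_complex:
  fixes h :: "real \<Rightarrow> complex"
  assumes cont: "continuous_on UNIV h" and add: "\<And>x y. h (x + y) = h x + h y"
  shows "h x = x *\<^sub>R h 1"
proof -
  \<comment> \<open>The deviation from the linear map through \<open>h 1\<close>. It is additive and
    vanishes at the integers, hence has period 1; continuity on the unit interval bounds it, and a
    bounded additive map is zero.\<close>
  define k where "k x = h x - x *\<^sub>R h 1" for x
  have kadd: "k (x + y) = k x + k y" for x y
    by (simp add: k_def add scaleR_add_left)
  have k0: "k 0 = 0"
    using kadd[of 0 0] by simp
  have k1: "k 1 = 0"
    by (simp add: k_def)
  have knat: "k (real n * x) = of_nat n * k x" for n x
    by (induction n) (simp_all add: k0 kadd distrib_right)
  have kint: "k (of_int i) = 0" for i :: int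
  proof -
    have "k (of_nat n) = 0" for n
      using knat[of n 1] k1 by simp
    moreover have "k (- x) = - k x" for x
      using kadd[of x "-x"] k0 by (simp add: eq_neg_iff_add_eq_0 add.commute)
    ultimately show ?thesis
      by (cases i rule: int_cases2) simp_all
  qed
  have per: "k x = k (frac x)" for x
    using kadd[of "of_int \<lfloor>x\<rfloor>" "frac x"] kint by (simp add: frac_def)
  have "compact (k ` {0..1})"
    unfolding k_def by (intro compact_continuous_image continuous_intros continuous_on_subset[OF cont]) auto
  then obtain M where M: "\<And>x. x \<in> {0..1} \<Longrightarrow> norm (k x) \<le> M"
    by (meson bounded_iff compact_imp_bounded image_eqI)
  have bound: "norm (k x) \<le> M" for x
    using per[of x] M[of "frac x"] by (simp add: frac_lt_1 less_imp_le)
  have "norm (k x) = 0"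
  proof (rule ccontr)
    assume "norm (k x) \<noteq> 0"
    then have pos: "norm (k x) > 0" by simp
    then obtain n where "M < real n * norm (k x)"
      using reals_Archimedean3 by blast
    then show False
      using bound[of "real n * x"] by (simp add: knat norm_mult)
  qed
  then show ?thesis by (simp add: k_def)
qed

text \<open>Pulled back along \<open>cis\<close>, the homomorphism has a continuous logarithm on the
  line. Normalised at 0 this logarithm is additive, hence linear, and since the circle closes up
  after 2 pi its slope is an integer multiple of the imaginary unit.\<close>

lemma circle_endomorphism:
  fixes f :: "complex \<Rightarrow> complex"
  assumes cont: "continuous_on (sphere 0 1) f"
    and range: "\<And>z. cmod z = 1 \<Longrightarrow> cmod (f z) = 1"
    and hom: "\<And>z w. \<lbrakk>cmod z = 1; cmod w = 1\<rbrakk> \<Longrightarrow> f (z * w) = f z * f w"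
  obtains a :: int where "\<And>z. cmod z = 1 \<Longrightarrow> f z = z powi a"
proof -
  define \<phi> where "\<phi> x = f (cis x)" for x
  have c\<phi>: "continuous_on UNIV \<phi>"
    unfolding \<phi>_def
    by (intro continuous_on_compose2[OF cont] continuous_intros) auto
  have nz: "\<phi> x \<noteq> 0" for x
    using range[of "cis x"] by (auto simp: \<phi>_def)
  have \<phi>add: "\<phi> (x + y) = \<phi> x * \<phi> y" for x y
    using hom[of "cis x" "cis y"] by (simp add: \<phi>_def cis_mult)
  have \<phi>0: "\<phi> 0 = 1"
    using \<phi>add[of 0 0] nz[of 0] by simp
  obtain g where cg: "continuous_on UNIV g" and g: "\<And>x. \<phi> x = exp (g x)"
    using continuous_logarithm_on_contractible[OF c\<phi>] nz by (metis UNIV_I contractible_UNIV)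
  define h where "h x = g x - g 0" for x
  have ch: "continuous_on UNIV h"
    unfolding h_def by (intro continuous_intros cg)
  have h: "\<phi> x = exp (h x)" for x
    using g[of x] g[of 0] \<phi>0 by (simp add: h_def exp_diff)
  have add: "h (x + y) = h x + h y" for x y
  proof -
    \<comment> \<open>The defect of additivity, with \<open>y\<close> fixed. Its values are
      multiples of 2 pi i, so they are isolated, and a continuous function on the line with isolated
      values is constant; its value at 0 is 0.\<close>
    define d where "d t = h (t + y) - h t - h y" for t
    have "d t \<in> range (\<lambda>n::int. of_int (2 * n) * complex_of_real pi * \<i>)" for t
    proof -
      have "exp (h (t + y)) = exp (h t + h y)"
        by (metis \<phi>add exp_add h)
      then obtain n :: int where "h (t + y) = h t + h y + (of_int (2 * n) * pi) * \<i>"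
        by (metis exp_eq)
      then show ?thesis by (auto simp: d_def)
    qed
    moreover have "continuous_on UNIV d"
      unfolding d_def by (intro continuous_intros continuous_on_compose2[OF ch]) auto
    ultimately have "d constant_on UNIV"
    proof (intro continuous_discrete_range_constant)
      fix t :: real
      assume *: "\<And>t. d t \<in> range (\<lambda>n::int. of_int (2 * n) * complex_of_real pi * \<i>)"
      show "\<exists>e>0. \<forall>y. y \<in> UNIV \<and> d y \<noteq> d t \<longrightarrow> e \<le> norm (d y - d t)"
      proof (intro exI[of _ 1] conjI allI impI)
        fix y assume "y \<in> UNIV \<and> d y \<noteq> d t"
        moreover obtain a b :: int where "d y = of_int (2 * a) * complex_of_real pi * \<i>"
            "d t = of_int (2 * b) * complex_of_real pi * \<i>"
          using * by blast
        ultimately have ab: "a \<noteq> b" "d y - d t = complex_of_real (of_int (2 * (a - b)) * pi) * \<i>"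
          by (auto simp: algebra_simps)
        have "1 \<le> \<bar>real_of_int (2 * (a - b))\<bar>"
        proof -
          have "1 \<le> \<bar>2 * (a - b)\<bar>"
            using ab(1) by (simp add: int_one_le_iff_zero_less)
          then show ?thesis
            by (metis of_int_1_le_iff of_int_abs)
        qed
        moreover have "1 \<le> pi" using pi_ge_two by simp
        ultimately have "1 * 1 \<le> \<bar>real_of_int (2 * (a - b))\<bar> * pi"
          by (intro mult_mono) auto
        then show "1 \<le> norm (d y - d t)"
          unfolding ab(2) norm_mult norm_of_real by (simp add: abs_mult)
      qed auto
    qed auto
    then have "d x = d 0"
      by (auto simp: constant_on_def)
    then show ?thesis by (simp add: d_def h_def algebra_simps)
  qed
  have lin: "h x = x *\<^sub>R h 1" for x
    by (rule additive_continuous_real_complex[OF ch add])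
  have "exp (h (2 * pi)) = 1"
    using h[of "2 * pi"] h[of 0] \<phi>0 by (simp add: \<phi>_def)
  then obtain a :: int where "h (2 * pi) = of_int (2 * a) * pi * \<i>"
    using complex_eq_iff exp_eq_1 by (metis exp_eq exp_zero add.left_neutral)
  then have "h 1 = of_int a * \<i>"
    using lin[of "2 * pi"] by (simp add: scaleR_conv_of_real)
  then have ha: "h x = \<i> * of_real (of_int a * x)" for x
    using lin[of x] by (simp add: scaleR_conv_of_real)
  have "f z = z powi a" if z: "cmod z = 1" for z
  proof -
    obtain x where x: "z = cis x"
      using z by (metis complex_cnj_cancel_iff cis_Arg_unique mult_1 of_real_1 rcis_cmod_Arg rcis_def)
    have "f z = exp (h x)"
      using h[of x] by (simp add: \<phi>_def x)
    also have "\<dots> = cis (of_int a * x)"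
      by (simp add: ha cis_conv_exp)
    also have "\<dots> = z powi a"
      by (simp add: x cis_power_int)
    finally show ?thesis .
  qed
  then show thesis by (rule that)
qed

section \<open>Tori and their automorphisms\<close>

lemma continuous_map_cvec_iff:
  "continuous_map X (top_of_set S) f \<longleftrightarrow>
     (\<forall>j. continuous_map X euclidean (\<lambda>x. f x j :: 'b::topological_space)) \<and> f \<in> topspace X \<rightarrow> S"
  using continuous_map_componentwise_UNIV[of X "\<lambda>_. euclidean" f]
  by (simp add: euclidean_product_topology continuous_map_in_subtopology)

text \<open>As a product over all indices, trivial beyond \<open>m\<close>, the torus gets
  compactness and connectedness from the product theorems.\<close>

lemma torus_PiE: "torus m = PiE UNIV (\<lambda>j. if j < m then sphere 0 1 else {1})"
proof -
  have "(\<forall>j<m. cmod (t j) = 1) \<and> (\<forall>j\<ge>m. t j = 1) \<longleftrightarrow>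
      (\<forall>j. t j \<in> (if j < m then sphere 0 1 else {1}))" for t :: cvec
    by (metis (no_types, lifting) dist_0_norm mem_sphere not_less singletonD singletonI)
  then show ?thesis
    unfolding torus_def PiE_def Pi_def by simp
qed

lemma torusI: "\<lbrakk>\<And>j. j < m \<Longrightarrow> cmod (t j) = 1; \<And>j. j \<ge> m \<Longrightarrow> t j = 1\<rbrakk> \<Longrightarrow> t \<in> torus m"
  by (simp add: torus_def)

lemma torus_norm: "t \<in> torus m \<Longrightarrow> cmod (t j) = 1"
  by (cases "j < m") (auto simp: torus_def)

lemma torus_nz: "t \<in> torus m \<Longrightarrow> t j \<noteq> 0"
  using torus_norm[of t m j] by auto

lemma torus_ge: "t \<in> torus m \<Longrightarrow> j \<ge> m \<Longrightarrow> t j = 1"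
  by (simp add: torus_def)

lemma torus_mono: "k \<le> m \<Longrightarrow> torus k \<subseteq> torus m"
  by (auto intro!: torusI simp: torus_norm torus_ge)

lemma one_in_torus [simp]: "(\<lambda>_. 1) \<in> torus m"
  by (simp add: torus_def)

definition cinv :: "cvec \<Rightarrow> cvec" where
  "cinv t = (\<lambda>j. inverse (t j))"

lemma cmult_apply: "cmult s t j = s j * t j"
  by (simp add: cmult_def)

lemma cmult_in_torus [simp]: "s \<in> torus m \<Longrightarrow> t \<in> torus m \<Longrightarrow> cmult s t \<in> torus m"
  by (simp add: torus_def cmult_def norm_mult)

lemma cinv_in_torus [simp]: "s \<in> torus m \<Longrightarrow> cinv s \<in> torus m"
  by (simp add: torus_def cinv_def norm_inverse)

lemma cmult_assoc: "cmult (cmult s t) u = cmult s (cmult t u)"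
  by (simp add: cmult_def mult.assoc)

lemma cmult_commute: "cmult s t = cmult t s"
  by (simp add: cmult_def mult.commute)

lemma cmult_left_commute: "cmult s (cmult t u) = cmult t (cmult s u)"
  by (simp add: cmult_def mult.left_commute)

lemma cmult_one [simp]: "cmult (\<lambda>_. 1) t = t" "cmult t (\<lambda>_. 1) = t"
  by (simp_all add: cmult_def)

lemma cmult_cinv: "s \<in> torus m \<Longrightarrow> cmult s (cinv s) = (\<lambda>_. 1)" "s \<in> torus m \<Longrightarrow> cmult (cinv s) s = (\<lambda>_. 1)"
  by (auto simp: cmult_def cinv_def torus_nz)

lemma cmult_cinv_cancel [simp]:
  "s \<in> torus m \<Longrightarrow> cmult s (cmult (cinv s) t) = t" "s \<in> torus m \<Longrightarrow> cmult (cinv s) (cmult s t) = t"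
  by (simp_all add: cmult_cinv flip: cmult_assoc)

lemma cmult_left_cancel: "u \<in> torus m \<Longrightarrow> cmult u s = cmult u t \<longleftrightarrow> s = t"
  by (metis cmult_cinv_cancel(2))

lemma compact_torus: "compact (torus m)"
proof -
  have "compactin (product_topology (\<lambda>_. euclidean) UNIV) (torus m)"
    unfolding torus_PiE compactin_PiE by simp
  then show ?thesis unfolding euclidean_product_topology compactin_euclidean_iff .
qed

lemma connected_torus: "connected (torus m)"
proof -
  have "connectedin (product_topology (\<lambda>_. euclidean) UNIV) (torus m)"
    unfolding torus_PiE connectedin_PiE by (simp add: connected_sphere)
  then show ?thesis unfolding euclidean_product_topology connectedin_iff_connected .
qed

lemma compact_torus_space [simp]: "compact_space (torus_space m)"
  by (simp add: compact_space_subtopology compact_torus)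

lemma connected_torus_space [simp]: "connected_space (torus_space m)"
  by (simp add: connected_space_subtopology connected_torus)

lemma Hausdorff_torus_space [simp]: "Hausdorff_space (torus_space m)"
  by (simp add: Hausdorff_space_subtopology)

lemma second_countable_euclidean:
  "second_countable (euclidean :: 'a::second_countable_topology topology)"
proof -
  obtain B :: "'a set set" where "countable B" "topological_basis B"
    using ex_countable_basis by blast
  then show ?thesis
    unfolding second_countable_def
    by (metis open_openin topological_basisE topological_basis_open)
qed

lemma second_countable_torus_space [simp]: "second_countable (torus_space m)"
  by (intro second_countable_subtopology second_countable_euclidean)

lemma torus_group_simps [simp]:
  "carrier (torus_group m) = torus m" "s \<otimes>\<^bsub>torus_group m\<^esub> t = cmult s t" "\<one>\<^bsub>torus_group m\<^esub> = (\<lambda>_. 1)"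
  by (simp_all add: torus_group_def)

lemma group_torus_group: "Group.group (torus_group m)"
proof (rule groupI)
  show "\<exists>y\<in>carrier (torus_group m). y \<otimes>\<^bsub>torus_group m\<^esub> x = \<one>\<^bsub>torus_group m\<^esub>"
    if "x \<in> carrier (torus_group m)" for x
    using that by (auto intro!: bexI[of _ "cinv x"] simp: cmult_cinv(2)[of x m])
qed (auto simp: cmult_assoc)

section \<open>Embeddings of tori and their images, the subtori\<close>

definition torus_embedding :: "nat \<Rightarrow> nat \<Rightarrow> (cvec \<Rightarrow> cvec) \<Rightarrow> bool" where
  "torus_embedding k m f \<longleftrightarrow> continuous_on (torus k) f \<and> f ` torus k \<subseteq> torus m \<and>
     (\<forall>s\<in>torus k. \<forall>t\<in>torus k. f (cmult s t) = cmult (f s) (f t)) \<and> inj_on f (torus k)"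

lemma torus_embedding_one: "torus_embedding k m f \<Longrightarrow> f (\<lambda>_. 1) = (\<lambda>_. 1)"
proof -
  assume f: "torus_embedding k m f"
  then have "f (cmult (\<lambda>_. 1) (\<lambda>_. 1)) = cmult (f (\<lambda>_. 1)) (f (\<lambda>_. 1))" "f (\<lambda>_. 1) \<in> torus m"
    by (auto simp: torus_embedding_def simp del: cmult_one)
  then show ?thesis
    using cmult_left_cancel[of "f (\<lambda>_. 1)" m "f (\<lambda>_. 1)" "\<lambda>_. 1"] by simp
qed

lemma torus_embedding_cinv:
  assumes f: "torus_embedding k m f" and s: "s \<in> torus k"
  shows "f (cinv s) = cinv (f s)"
proof -
  have "f (cmult s (cinv s)) = cmult (f s) (f (cinv s))"
    using f s by (simp add: torus_embedding_def)
  then have "cmult (f s) (f (cinv s)) = (\<lambda>_. 1)"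
    using cmult_cinv(1)[OF s] torus_embedding_one[OF f] by simp
  moreover have "f s \<in> torus m"
    using f s by (auto simp: torus_embedding_def)
  ultimately show ?thesis
    using cmult_cinv(1)[of "f s" m] cmult_left_cancel[of "f s" m "f (cinv s)" "cinv (f s)"] by simp
qed

lemma torus_embedding_compose:
  assumes "torus_embedding k m f" "torus_embedding m n g"
  shows "torus_embedding k n (g \<circ> f)"
  unfolding torus_embedding_def
proof (intro conjI ballI)
  have f: "continuous_on (torus k) f" "f ` torus k \<subseteq> torus m" "inj_on f (torus k)"
    and g: "continuous_on (torus m) g" "g ` torus m \<subseteq> torus n" "inj_on g (torus m)"
    using assms by (auto simp: torus_embedding_def)
  show "continuous_on (torus k) (g \<circ> f)"
    using f g by (metis continuous_on_compose continuous_on_subset)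
  show "(g \<circ> f) ` torus k \<subseteq> torus n"
    using f g by auto
  show "inj_on (g \<circ> f) (torus k)"
    using f g by (metis comp_inj_on inj_on_subset)
  show "(g \<circ> f) (cmult s t) = cmult ((g \<circ> f) s) ((g \<circ> f) t)" if "s \<in> torus k" "t \<in> torus k" for s t
    using assms f(2) that by (simp add: torus_embedding_def image_subset_iff)
qed

text \<open>A continuous injection of a compact space into a Hausdorff space is a homeomorphism onto
  its image.\<close>

lemma torus_embedding_homeomorphic_map:
  assumes "torus_embedding k m f"
  shows "homeomorphic_map (torus_space k) (top_of_set (f ` torus k)) f"
  using assms unfolding torus_embedding_def
  by (intro continuous_imp_homeomorphic_map)
     (auto simp: Hausdorff_space_subtopology continuous_map_in_subtopology)

text \<open>Closedness and connectedness of \<open>H\<close> and continuity of the inverse are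
  consequences of the compactness and connectedness of the source torus. What remains of the
  definition is the parametrisation, and this is the form in which subtori are straightened and
  pulled back below.\<close>

lemma subtorus_of_dim_iff:
  "subtorus_of_dim m k H \<longleftrightarrow> (\<exists>f. torus_embedding k m f \<and> H = f ` torus k)"
proof
  assume "subtorus_of_dim m k H"
  then obtain f where sub: "subgroup H (torus_group m)"
    and f: "f \<in> iso (torus_group k) (torus_group m\<lparr>carrier := H\<rparr>)"
    and h: "homeomorphic_map (torus_space k) (top_of_set H) f"
    by (auto simp: subtorus_of_dim_def top_group_iso_def subtorus_def)
  have "H \<subseteq> torus m"
    using subgroup.subset[OF sub] by simp
  then have "torus_embedding k m f \<and> H = f ` torus k"
    using f homeomorphic_imp_continuous_map[OF h]
    by (auto simp: torus_embedding_def iso_iff hom_def continuous_map_in_subtopology)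
  then show "\<exists>f. torus_embedding k m f \<and> H = f ` torus k" by blast
next
  assume "\<exists>f. torus_embedding k m f \<and> H = f ` torus k"
  then obtain f where f: "torus_embedding k m f" and H: "H = f ` torus k" by blast
  have Hm: "H \<subseteq> torus m"
    using f H by (auto simp: torus_embedding_def)
  interpret G: group "torus_group m" by (rule group_torus_group)
  have inv: "inv\<^bsub>torus_group m\<^esub> s = cinv s" if "s \<in> torus m" for s
    by (rule G.inv_equality) (use that in \<open>auto simp: cmult_cinv\<close>)
  have "subgroup H (torus_group m)"
  proof (rule G.subgroupI)
    show "H \<subseteq> carrier (torus_group m)" using Hm by simp
    show "H \<noteq> {}" using H one_in_torus by blast
    show "inv\<^bsub>torus_group m\<^esub> a \<in> H" if "a \<in> H" for a
      using that f Hm inv torus_embedding_cinv[OF f] cinv_in_torus by (auto simp: H subset_iff) (metis imageI cinv_in_torus)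
    show "a \<otimes>\<^bsub>torus_group m\<^esub> b \<in> H" if "a \<in> H" "b \<in> H" for a b
    proof -
      obtain s t where "s \<in> torus k" "t \<in> torus k" "a = f s" "b = f t"
        using \<open>a \<in> H\<close> \<open>b \<in> H\<close> unfolding H by blast
      then have "a \<otimes>\<^bsub>torus_group m\<^esub> b = f (cmult s t)" "cmult s t \<in> torus k"
        using f by (auto simp: torus_embedding_def)
      then show ?thesis using H by blast
    qed
  qed
  moreover have "compact H"
    using f H compact_torus by (auto simp: torus_embedding_def intro: compact_continuous_image)
  then have "closedin (torus_space m) H"
    using Hm by (simp add: closedin_subset compact_imp_closed closed_subset)
  moreover have "connected H"
    using f H connected_torus by (auto simp: torus_embedding_def intro: connected_continuous_image)
  moreover have "f \<in> iso (torus_group k) (torus_group m\<lparr>carrier := H\<rparr>)"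
    using f H by (auto simp: torus_embedding_def iso_iff hom_def)
  moreover have "homeomorphic_map (torus_space k) (top_of_set H) f"
    using torus_embedding_homeomorphic_map[OF f] H by simp
  ultimately show "subtorus_of_dim m k H"
    unfolding subtorus_of_dim_def subtorus_def top_group_iso_def by (intro conjI exI[of _ f])
qed

lemma subtorus_of_dim_imp_subtorus: "subtorus_of_dim m k H \<Longrightarrow> subtorus m H"
  by (simp add: subtorus_of_dim_def)

lemma subtorus_of_dim_imp_subgroup: "subtorus_of_dim m k H \<Longrightarrow> subgroup H (torus_group m)"
  by (simp add: subtorus_of_dim_def subtorus_def)

lemma subtorus_of_dim_subset: "subtorus_of_dim m k H \<Longrightarrow> H \<subseteq> torus m"
  using subgroup.subset[OF subtorus_of_dim_imp_subgroup] by fastforce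

lemma subtorus_of_dim_one: "subtorus_of_dim m k H \<Longrightarrow> (\<lambda>_. 1) \<in> H"
  using subgroup.one_closed[OF subtorus_of_dim_imp_subgroup] by fastforce

lemma subtorus_of_dim_cmult: "subtorus_of_dim m k H \<Longrightarrow> s \<in> H \<Longrightarrow> t \<in> H \<Longrightarrow> cmult s t \<in> H"
  using subgroup.m_closed[OF subtorus_of_dim_imp_subgroup] by fastforce

lemma subtorus_of_dim_cinv:
  assumes "subtorus_of_dim m k H" "s \<in> H"
  shows "cinv s \<in> H"
proof -
  obtain f where f: "torus_embedding k m f" and H: "H = f ` torus k"
    using assms(1) unfolding subtorus_of_dim_iff by blast
  then obtain r where r: "r \<in> torus k" "s = f r"
    using assms(2) by blast
  then have "cinv s = f (cinv r)"
    using torus_embedding_cinv[OF f] by simp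
  then show ?thesis
    using H r by simp
qed

lemma torus_0: "torus 0 = {\<lambda>_. 1}"
  by (auto simp: torus_def)

lemma subtorus_of_dim_0: "subtorus_of_dim m 0 H \<Longrightarrow> H = {\<lambda>_. 1}"
  by (auto simp: subtorus_of_dim_iff torus_0 torus_embedding_one)

text \<open>Isotropy groups of a link are isotropy groups of \<open>X\<close> seen inside the
  smaller torus that acts on the link. Composing a parametrisation of \<open>K\<close> with the
  inverse of \<open>e\<close> on its image keeps the dimension.\<close>

lemma subtorus_of_dim_preimage:
  assumes e: "torus_embedding k m e" and K: "subtorus_of_dim m d K" and sub: "K \<subseteq> e ` torus k"
  shows "subtorus_of_dim k d {r \<in> torus k. e r \<in> K}"
proof -
  obtain g where g: "torus_embedding d m g" and Kg: "K = g ` torus d"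
    using K by (auto simp: subtorus_of_dim_iff)
  obtain e' where e': "homeomorphic_maps (torus_space k) (top_of_set (e ` torus k)) e e'"
    using torus_embedding_homeomorphic_map[OF e] homeomorphic_map_maps by blast
  then have ce': "continuous_on (e ` torus k) e'" "e' ` e ` torus k \<subseteq> torus k"
    and e'e: "\<And>r. r \<in> torus k \<Longrightarrow> e' (e r) = r"
    by (auto simp: homeomorphic_maps_def continuous_map_in_subtopology)
  have ee': "e (e' x) = x" if "x \<in> e ` torus k" for x
    using that e'e by auto
  have hom: "e' (cmult x y) = cmult (e' x) (e' y)" if xy: "x \<in> e ` torus k" "y \<in> e ` torus k" for x y
  proof -
    obtain r s where rs: "r \<in> torus k" "s \<in> torus k" "x = e r" "y = e s" using xy by blast
    then have "cmult x y = e (cmult r s)" using e by (simp add: torus_embedding_def)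
    then show ?thesis using rs e'e by simp
  qed
  have gK: "g t \<in> e ` torus k" if "t \<in> torus d" for t
    using that Kg sub by blast
  have "torus_embedding d k (e' \<circ> g)"
    unfolding torus_embedding_def
  proof (intro conjI ballI)
    show "continuous_on (torus d) (e' \<circ> g)"
      using g ce' gK by (intro continuous_on_compose) (auto simp: torus_embedding_def intro: continuous_on_subset)
    show "(e' \<circ> g) ` torus d \<subseteq> torus k"
      using ce'(2) gK by auto
    show "(e' \<circ> g) (cmult s t) = cmult ((e' \<circ> g) s) ((e' \<circ> g) t)" if "s \<in> torus d" "t \<in> torus d" for s t
      using that g hom gK by (simp add: torus_embedding_def)
    show "inj_on (e' \<circ> g) (torus d)"
      using g gK by (auto simp: torus_embedding_def inj_on_def) (metis ee')
  qed
  moreover have "(e' \<circ> g) ` torus d = {r \<in> torus k. e r \<in> K}"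
  proof (intro Set.set_eqI iffI)
    fix r assume "r \<in> (e' \<circ> g) ` torus d"
    then show "r \<in> {r \<in> torus k. e r \<in> K}"
      using ce'(2) gK ee' Kg by auto
  next
    fix r assume "r \<in> {r \<in> torus k. e r \<in> K}"
    then obtain t where "t \<in> torus d" "e r = g t" "r \<in> torus k" using Kg by auto
    then show "r \<in> (e' \<circ> g) ` torus d"
      using e'e by (metis comp_apply imageI)
  qed
  ultimately show ?thesis
    by (auto simp: subtorus_of_dim_iff intro!: exI[of _ "e' \<circ> g"])
qed

section \<open>Automorphisms of tori as integer row operations\<close>

definition torus_aut :: "nat \<Rightarrow> (cvec \<Rightarrow> cvec) \<Rightarrow> bool" where
  "torus_aut m \<beta> \<longleftrightarrow> torus_embedding m m \<beta> \<and> \<beta> ` torus m = torus m"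

lemma torus_autI:
  assumes "continuous_on (torus m) \<beta>"
    and "\<And>s. s \<in> torus m \<Longrightarrow> \<beta> s \<in> torus m" "\<And>s. s \<in> torus m \<Longrightarrow> \<gamma> s \<in> torus m"
    and "\<And>s t. \<lbrakk>s \<in> torus m; t \<in> torus m\<rbrakk> \<Longrightarrow> \<beta> (cmult s t) = cmult (\<beta> s) (\<beta> t)"
    and "\<And>s. s \<in> torus m \<Longrightarrow> \<gamma> (\<beta> s) = s" "\<And>s. s \<in> torus m \<Longrightarrow> \<beta> (\<gamma> s) = s"
  shows "torus_aut m \<beta>"
proof -
  have "inj_on \<beta> (torus m)"
    by (rule inj_on_inverseI[where g = \<gamma>]) (use assms(5) in auto)
  moreover have "\<beta> ` torus m = torus m"
  proof (intro subset_antisym subsetI)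
    fix s assume "s \<in> torus m"
    then show "s \<in> \<beta> ` torus m"
      using assms(3,6) by (metis imageI)
  qed (use assms(2) in auto)
  ultimately show ?thesis
    using assms(1,4) by (simp add: torus_aut_def torus_embedding_def)
qed

lemma torus_aut_id: "torus_aut m id"
  by (rule torus_autI[where \<gamma> = id]) auto

lemma torus_aut_compose: "torus_aut m \<beta> \<Longrightarrow> torus_aut m \<gamma> \<Longrightarrow> torus_aut m (\<gamma> \<circ> \<beta>)"
  unfolding torus_aut_def by (metis image_comp torus_embedding_compose)

text \<open>A row operation on exponents: when the coordinates are powers of one variable,
  \<open>b j\<close> times row \<open>k\<close> is added to row \<open>j\<close> for every other
  \<open>j\<close> below \<open>m\<close>.\<close>

definition shear :: "nat \<Rightarrow> nat \<Rightarrow> (nat \<Rightarrow> int) \<Rightarrow> cvec \<Rightarrow> cvec" where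
  "shear m k b s = (\<lambda>j. if j < m \<and> j \<noteq> k then s j * s k powi b j else s j)"

lemma norm_power_int_1: "cmod z = 1 \<Longrightarrow> cmod (z powi a) = 1"
  by (simp add: norm_power_int)

lemma continuous_on_coord: "continuous_on S (\<lambda>s. s j :: 'b::topological_space)"
  by (rule continuous_on_product_then_coordinatewise[OF continuous_on_id])

text \<open>Coordinate \<open>k\<close> itself is unchanged, so the shear with negated exponents
  undoes the operation.\<close>

lemma torus_aut_shear:
  assumes "k < m"
  shows "torus_aut m (shear m k b)"
proof (rule torus_autI[where \<gamma> = "shear m k (\<lambda>j. - b j)"])
  show "continuous_on (torus m) (shear m k b)"
    unfolding shear_def
  proof (rule continuous_on_coordinatewise_then_product)
    fix j
    show "continuous_on (torus m) (\<lambda>s. if j < m \<and> j \<noteq> k then s j * s k powi b j else s j)"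
      by (cases "j < m \<and> j \<noteq> k") (auto intro!: continuous_intros continuous_on_coord simp: torus_nz)
  qed
  show "shear m k c s \<in> torus m" if "s \<in> torus m" for c s
    using that by (intro torusI) (auto simp: shear_def norm_mult norm_power_int_1 torus_norm torus_ge)
  then show "shear m k (\<lambda>j. - b j) s \<in> torus m" if "s \<in> torus m" for s
    using that .
  show "shear m k b (cmult s t) = cmult (shear m k b s) (shear m k b t)" for s t
    by (auto simp: shear_def cmult_def power_int_mult_distrib)
  show "shear m k (\<lambda>j. - b j) (shear m k b s) = s" if "s \<in> torus m" for s
    using torus_nz[OF that] by (auto simp: shear_def power_int_minus)
  show "shear m k b (shear m k (\<lambda>j. - b j) s) = s" if "s \<in> torus m" for s
    using torus_nz[OF that] by (auto simp: shear_def power_int_minus)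
qed

lemma torus_aut_invert: "torus_aut m (\<lambda>s. s(k := inverse (s k)))"
proof (rule torus_autI[where \<gamma> = "\<lambda>s. s(k := inverse (s k))"])
  show "continuous_on (torus m) (\<lambda>s. s(k := inverse (s k)))"
  proof (rule continuous_on_coordinatewise_then_product)
    fix j
    show "continuous_on (torus m) (\<lambda>s. (s(k := inverse (s k))) j)"
      by (cases "j = k") (auto intro!: continuous_intros continuous_on_coord simp: torus_nz)
  qed
  show "s(k := inverse (s k)) \<in> torus m" if "s \<in> torus m" for s
    using that by (auto intro!: torusI simp: torus_norm torus_ge norm_inverse)
  then show "s(k := inverse (s k)) \<in> torus m" if "s \<in> torus m" for s
    using that .
qed (auto simp: cmult_def)

definition axis_vec :: "nat \<Rightarrow> complex \<Rightarrow> cvec" where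
  "axis_vec k z = (\<lambda>_. 1)(k := z)"

lemma axis_vec_in_torus: "cmod z = 1 \<Longrightarrow> k < m \<Longrightarrow> axis_vec k z \<in> torus m"
  by (auto intro!: torusI simp: axis_vec_def)

lemma axis_vec_mult: "axis_vec k (z * w) = cmult (axis_vec k z) (axis_vec k w)"
  by (auto simp: axis_vec_def cmult_def)

text \<open>Restricted to the last coordinate circle, each coordinate of an embedding is an
  endomorphism of the circle and hence a power. The exponents form the column of an integer matrix
  to which row reduction applies.\<close>

lemma axis_vec_exponents:
  assumes f: "torus_embedding (Suc k) m f"
  obtains a :: "nat \<Rightarrow> int" where "\<And>z j. \<lbrakk>cmod z = 1; j < m\<rbrakk> \<Longrightarrow> f (axis_vec k z) j = z powi a j"
proof -
  have "\<exists>a::int. \<forall>z. cmod z = 1 \<longrightarrow> f (axis_vec k z) j = z powi a" for j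
  proof -
    have im: "f (axis_vec k z) \<in> torus m" if "cmod z = 1" for z
      using f axis_vec_in_torus[OF that, of k "Suc k"] by (auto simp: torus_embedding_def)
    have "continuous_on (sphere 0 1) (axis_vec k)"
    proof (rule continuous_on_coordinatewise_then_product)
      show "continuous_on (sphere 0 1) (\<lambda>z. axis_vec k z i)" for i
        by (cases "i = k") (auto simp: axis_vec_def)
    qed
    moreover have "continuous_on (torus (Suc k)) f"
      using f by (simp add: torus_embedding_def)
    moreover have "axis_vec k ` sphere 0 1 \<subseteq> torus (Suc k)"
      by (auto simp: axis_vec_in_torus)
    ultimately have "continuous_on (sphere 0 1) (\<lambda>z. f (axis_vec k z))"
      by (metis continuous_on_compose2)
    then have "continuous_on (sphere 0 1) (\<lambda>z. f (axis_vec k z) j)"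
      by (rule continuous_on_product_then_coordinatewise)
    moreover have "f (axis_vec k (z * w)) j = f (axis_vec k z) j * f (axis_vec k w) j"
      if "cmod z = 1" "cmod w = 1" for z w
      using f that axis_vec_in_torus[of _ k "Suc k"]
      by (simp add: torus_embedding_def axis_vec_mult cmult_apply)
    ultimately show ?thesis
      using circle_endomorphism[of "\<lambda>z. f (axis_vec k z) j"] torus_norm[OF im] by metis
  qed
  then have "\<exists>a :: nat \<Rightarrow> int. \<forall>j z. cmod z = 1 \<longrightarrow> f (axis_vec k z) j = z powi a j"
    by (intro choice) blast
  then show thesis using that by blast
qed

lemma shear_fixes_torus: "t \<in> torus k \<Longrightarrow> k \<le> i \<Longrightarrow> shear m i b t = t"
  by (auto simp: shear_def torus_ge)

text \<open>
  The Euclidean algorithm on the exponents of index \<open>\<ge> k\<close>: a shear by one of two nonzero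
  exponents makes the other one smaller.
\<close>

lemma reduce_exponents:
  assumes "torus_aut m \<beta>" and "\<And>t. t \<in> torus k \<Longrightarrow> \<beta> (f t) = t"
    and "\<And>z j. \<lbrakk>cmod z = 1; j < m\<rbrakk> \<Longrightarrow> \<beta> (f (axis_vec k z)) j = z powi a j"
  shows "\<exists>\<beta> a i. torus_aut m \<beta> \<and> (\<forall>t\<in>torus k. \<beta> (f t) = t) \<and>
    (\<forall>z j. cmod z = 1 \<longrightarrow> j < m \<longrightarrow> \<beta> (f (axis_vec k z)) j = z powi a j) \<and>
    (\<forall>j\<in>{k..<m}. j \<noteq> i \<longrightarrow> a j = 0)"
  using assms
proof (induction "\<Sum>j\<in>{k..<m}. nat \<bar>a j\<bar>" arbitrary: \<beta> a rule: less_induct)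
  case less
  show ?case
  proof (cases "\<exists>i\<in>{k..<m}. \<exists>j\<in>{k..<m}. i \<noteq> j \<and> a i \<noteq> 0 \<and> a j \<noteq> 0")
    case False
    then have "\<exists>i. \<forall>j\<in>{k..<m}. j \<noteq> i \<longrightarrow> a j = 0"
      by metis
    then show ?thesis
      using less.prems by blast
  next
    case True
    then obtain i j where ij: "i \<in> {k..<m}" "j \<in> {k..<m}" "i \<noteq> j" "a j \<noteq> 0" "\<bar>a j\<bar> \<le> \<bar>a i\<bar>"
      by (metis linorder_le_cases)
    \<comment> \<open>The sign that moves \<open>a i\<close> towards 0. Because \<open>a j\<close>
      is nonzero and not larger in absolute value than \<open>a i\<close>, the absolute value drops
      strictly.\<close>
    define c :: int where "c = (if sgn (a i) = sgn (a j) then -1 else 1)"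
    have c: "\<bar>a i + c * a j\<bar> < \<bar>a i\<bar>"
      using ij(4,5) by (auto simp: c_def sgn_if split: if_splits)
    define b where "b = (\<lambda>_. 0)(i := c)"
    define a' where "a' = a(i := a i + c * a j)"
    have aut: "torus_aut m (shear m j b \<circ> \<beta>)"
      using torus_aut_compose[OF less.prems(1) torus_aut_shear] ij by simp
    have "(\<Sum>l\<in>{k..<m}. nat \<bar>a' l\<bar>) < (\<Sum>l\<in>{k..<m}. nat \<bar>a l\<bar>)"
    proof (rule sum_strict_mono_ex1)
      show "\<forall>l\<in>{k..<m}. nat \<bar>a' l\<bar> \<le> nat \<bar>a l\<bar>"
        using c by (auto simp: a'_def)
      show "\<exists>l\<in>{k..<m}. nat \<bar>a' l\<bar> < nat \<bar>a l\<bar>"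
        using c ij(1) by (intro bexI[of _ i]) (auto simp: a'_def)
    qed simp
    moreover have "(shear m j b \<circ> \<beta>) (f t) = t" if "t \<in> torus k" for t
      using less.prems(2)[OF that] shear_fixes_torus[OF that] ij(2) by simp
    moreover have "(shear m j b \<circ> \<beta>) (f (axis_vec k z)) l = z powi a' l" if "cmod z = 1" "l < m" for z l
    proof -
      have "z \<noteq> 0" using that(1) by auto
      then show ?thesis
        using less.prems(3)[OF that] less.prems(3)[OF that(1), of i] less.prems(3)[OF that(1), of j] ij that(2)
        by (auto simp: shear_def b_def a'_def power_int_add power_int_mult mult.commute[of c])
    qed
    ultimately show ?thesis
      by (rule less.hyps[OF _ aut])
  qed
qed

text \<open>Induction on \<open>k\<close>: with the first \<open>k\<close> circles already straight,
  the last one is straightened by automorphisms that fix \<open>torus k\<close> pointwise. Row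
  reduction leaves at most one nonzero exponent of index at least \<open>k\<close>, and injectivity
  forces it to be 1 or -1, since otherwise some nontrivial point of the last circle would land in
  \<open>torus k\<close>.\<close>

theorem torus_embedding_standard:
  assumes "torus_embedding k m f" "k \<le> m"
  shows "\<exists>\<beta>. torus_aut m \<beta> \<and> (\<forall>t\<in>torus k. \<beta> (f t) = t)"
  using assms
proof (induction k)
  case 0
  then show ?case
    using torus_aut_id[of m] torus_embedding_one[of 0 m f] by (auto simp: torus_0)
next
  case (Suc k)
  have km: "k < m" using Suc.prems by simp
  have sub: "torus k \<subseteq> torus (Suc k)" by (simp add: torus_mono)
  have "torus_embedding k m f"
    using Suc.prems(1) sub unfolding torus_embedding_def
    by (meson continuous_on_subset image_mono inj_on_subset subset_iff subset_trans)
  then obtain \<beta>0 where \<beta>0: "torus_aut m \<beta>0" "\<And>t. t \<in> torus k \<Longrightarrow> \<beta>0 (f t) = t"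
    using Suc.IH km by auto
  have emb0: "torus_embedding (Suc k) m (\<beta>0 \<circ> f)"
    using Suc.prems(1) \<beta>0(1) torus_embedding_compose by (auto simp: torus_aut_def)
  obtain a0 where a0: "\<And>z j. \<lbrakk>cmod z = 1; j < m\<rbrakk> \<Longrightarrow> \<beta>0 (f (axis_vec k z)) j = z powi a0 j"
    by (rule axis_vec_exponents[OF emb0]) auto
  obtain \<beta> a i where \<beta>: "torus_aut m \<beta>" and fx: "\<And>t. t \<in> torus k \<Longrightarrow> \<beta> (f t) = t"
    and a: "\<And>z j. \<lbrakk>cmod z = 1; j < m\<rbrakk> \<Longrightarrow> \<beta> (f (axis_vec k z)) j = z powi a j"
    and ai: "\<And>j. \<lbrakk>k \<le> j; j < m; j \<noteq> i\<rbrakk> \<Longrightarrow> a j = 0"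
    using reduce_exponents[where \<beta> = \<beta>0 and k = k and f = f and a = a0, OF \<beta>0 a0]
    by (metis atLeastLessThan_iff)
  have emb: "torus_embedding (Suc k) m (\<beta> \<circ> f)"
    using Suc.prems(1) \<beta> torus_embedding_compose by (auto simp: torus_aut_def)
  \<comment> \<open>The hypothesis puts the image of \<open>axis_vec k z\<close> into
    \<open>torus k\<close>, where \<open>\<beta> \<circ> f\<close> is the identity. By injectivity
    \<open>axis_vec k z\<close> then equals this point of \<open>torus k\<close>, so its coordinate
    \<open>k\<close> is 1.\<close>
  have nontriv: "z = 1" if z: "cmod z = 1" "\<And>j. k \<le> j \<Longrightarrow> j < m \<Longrightarrow> z powi a j = 1" for z
  proof -
    define u where "u = \<beta> (f (axis_vec k z))"
    have av: "axis_vec k z \<in> torus (Suc k)"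
      using z by (simp add: axis_vec_in_torus)
    have um: "u \<in> torus m"
      using emb av by (auto simp: torus_embedding_def u_def)
    have "u j = 1" if "j \<ge> k" for j
    proof (cases "j < m")
      case True
      then show ?thesis using a[OF z(1) True] z(2)[OF that True] by (simp add: u_def)
    qed (use um torus_ge in auto)
    then have uk: "u \<in> torus k"
      using um by (auto intro!: torusI simp: torus_norm)
    then have "(\<beta> \<circ> f) u = (\<beta> \<circ> f) (axis_vec k z)"
      using fx by (simp add: u_def)
    then have "u = axis_vec k z"
      using emb av uk sub unfolding torus_embedding_def by (meson inj_onD subsetD)
    then have "u k = z" by (simp add: axis_vec_def)
    then show "z = 1" using torus_ge[OF uk, of k] by simp
  qed
  \<comment> \<open>If all exponents of index at least \<open>k\<close> vanished,
    \<open>z = -1\<close> would contradict \<open>nontriv\<close>; hence the exceptional index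
    \<open>i\<close> does lie in the range.\<close>
  have im: "k \<le> i" "i < m"
  proof -
    have "\<not> (\<forall>j. k \<le> j \<longrightarrow> j < m \<longrightarrow> a j = 0)"
    proof
      assume "\<forall>j. k \<le> j \<longrightarrow> j < m \<longrightarrow> a j = 0"
      then show False using nontriv[of "-1"] by simp
    qed
    then show "k \<le> i" "i < m" using ai by metis+
  qed
  \<comment> \<open>A nontrivial root of unity of order the absolute value of \<open>a i\<close>, or
    -1 when \<open>a i\<close> is 0, would contradict \<open>nontriv\<close>.\<close>
  have unit: "\<bar>a i\<bar> = 1"
  proof (rule ccontr)
    assume ne: "\<bar>a i\<bar> \<noteq> 1"
    define z where "z = cis (2 * pi / of_int (a i))"
    show False
    proof (cases "a i = 0")
      case True
      then show False using nontriv[of "-1"] ai by (metis norm_minus_cancel norm_one one_neq_neg_one power_int_0_right)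
    next
      case False
      have "z powi a i = 1"
        using False by (simp add: z_def cis_power_int)
      then have "z powi a j = 1" if "k \<le> j" "j < m" for j
        using ai[OF that] by (cases "j = i") auto
      then have "z = 1" using nontriv[of z] by (simp add: z_def)
      then have "cos (2 * pi / of_int (a i)) = 1"
        by (simp add: z_def complex_eq_iff)
      then obtain n :: int where "2 * pi / of_int (a i) = of_int n * 2 * pi"
        by (metis cos_one_2pi_int)
      then have "(1 :: real) = of_int (n * a i)"
        using False by (simp add: field_simps)
      then have "n * a i = 1" by linarith
      then show False using ne zmult_eq_1_iff by auto
    qed
  qed
  \<comment> \<open>Once the exponent of index \<open>k\<close> is 1, a single shear clears all the others.\<close>
  obtain \<beta>1 a1 where \<beta>1: "torus_aut m \<beta>1" and fix1: "\<And>t. t \<in> torus k \<Longrightarrow> \<beta>1 (f t) = t"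
    and a1: "\<And>z j. \<lbrakk>cmod z = 1; j < m\<rbrakk> \<Longrightarrow> \<beta>1 (f (axis_vec k z)) j = z powi a1 j"
    and a1k: "a1 k = 1"
  proof (cases "i = k")
    case True
    \<comment> \<open>Only the sign of the exponent is left to correct, by inverting coordinate
      \<open>k\<close>.\<close>
    define \<beta>1 where "\<beta>1 = (if a i = 1 then \<beta> else (\<lambda>s. s(k := inverse (s k))) \<circ> \<beta>)"
    show thesis
    proof (rule that[of \<beta>1 "a(k := 1)"])
      show "torus_aut m \<beta>1"
        using \<beta> torus_aut_compose[OF \<beta> torus_aut_invert] by (simp add: \<beta>1_def)
      show "\<beta>1 (f t) = t" if "t \<in> torus k" for t
        using fx[OF that] torus_ge[OF that, of k] by (auto simp: \<beta>1_def fun_eq_iff)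
      show "\<beta>1 (f (axis_vec k z)) j = z powi (a(k := 1)) j" if "cmod z = 1" "j < m" for z j
      proof -
        have "a k = 1 \<or> a k = -1" using unit True by auto
        then show ?thesis
          using a[OF that] a[OF that(1) km] True by (auto simp: \<beta>1_def power_int_minus)
      qed
    qed simp
  next
    case False
    then have ak: "a k = 0" using ai km by auto
    \<comment> \<open>Adding \<open>a i\<close> times row \<open>i\<close> to row \<open>k\<close>,
      whose exponent is 0, produces \<open>a i * a i\<close>, which is 1.\<close>
    define \<beta>1 where "\<beta>1 = shear m i ((\<lambda>_. 0)(k := a i)) \<circ> \<beta>"
    show thesis
    proof (rule that[of \<beta>1 "a(k := 1)"])
      show "torus_aut m \<beta>1"
        unfolding \<beta>1_def using im by (intro torus_aut_compose \<beta> torus_aut_shear)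
      show "\<beta>1 (f t) = t" if "t \<in> torus k" for t
        using fx[OF that] shear_fixes_torus[OF that im(1)] by (simp add: \<beta>1_def)
      show "\<beta>1 (f (axis_vec k z)) j = z powi (a(k := 1)) j" if "cmod z = 1" "j < m" for z j
      proof -
        have "a i * a i = 1" using unit by (metis abs_mult_self_eq mult_1)
        then show ?thesis
          using a[OF that] a[OF that(1) km] a[OF that(1) im(2)] False ak that(2)
          by (auto simp: \<beta>1_def shear_def simp flip: power_int_mult)
      qed
    qed simp
  qed
  define \<beta>2 where "\<beta>2 = shear m k (\<lambda>j. - a1 j) \<circ> \<beta>1"
  have aut2: "torus_aut m \<beta>2"
    unfolding \<beta>2_def by (intro torus_aut_compose \<beta>1 torus_aut_shear km)
  have fix2: "\<beta>2 (f t) = t" if "t \<in> torus k" for t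
    using fix1[OF that] shear_fixes_torus[OF that] by (simp add: \<beta>2_def)
  have ax2: "\<beta>2 (f (axis_vec k z)) = axis_vec k z" if z: "cmod z = 1" for z
  proof
    fix j
    have "\<beta>1 (f (axis_vec k z)) \<in> torus m"
      using Suc.prems(1) \<beta>1 axis_vec_in_torus[OF z, of k "Suc k"]
      by (auto simp: torus_aut_def torus_embedding_def)
    moreover have "z \<noteq> 0" using z by auto
    ultimately show "\<beta>2 (f (axis_vec k z)) j = axis_vec k z j"
      using a1[OF z, of j] a1[OF z km] a1k km torus_ge
      by (cases "j < m") (auto simp: \<beta>2_def shear_def axis_vec_def power_int_minus)
  qed
  \<comment> \<open>\<open>t\<close> is the product of an element of \<open>torus k\<close> and a
    point of the last circle, and \<open>\<beta>2 \<circ> f\<close> is the identity on both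
    factors.\<close>
  have "\<beta>2 (f t) = t" if t: "t \<in> torus (Suc k)" for t
  proof -
    define t0 where "t0 = t(k := 1)"
    have t0: "t0 \<in> torus k"
      unfolding t0_def using t by (auto intro!: torusI simp: torus_norm torus_ge)
    have ax: "axis_vec k (t k) \<in> torus (Suc k)"
      using t by (simp add: axis_vec_in_torus torus_norm)
    have tt: "t = cmult t0 (axis_vec k (t k))"
      by (auto simp: t0_def axis_vec_def cmult_def)
    have "f t = cmult (f t0) (f (axis_vec k (t k)))"
      using Suc.prems(1) t0 sub ax by (subst tt) (auto simp: torus_embedding_def)
    moreover have "f t0 \<in> torus m" "f (axis_vec k (t k)) \<in> torus m"
      using Suc.prems(1) t0 sub ax by (auto simp: torus_embedding_def)
    ultimately have "\<beta>2 (f t) = cmult (\<beta>2 (f t0)) (\<beta>2 (f (axis_vec k (t k))))"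
      using aut2 by (auto simp: torus_embedding_def torus_aut_def)
    then show ?thesis
      using fix2[OF t0] ax2[of "t k"] tt torus_norm[OF t] by simp
  qed
  then show ?case using aut2 by blast
qed


text \<open>
  The last factor \<open>U(1)^k\<close> is placed first among the coordinates, which is where
  \<open>torus_embedding_standard\<close> moves a subtorus of dimension \<open>k\<close>.
\<close>

definition slice3 :: "nat \<Rightarrow> nat \<Rightarrow> nat \<Rightarrow> cvec \<Rightarrow> cvec \<times> cvec \<times> cvec" where
  "slice3 i d k s = ((\<lambda>j. if j < i then s (k + j) else 1), (\<lambda>j. if j < d then s (k + i + j) else 1),
     (\<lambda>j. if j < k then s j else 1))"

definition glue3 :: "nat \<Rightarrow> nat \<Rightarrow> nat \<Rightarrow> cvec \<times> cvec \<times> cvec \<Rightarrow> cvec" where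
  "glue3 i d k = (\<lambda>(s, u, r) j. if j < k then r j else if j < k + i then s (j - k)
     else if j < k + i + d then u (j - k - i) else 1)"

lemma slice3_in_torus: "s \<in> torus m \<Longrightarrow> slice3 i d k s \<in> torus i \<times> torus d \<times> torus k"
  by (auto simp: slice3_def torus_norm intro!: torusI)

lemma glue3_in_torus:
  assumes "p \<in> torus i \<times> torus d \<times> torus k" "m = i + d + k"
  shows "glue3 i d k p \<in> torus m"
  using assms by (auto simp: glue3_def torus_norm intro!: torusI)

lemma glue3_slice3: "s \<in> torus (i + d + k) \<Longrightarrow> glue3 i d k (slice3 i d k s) = s"
  by (auto simp: glue3_def slice3_def torus_ge fun_eq_iff)

lemma slice3_glue3: "p \<in> torus i \<times> torus d \<times> torus k \<Longrightarrow> slice3 i d k (glue3 i d k p) = p"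
  by (auto simp: glue3_def slice3_def torus_ge fun_eq_iff)

lemma continuous_map_slice3:
  "continuous_map (torus_space m) (prod_topology (torus_space i) (prod_topology (torus_space d) (torus_space k)))
     (slice3 i d k)"
proof -
  have co: "continuous_map (torus_space m) euclidean (\<lambda>s. if P then s j else 1)" for P j
    by (cases P) (simp_all add: continuous_on_coord)
  have "\<And>s. s \<in> torus m \<Longrightarrow> slice3 i d k s \<in> torus i \<times> torus d \<times> torus k"
    by (rule slice3_in_torus)
  then have "continuous_map (torus_space m) (torus_space i) (\<lambda>s. \<lambda>j. if j < i then s (k + j) else 1)"
    "continuous_map (torus_space m) (torus_space d) (\<lambda>s. \<lambda>j. if j < d then s (k + i + j) else 1)"
    "continuous_map (torus_space m) (torus_space k) (\<lambda>s. \<lambda>j. if j < k then s j else 1)"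
    unfolding continuous_map_cvec_iff using co by (auto simp: slice3_def)
  then show ?thesis
    unfolding slice3_def by (simp only: continuous_map_paired)
qed

text \<open>The automorphism that makes \<open>H\<close> standard turns it into the subgroup of the
  first \<open>k\<close> coordinates; cutting the coordinates into three blocks then splits it off
  as a direct factor.\<close>

theorem torus_splitting:
  assumes H: "subtorus_of_dim m k H" and m: "m = i + d + k"
  obtains \<alpha> where
    "top_group_iso (torus_group m) (torus_space m) (torus_group i \<times>\<times> torus_group d \<times>\<times> torus_group k)
       (prod_topology (torus_space i) (prod_topology (torus_space d) (torus_space k))) \<alpha>"
    "\<alpha> ` H = {\<lambda>_. 1} \<times> {\<lambda>_. 1} \<times> torus k"
proof -
  obtain f where f: "torus_embedding k m f" and Hf: "H = f ` torus k"
    using H unfolding subtorus_of_dim_iff by blast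
  obtain \<beta> where \<beta>: "torus_aut m \<beta>" and fx: "\<And>t. t \<in> torus k \<Longrightarrow> \<beta> (f t) = t"
    using torus_embedding_standard[OF f] m by auto
  define \<alpha> where "\<alpha> = slice3 i d k \<circ> \<beta>"
  have bm: "\<beta> s \<in> torus m" if "s \<in> torus m" for s
    using \<beta> that by (auto simp: torus_aut_def)
  have bij: "bij_betw (slice3 i d k) (torus m) (torus i \<times> torus d \<times> torus k)"
  proof (rule bij_betw_byWitness[where f' = "glue3 i d k"])
    show "slice3 i d k ` torus m \<subseteq> torus i \<times> torus d \<times> torus k"
      using slice3_in_torus by blast
    show "glue3 i d k ` (torus i \<times> torus d \<times> torus k) \<subseteq> torus m"
      using glue3_in_torus[OF _ m] by blast
  qed (use m in \<open>auto simp: glue3_slice3 slice3_glue3\<close>)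
  have bij2: "bij_betw \<beta> (torus m) (torus m)"
    using \<beta> by (auto simp: torus_aut_def torus_embedding_def bij_betw_def)
  have bija: "bij_betw \<alpha> (torus m) (torus i \<times> torus d \<times> torus k)"
    unfolding \<alpha>_def by (rule bij_betw_trans[OF bij2 bij])
  have "\<alpha> (cmult s t) = (case (\<alpha> s, \<alpha> t) of ((a, b, c), (a', b', c')) \<Rightarrow> (cmult a a', cmult b b', cmult c c'))"
    if "s \<in> torus m" "t \<in> torus m" for s t
    using \<beta> that by (auto simp: torus_aut_def torus_embedding_def \<alpha>_def slice3_def cmult_def fun_eq_iff)
  then have "\<alpha> \<in> hom (torus_group m) (torus_group i \<times>\<times> torus_group d \<times>\<times> torus_group k)"
    using bij_betwE[OF bija] by (auto simp: hom_def DirProd_def split: prod.splits)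
  then have "\<alpha> \<in> iso (torus_group m) (torus_group i \<times>\<times> torus_group d \<times>\<times> torus_group k)"
    using bija by (simp add: iso_def)
  moreover have "homeomorphic_map (torus_space m)
      (prod_topology (torus_space i) (prod_topology (torus_space d) (torus_space k))) \<alpha>"
  proof (rule continuous_imp_homeomorphic_map)
    have "continuous_map (torus_space m) (torus_space m) \<beta>"
      using \<beta> by (auto simp: torus_aut_def torus_embedding_def continuous_map_in_subtopology)
    then show "continuous_map (torus_space m)
        (prod_topology (torus_space i) (prod_topology (torus_space d) (torus_space k))) \<alpha>"
      unfolding \<alpha>_def by (rule continuous_map_compose[OF _ continuous_map_slice3])
  qed (use bija in \<open>auto simp: bij_betw_def Hausdorff_space_subtopology\<close>)
  moreover have "\<alpha> ` H = {\<lambda>_. 1} \<times> {\<lambda>_. 1} \<times> torus k"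
  proof -
    have "\<alpha> (f t) = ((\<lambda>_. 1), (\<lambda>_. 1), t)" if t: "t \<in> torus k" for t
      using fx[OF t] torus_ge[OF t] by (auto simp: \<alpha>_def slice3_def fun_eq_iff)
    then show ?thesis
      unfolding Hf image_image by (auto intro!: image_eqI)
  qed
  ultimately show thesis
    using that by (simp add: top_group_iso_def)
qed

section \<open>Coordinates adapted to a subtorus\<close>

locale split_torus =
  fixes m k i d :: nat and H :: "cvec set" and \<alpha> :: "cvec \<Rightarrow> cvec \<times> cvec \<times> cvec" and f
  assumes H: "subtorus_of_dim m k H"
    and iso: "top_group_iso (torus_group m) (torus_space m) (torus_group i \<times>\<times> torus_group d \<times>\<times> torus_group k)
       (prod_topology (torus_space i) (prod_topology (torus_space d) (torus_space k))) \<alpha>"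
    and image_H: "\<alpha> ` H = {\<lambda>_. 1} \<times> {\<lambda>_. 1} \<times> torus k"
    and maps: "homeomorphic_maps (torus_space m)
       (prod_topology (torus_space i) (prod_topology (torus_space d) (torus_space k))) \<alpha> f"
begin

abbreviation "T3 \<equiv> torus i \<times> torus d \<times> torus k"

lemma \<alpha>_in: "t \<in> torus m \<Longrightarrow> \<alpha> t \<in> T3"
  and f_in: "p \<in> T3 \<Longrightarrow> f p \<in> torus m"
  and f_\<alpha>: "t \<in> torus m \<Longrightarrow> f (\<alpha> t) = t"
  and \<alpha>_f: "p \<in> T3 \<Longrightarrow> \<alpha> (f p) = p"
  using maps by (auto simp: homeomorphic_maps_def continuous_map_def Pi_iff)

lemma \<alpha>_cmult:
  assumes "s \<in> torus m" "t \<in> torus m"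
  shows "\<alpha> (cmult s t) = (cmult (fst (\<alpha> s)) (fst (\<alpha> t)), cmult (fst (snd (\<alpha> s))) (fst (snd (\<alpha> t))),
    cmult (snd (snd (\<alpha> s))) (snd (snd (\<alpha> t))))"
proof -
  have "\<alpha> \<in> hom (torus_group m) (torus_group i \<times>\<times> torus_group d \<times>\<times> torus_group k)"
    using iso by (simp add: top_group_iso_def iso_def)
  then have "\<alpha> (s \<otimes>\<^bsub>torus_group m\<^esub> t) = \<alpha> s \<otimes>\<^bsub>torus_group i \<times>\<times> torus_group d \<times>\<times> torus_group k\<^esub> \<alpha> t"
    using assms by (simp only: hom_def mem_Collect_eq torus_group_simps(1))
  then show ?thesis by (simp add: mult_DirProd' split_beta)
qed

lemma f_cmult:
  assumes "(s, u, r) \<in> T3" "(s', u', r') \<in> T3"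
  shows "f (cmult s s', cmult u u', cmult r r') = cmult (f (s, u, r)) (f (s', u', r'))"
proof -
  have "\<alpha> (cmult (f (s, u, r)) (f (s', u', r'))) = (cmult s s', cmult u u', cmult r r')"
    using \<alpha>_cmult[OF f_in[OF assms(1)] f_in[OF assms(2)]] assms by (simp add: \<alpha>_f)
  then show ?thesis
    using f_\<alpha>[of "cmult (f (s, u, r)) (f (s', u', r'))"] f_in assms by (metis cmult_in_torus)
qed

lemma in_H_iff:
  assumes "t \<in> torus m"
  shows "t \<in> H \<longleftrightarrow> fst (\<alpha> t) = (\<lambda>_. 1) \<and> fst (snd (\<alpha> t)) = (\<lambda>_. 1)"
proof
  assume "t \<in> H"
  then have "\<alpha> t \<in> {\<lambda>_. 1} \<times> {\<lambda>_. 1} \<times> torus k" using image_H by blast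
  then show "fst (\<alpha> t) = (\<lambda>_. 1) \<and> fst (snd (\<alpha> t)) = (\<lambda>_. 1)" by auto
next
  assume *: "fst (\<alpha> t) = (\<lambda>_. 1) \<and> fst (snd (\<alpha> t)) = (\<lambda>_. 1)"
  have "\<alpha> t \<in> {\<lambda>_. 1} \<times> {\<lambda>_. 1} \<times> torus k"
    using \<alpha>_in[OF assms] * by (cases "\<alpha> t") auto
  then obtain h where h: "h \<in> H" "\<alpha> t = \<alpha> h" using image_H by (metis imageE)
  then show "t \<in> H" using f_\<alpha>[OF assms] f_\<alpha>[of h] subtorus_of_dim_subset[OF H] by auto
qed

text \<open>The identification of the standard torus of dimension \<open>k\<close> with
  \<open>H\<close>. It is through this map that the standard torus acts on the link.\<close>

definition \<iota> :: "cvec \<Rightarrow> cvec" where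
  "\<iota> r = f ((\<lambda>_. 1), (\<lambda>_. 1), r)"

lemma \<iota>_in: "r \<in> torus k \<Longrightarrow> \<iota> r \<in> torus m"
  unfolding \<iota>_def by (rule f_in) simp

lemma \<iota>_cmult: "r \<in> torus k \<Longrightarrow> r' \<in> torus k \<Longrightarrow> \<iota> (cmult r r') = cmult (\<iota> r) (\<iota> r')"
  unfolding \<iota>_def using f_cmult[of "\<lambda>_. 1" "\<lambda>_. 1" r "\<lambda>_. 1" "\<lambda>_. 1" r'] by simp

lemma \<alpha>_\<iota>: "r \<in> torus k \<Longrightarrow> \<alpha> (\<iota> r) = ((\<lambda>_. 1), (\<lambda>_. 1), r)"
  unfolding \<iota>_def by (rule \<alpha>_f) simp

lemma \<iota>_image: "\<iota> ` torus k = H"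
proof (intro subset_antisym subsetI)
  fix h assume "h \<in> \<iota> ` torus k"
  then show "h \<in> H" using in_H_iff[OF \<iota>_in] \<alpha>_\<iota> by auto
next
  fix h assume h: "h \<in> H"
  then have hm: "h \<in> torus m" using subtorus_of_dim_subset[OF H] by blast
  obtain a b r where r: "\<alpha> h = (a, b, r)" by (cases "\<alpha> h")
  then have "h = \<iota> r" "r \<in> torus k"
    using in_H_iff[OF hm] h f_\<alpha>[OF hm] \<alpha>_in[OF hm] by (auto simp: \<iota>_def)
  then show "h \<in> \<iota> ` torus k" by blast
qed

lemma \<iota>_continuous: "continuous_map (torus_space k) (torus_space m) \<iota>"
proof -
  have "continuous_map (torus_space k) (prod_topology (torus_space i) (prod_topology (torus_space d) (torus_space k)))
      (\<lambda>r. ((\<lambda>_. 1), (\<lambda>_. 1), r))"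
    unfolding continuous_map_paired by simp
  moreover have "continuous_map (prod_topology (torus_space i) (prod_topology (torus_space d) (torus_space k)))
      (torus_space m) f"
    using maps by (simp only: homeomorphic_maps_def)
  ultimately have "continuous_map (torus_space k) (torus_space m) (f \<circ> (\<lambda>r. ((\<lambda>_. 1), (\<lambda>_. 1), r)))"
    by (rule continuous_map_compose)
  moreover have "f \<circ> (\<lambda>r. ((\<lambda>_. 1), (\<lambda>_. 1), r)) = \<iota>"
    by (simp add: fun_eq_iff \<iota>_def)
  ultimately show ?thesis by simp
qed

lemma \<iota>_embedding: "torus_embedding k m \<iota>"
  unfolding torus_embedding_def
proof (intro conjI ballI)
  show "continuous_on (torus k) \<iota>"
    using \<iota>_continuous by (simp add: continuous_map_in_subtopology)
  show "inj_on \<iota> (torus k)"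
    using \<alpha>_\<iota> by (intro inj_onI) (metis prod.inject)
qed (use \<iota>_in \<iota>_cmult in auto)

text \<open>The cosets of \<open>H\<close> are the fibres of the first two components of
  \<open>\<alpha>\<close>. This turns isotropy conditions into equations between
  coordinates.\<close>

lemma \<alpha>_cinv_cmult:
  assumes s: "s \<in> torus m" and t: "t \<in> torus m"
  shows "cmult (cinv s) t \<in> H \<longleftrightarrow> fst (\<alpha> s) = fst (\<alpha> t) \<and> fst (snd (\<alpha> s)) = fst (snd (\<alpha> t))"
proof -
  define h where "h = cmult (cinv s) t"
  have h: "h \<in> torus m" using s t by (simp add: h_def)
  have ts: "t = cmult s h" using s by (simp add: h_def)
  have "fst (\<alpha> s) \<in> torus i" "fst (snd (\<alpha> s)) \<in> torus d" using \<alpha>_in[OF s] by auto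
  then have "fst (\<alpha> s) = fst (\<alpha> t) \<longleftrightarrow> fst (\<alpha> h) = (\<lambda>_. 1)"
    "fst (snd (\<alpha> s)) = fst (snd (\<alpha> t)) \<longleftrightarrow> fst (snd (\<alpha> h)) = (\<lambda>_. 1)"
    unfolding ts \<alpha>_cmult[OF s h] fst_conv snd_conv
    by (metis cmult_left_cancel cmult_one(2))+
  then show ?thesis using in_H_iff[OF h] by (simp add: h_def)
qed

end

lemma split_torus_exists:
  assumes "subtorus_of_dim m k H" "m = i + d + k"
  obtains \<alpha> f where "split_torus m k i d H \<alpha> f"
proof -
  obtain \<alpha> where \<alpha>: "top_group_iso (torus_group m) (torus_space m) (torus_group i \<times>\<times> torus_group d \<times>\<times> torus_group k)
       (prod_topology (torus_space i) (prod_topology (torus_space d) (torus_space k))) \<alpha>"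
    "\<alpha> ` H = {\<lambda>_. 1} \<times> {\<lambda>_. 1} \<times> torus k"
    by (rule torus_splitting[OF assms])
  then obtain f where "homeomorphic_maps (torus_space m)
       (prod_topology (torus_space i) (prod_topology (torus_space d) (torus_space k))) \<alpha> f"
    using homeomorphic_map_maps unfolding top_group_iso_def by blast
  then show thesis using that \<alpha> assms(1) by (simp add: split_torus_def)
qed

section \<open>Topological manifolds\<close>

lemma second_countable_prod_topology:
  assumes "second_countable X" "second_countable Y"
  shows "second_countable (prod_topology X Y)"
proof -
  obtain A where A: "countable A" "\<And>V. V \<in> A \<Longrightarrow> openin X V"
    "\<And>U x. openin X U \<Longrightarrow> x \<in> U \<Longrightarrow> \<exists>V\<in>A. x \<in> V \<and> V \<subseteq> U"
    using assms(1) unfolding second_countable_def by metis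
  obtain B where B: "countable B" "\<And>V. V \<in> B \<Longrightarrow> openin Y V"
    "\<And>U x. openin Y U \<Longrightarrow> x \<in> U \<Longrightarrow> \<exists>V\<in>B. x \<in> V \<and> V \<subseteq> U"
    using assms(2) unfolding second_countable_def by metis
  show ?thesis
    unfolding second_countable_def
  proof (intro exI conjI allI impI ballI)
    show "countable ((\<lambda>(V, W). V \<times> W) ` (A \<times> B))"
      using A(1) B(1) by (intro countable_image countable_SIGMA)
    show "openin (prod_topology X Y) V" if "V \<in> (\<lambda>(V, W). V \<times> W) ` (A \<times> B)" for V
      using that A(2) B(2) by (auto simp: openin_prod_Times_iff)
    fix U z assume Uz: "openin (prod_topology X Y) U \<and> z \<in> U"
    obtain x y where z: "z = (x, y)" by force
    then obtain V W where VW: "openin X V" "openin Y W" "x \<in> V" "y \<in> W" "V \<times> W \<subseteq> U"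
      using Uz openin_prod_topology_alt[of X Y U] by blast
    obtain V' where V': "V' \<in> A" "x \<in> V'" "V' \<subseteq> V" using A(3)[OF VW(1,3)] by blast
    obtain W' where W': "W' \<in> B" "y \<in> W'" "W' \<subseteq> W" using B(3)[OF VW(2,4)] by blast
    show "\<exists>V\<in>(\<lambda>(V, W). V \<times> W) ` (A \<times> B). z \<in> V \<and> V \<subseteq> U"
      using V' W' VW(5) z by (intro bexI[of _ "V' \<times> W'"]) auto
  qed
qed

lemma second_countable_Euclidean_space: "second_countable (Euclidean_space k)"
  unfolding Euclidean_space_def euclidean_product_topology
  by (intro second_countable_subtopology second_countable_euclidean)

lemma topological_manifold_Euclidean_space: "topological_manifold k (Euclidean_space k)"
  unfolding topological_manifold_def
proof (intro conjI ballI)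
  fix x assume x: "x \<in> topspace (Euclidean_space k)"
  show "\<exists>U V. openin (Euclidean_space k) U \<and> x \<in> U \<and> openin (Euclidean_space k) V \<and>
      subtopology (Euclidean_space k) U homeomorphic_space subtopology (Euclidean_space k) V"
    using x homeomorphic_space_refl openin_topspace by blast
qed (simp_all add: Hausdorff_Euclidean_space second_countable_Euclidean_space)

lemma homeomorphic_space_open_restriction:
  assumes "homeomorphic_maps X Y f g" "openin X U"
  shows "openin Y (f ` U)" "subtopology X U homeomorphic_space subtopology Y (f ` U)"
proof -
  have f: "homeomorphic_map X Y f"
    using assms(1) homeomorphic_maps_map by blast
  then show "openin Y (f ` U)"
    using assms(2) homeomorphic_map_openness openin_subset by metis
  have "U \<subseteq> topspace X"
    by (rule openin_subset[OF assms(2)])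
  moreover have "f ` U \<subseteq> topspace Y"
    using calculation homeomorphic_imp_surjective_map[OF f] by blast
  ultimately have "f ` (topspace X \<inter> U) = topspace Y \<inter> f ` U"
    by (simp add: Int_absorb1)
  then show "subtopology X U homeomorphic_space subtopology Y (f ` U)"
    by (rule homeomorphic_map_imp_homeomorphic_space[OF homeomorphic_map_subtopologies[OF f]])
qed

lemma topological_manifold_openin:
  assumes X: "topological_manifold k X" and W: "openin X W"
  shows "topological_manifold k (subtopology X W)"
  unfolding topological_manifold_def
proof (intro conjI ballI)
  show "Hausdorff_space (subtopology X W)" "second_countable (subtopology X W)"
    using X by (auto simp: topological_manifold_def Hausdorff_space_subtopology second_countable_subtopology)
  fix x assume "x \<in> topspace (subtopology X W)"
  then have x: "x \<in> topspace X" "x \<in> W" by auto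
  then obtain U V where UV: "openin X U" "x \<in> U" "openin (Euclidean_space k) V"
      "subtopology X U homeomorphic_space subtopology (Euclidean_space k) V"
    using X unfolding topological_manifold_def by metis
  then obtain f g where fg: "homeomorphic_maps (subtopology X U) (subtopology (Euclidean_space k) V) f g"
    by (auto simp: homeomorphic_space_def)
  have o: "openin (subtopology X U) (U \<inter> W)"
    using W by (rule openin_subtopology_Int2)
  have fV: "openin (Euclidean_space k) (f ` (U \<inter> W))"
    using homeomorphic_space_open_restriction(1)[OF fg o] UV(3) openin_trans_full by blast
  have "f ` (U \<inter> W) \<subseteq> V"
    using openin_subset[OF homeomorphic_space_open_restriction(1)[OF fg o]] by auto
  then have "subtopology (subtopology X W) (U \<inter> W) homeomorphic_space
      subtopology (Euclidean_space k) (f ` (U \<inter> W))"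
    using homeomorphic_space_open_restriction(2)[OF fg o]
    by (simp add: subtopology_subtopology Int_absorb1 Int_absorb2 Int_commute Int_left_commute)
  moreover have "openin (subtopology X W) (U \<inter> W)"
    using UV(1) by (metis Int_commute openin_subtopology_Int2)
  ultimately show "\<exists>U V. openin (subtopology X W) U \<and> x \<in> U \<and> openin (Euclidean_space k) V \<and>
      subtopology (subtopology X W) U homeomorphic_space subtopology (Euclidean_space k) V"
    using fV x UV(2) by blast
qed

lemma topological_manifold_local:
  assumes "Hausdorff_space X" "second_countable X"
    and loc: "\<And>x. x \<in> topspace X \<Longrightarrow> \<exists>U. openin X U \<and> x \<in> U \<and> topological_manifold k (subtopology X U)"
  shows "topological_manifold k X"
  unfolding topological_manifold_def
proof (intro conjI ballI assms(1,2))
  fix x assume x: "x \<in> topspace X"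
  obtain W where W: "openin X W" "x \<in> W" "topological_manifold k (subtopology X W)"
    using loc[OF x] by blast
  have "x \<in> topspace (subtopology X W)" using x W by auto
  then obtain U V where UV: "openin (subtopology X W) U" "x \<in> U" "openin (Euclidean_space k) V"
      "subtopology (subtopology X W) U homeomorphic_space subtopology (Euclidean_space k) V"
    using W(3) unfolding topological_manifold_def by meson
  have "openin X U" using UV(1) W(1) openin_trans_full by blast
  moreover have "subtopology (subtopology X W) U = subtopology X U"
    using openin_subset[OF UV(1)] by (simp add: subtopology_subtopology Int_absorb1)
  ultimately show "\<exists>U V. openin X U \<and> x \<in> U \<and> openin (Euclidean_space k) V \<and>
      subtopology X U homeomorphic_space subtopology (Euclidean_space k) V"
    using UV by auto
qed

lemma homeomorphic_topological_manifold:
  assumes XY: "X homeomorphic_space Y" and X: "topological_manifold k X"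
  shows "topological_manifold k Y"
  unfolding topological_manifold_def
proof (intro conjI ballI)
  show "Hausdorff_space Y" "second_countable Y"
    using X XY homeomorphic_Hausdorff_space homeomorphic_space_second_countability
    by (auto simp: topological_manifold_def)
  obtain f g where fg: "homeomorphic_maps X Y f g" using XY by (auto simp: homeomorphic_space_def)
  fix y assume y: "y \<in> topspace Y"
  then have x: "g y \<in> topspace X" "f (g y) = y"
    using fg by (auto simp: homeomorphic_maps_def continuous_map_def)
  then obtain U V where UV: "openin X U" "g y \<in> U" "openin (Euclidean_space k) V"
      "subtopology X U homeomorphic_space subtopology (Euclidean_space k) V"
    using X unfolding topological_manifold_def by meson
  show "\<exists>U V. openin Y U \<and> y \<in> U \<and> openin (Euclidean_space k) V \<and>
      subtopology Y U homeomorphic_space subtopology (Euclidean_space k) V"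
  proof (intro exI conjI)
    show "y \<in> f ` U" using UV(2) x(2) by (metis imageI)
    show "subtopology Y (f ` U) homeomorphic_space subtopology (Euclidean_space k) V"
      using homeomorphic_space_open_restriction(2)[OF fg UV(1)] UV(4)
        homeomorphic_space_sym homeomorphic_space_trans by blast
  qed (use homeomorphic_space_open_restriction(1)[OF fg UV(1)] UV in auto)
qed

section \<open>Invariance of dimension\<close>

lemma Euclidean_open_not_thin:
  assumes "openin (Euclidean_space k) S" "x \<in> S" "j < k"
  obtains y where "y \<in> S" "y j \<noteq> 0"
proof (cases "x j = 0")
  case True
  have xk: "x \<in> topspace (Euclidean_space k)"
    using openin_subset[OF assms(1)] assms(2) by blast
  \<comment> \<open>The line through \<open>x\<close> in direction \<open>j\<close>; for small
    parameters it stays in the open set \<open>S\<close>.\<close>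
  define g where "g = (\<lambda>t::real. x(j := t))"
  have "continuous_map euclideanreal (Euclidean_space k) g"
    unfolding Euclidean_space_def continuous_map_in_subtopology continuous_map_componentwise_UNIV g_def
    using xk assms(3) by (auto simp: topspace_Euclidean_space)
  then have "openin euclideanreal {t \<in> topspace euclideanreal. g t \<in> S}"
    by (rule openin_continuous_map_preimage[OF _ assms(1)])
  then have o: "open {t. g t \<in> S}" by simp
  have "0 \<in> {t. g t \<in> S}"
    using True assms(2) by (metis fun_upd_triv g_def mem_Collect_eq)
  then obtain e where e: "e > 0" "ball 0 e \<subseteq> {t. g t \<in> S}"
    using o openE by blast
  then have "g (e / 2) \<in> S" by (auto simp: subset_iff)
  then show thesis using that[of "g (e / 2)"] e(1) by (simp add: g_def)
next
  case False
  then show thesis using that assms by blast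
qed

lemma Euclidean_space_subspace:
  "j \<le> k \<Longrightarrow> Euclidean_space j = subtopology (Euclidean_space k) (topspace (Euclidean_space j))"
  by (metis Euclidean_space_def inf.absorb_iff2 subset_Euclidean_space subtopology_subtopology topspace_Euclidean_space)

text \<open>If \<open>j < k\<close>, the homeomorphism is a continuous injection of an open subset
  of k-space into k-space. By invariance of domain its image is open, yet coordinate
  \<open>j\<close> vanishes on all of it.\<close>

lemma open_Euclidean_dimension_le:
  assumes V: "openin (Euclidean_space k) V" "V \<noteq> {}"
    and hom: "subtopology (Euclidean_space k) V homeomorphic_space subtopology (Euclidean_space j) W"
  shows "k \<le> j"
proof (rule ccontr)
  assume "\<not> k \<le> j"
  then have jk: "j < k" by simp
  obtain f where f: "homeomorphic_map (subtopology (Euclidean_space k) V) (subtopology (Euclidean_space j) W) f"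
    using hom homeomorphic_space by blast
  have Vt: "topspace (subtopology (Euclidean_space k) V) = V"
    using openin_subset[OF V(1)] by auto
  have cj: "continuous_map (subtopology (Euclidean_space k) V) (Euclidean_space j) f"
    using homeomorphic_imp_continuous_map[OF f] continuous_map_in_subtopology by blast
  then have c: "continuous_map (subtopology (Euclidean_space k) V) (Euclidean_space k) f"
    using Euclidean_space_subspace[of j k] jk continuous_map_in_subtopology
    by (metis less_imp_le)
  have "inj_on f V"
    using homeomorphic_imp_injective_map[OF f] Vt by simp
  then have o: "openin (Euclidean_space k) (f ` V)"
    by (rule invariance_of_domain_Euclidean_space[OF V(1) c])
  obtain x where x: "x \<in> f ` V" using V(2) by blast
  obtain y where "y \<in> f ` V" "y j \<noteq> 0"
    using Euclidean_open_not_thin[OF o x jk] by blast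
  moreover have "f ` V \<subseteq> topspace (Euclidean_space j)"
    using continuous_map_image_subset_topspace[OF cj] Vt by simp
  ultimately show False
    by (auto simp: topspace_Euclidean_space)
qed

lemma topological_manifold_dimension_le:
  assumes X: "topological_manifold j X" "topological_manifold k X" and ne: "topspace X \<noteq> {}"
  shows "k \<le> j"
proof -
  obtain x where x: "x \<in> topspace X" using ne by blast
  obtain U V where UV: "openin X U" "x \<in> U" "openin (Euclidean_space k) V"
      "subtopology X U homeomorphic_space subtopology (Euclidean_space k) V"
    using X(2) x unfolding topological_manifold_def by meson
  have "topological_manifold j (subtopology X U)"
    by (rule topological_manifold_openin[OF X(1) UV(1)])
  then have mj: "topological_manifold j (subtopology (Euclidean_space k) V)"
    by (rule homeomorphic_topological_manifold[OF UV(4)])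
  obtain f where f: "homeomorphic_map (subtopology X U) (subtopology (Euclidean_space k) V) f"
    using UV(4) homeomorphic_space by blast
  define v where "v = f x"
  have "x \<in> topspace (subtopology X U)"
    using UV(2) x by simp
  then have v: "v \<in> topspace (subtopology (Euclidean_space k) V)"
    using homeomorphic_imp_surjective_map[OF f] unfolding v_def by blast
  obtain A B where AB: "openin (subtopology (Euclidean_space k) V) A" "v \<in> A"
      "openin (Euclidean_space j) B"
      "subtopology (subtopology (Euclidean_space k) V) A homeomorphic_space subtopology (Euclidean_space j) B"
    using mj v unfolding topological_manifold_def by meson
  have "openin (Euclidean_space k) A"
    using AB(1) UV(3) openin_trans_full by blast
  moreover have "subtopology (subtopology (Euclidean_space k) V) A = subtopology (Euclidean_space k) A"
    using openin_subset[OF AB(1)] by (simp add: subtopology_subtopology Int_absorb1)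
  ultimately show ?thesis
    using open_Euclidean_dimension_le[of k A j B] AB by auto
qed

text \<open>This uniqueness is what makes the description operator in \<open>orbit_dim\<close>
  meaningful.\<close>

lemma topological_manifold_dimension_unique:
  "\<lbrakk>topological_manifold j X; topological_manifold k X; topspace X \<noteq> {}\<rbrakk> \<Longrightarrow> j = k"
  by (simp add: antisym topological_manifold_dimension_le)

section \<open>Products of manifolds and the torus as a manifold\<close>

definition Euclidean_split :: "nat \<Rightarrow> nat \<Rightarrow> (nat \<Rightarrow> real) \<Rightarrow> (nat \<Rightarrow> real) \<times> (nat \<Rightarrow> real)" where
  "Euclidean_split a b z = ((\<lambda>i. if i < a then z i else 0), (\<lambda>i. if i < b then z (a + i) else 0))"

definition Euclidean_join :: "nat \<Rightarrow> nat \<Rightarrow> (nat \<Rightarrow> real) \<times> (nat \<Rightarrow> real) \<Rightarrow> nat \<Rightarrow> real" where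
  "Euclidean_join a b = (\<lambda>(x, y) i. if i < a + b then (if i < a then x i else y (i - a)) else 0)"

lemma continuous_map_Euclidean_coord: "continuous_map (Euclidean_space k) euclideanreal (\<lambda>x. x i)"
  unfolding Euclidean_space_def
  by (rule continuous_map_from_subtopology) (rule continuous_map_product_projection, simp)

lemma homeomorphic_maps_Euclidean_split:
  "homeomorphic_maps (Euclidean_space (a + b)) (prod_topology (Euclidean_space a) (Euclidean_space b))
     (Euclidean_split a b) (Euclidean_join a b)"
  unfolding homeomorphic_maps_def
proof (intro conjI ballI)
  show "continuous_map (Euclidean_space (a + b)) (prod_topology (Euclidean_space a) (Euclidean_space b))
      (Euclidean_split a b)"
    unfolding Euclidean_split_def continuous_map_paired
    by (intro conjI; subst continuous_map_componentwise_Euclidean_space)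
       (auto intro: continuous_map_Euclidean_coord)
  show "continuous_map (prod_topology (Euclidean_space a) (Euclidean_space b)) (Euclidean_space (a + b))
      (Euclidean_join a b)"
    unfolding Euclidean_join_def case_prod_unfold continuous_map_componentwise_Euclidean_space
    using continuous_map_compose[OF continuous_map_fst continuous_map_Euclidean_coord]
      continuous_map_compose[OF continuous_map_snd continuous_map_Euclidean_coord]
    by (auto simp: o_def)
qed (auto simp: Euclidean_split_def Euclidean_join_def topspace_Euclidean_space fun_eq_iff)

lemma topological_manifold_prod:
  assumes X: "topological_manifold a X" and Y: "topological_manifold b Y"
  shows "topological_manifold (a + b) (prod_topology X Y)"
proof (rule topological_manifold_local)
  show "Hausdorff_space (prod_topology X Y)" "second_countable (prod_topology X Y)"
    using X Y by (auto simp: topological_manifold_def Hausdorff_space_prod_topology second_countable_prod_topology)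
  fix z assume "z \<in> topspace (prod_topology X Y)"
  then obtain x y where z: "z = (x, y)" "x \<in> topspace X" "y \<in> topspace Y" by auto
  obtain U U' where U: "openin X U" "x \<in> U" "openin (Euclidean_space a) U'"
      "subtopology X U homeomorphic_space subtopology (Euclidean_space a) U'"
    using X z unfolding topological_manifold_def by meson
  obtain V V' where V: "openin Y V" "y \<in> V" "openin (Euclidean_space b) V'"
      "subtopology Y V homeomorphic_space subtopology (Euclidean_space b) V'"
    using Y z unfolding topological_manifold_def by meson
  have "prod_topology (Euclidean_space a) (Euclidean_space b) homeomorphic_space Euclidean_space (a + b)"
    using homeomorphic_maps_Euclidean_split homeomorphic_space_def homeomorphic_space_sym by metis
  then have "topological_manifold (a + b) (prod_topology (Euclidean_space a) (Euclidean_space b))"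
    using homeomorphic_topological_manifold homeomorphic_space_sym topological_manifold_Euclidean_space by blast
  then have "topological_manifold (a + b)
      (subtopology (prod_topology (Euclidean_space a) (Euclidean_space b)) (U' \<times> V'))"
    by (rule topological_manifold_openin) (simp add: openin_prod_Times_iff U V)
  moreover have "subtopology (prod_topology X Y) (U \<times> V) homeomorphic_space
      subtopology (prod_topology (Euclidean_space a) (Euclidean_space b)) (U' \<times> V')"
    unfolding subtopology_Times by (rule homeomorphic_space_prod_topology[OF U(4) V(4)])
  ultimately have "topological_manifold (a + b) (subtopology (prod_topology X Y) (U \<times> V))"
    using homeomorphic_topological_manifold homeomorphic_space_sym by blast
  moreover have "openin (prod_topology X Y) (U \<times> V)"
    by (simp add: openin_prod_Times_iff U V)
  ultimately show "\<exists>W. openin (prod_topology X Y) W \<and> z \<in> W \<and>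
      topological_manifold (a + b) (subtopology (prod_topology X Y) W)"
    using z U V by blast
qed

lemma continuous_map_Euclidean_iff:
  "continuous_map X (Euclidean_space k) f \<longleftrightarrow>
     (\<forall>j. continuous_map X euclideanreal (\<lambda>x. f x j)) \<and> f \<in> topspace X \<rightarrow> topspace (Euclidean_space k)"
  unfolding Euclidean_space_def continuous_map_in_subtopology continuous_map_componentwise_UNIV by simp

text \<open>The chart at \<open>t\<close> divides by \<open>t\<close> and takes the argument of each
  coordinate. It is defined where no quotient meets the closed negative axis, on which the argument
  jumps, and its image is the open cube of side 2 pi.\<close>

lemma topological_manifold_torus: "topological_manifold k (torus_space k)"
proof (rule topological_manifold_local)
  fix t assume "t \<in> topspace (torus_space k)"
  then have t: "t \<in> torus k" by simp
  define W where "W = (\<Inter>j\<in>{..<k}. {s. s j * inverse (t j) \<notin> \<real>\<^sub>\<le>\<^sub>0})"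
  define V where "V = {x \<in> topspace (Euclidean_space k). \<forall>j<k. -pi < x j \<and> x j < pi}"
  define f where "f = (\<lambda>s::cvec. \<lambda>j. if j < k then Arg (s j * inverse (t j)) else 0)"
  define g where "g = (\<lambda>x j. if j < k then t j * cis (x j) else 1)"
  have "open W"
    unfolding W_def
  proof (intro open_INT ballI)
    fix j
    have "open ((\<lambda>s::cvec. s j * inverse (t j)) -` (- \<real>\<^sub>\<le>\<^sub>0))"
      by (intro open_vimage continuous_intros continuous_on_coord) (simp add: open_Compl)
    then show "open {s::cvec. s j * inverse (t j) \<notin> \<real>\<^sub>\<le>\<^sub>0}"
      by (simp add: vimage_def)
  qed simp
  then have oW: "openin (torus_space k) (torus k \<inter> W)"
    by (rule openin_open_Int)
  have tW: "t \<in> torus k \<inter> W"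
    using t by (auto simp: W_def torus_nz)
  have "openin (Euclidean_space k) {x \<in> topspace (Euclidean_space k). x j \<in> {-pi<..<pi}}" for j
    by (rule openin_continuous_map_preimage[OF continuous_map_Euclidean_coord]) simp
  then have "openin (Euclidean_space k)
      (topspace (Euclidean_space k) \<inter> (\<Inter>j\<in>{..<k}. {x \<in> topspace (Euclidean_space k). x j \<in> {-pi<..<pi}}))"
    by (intro openin_Int_Inter) auto
  moreover have "topspace (Euclidean_space k) \<inter> (\<Inter>j\<in>{..<k}. {x \<in> topspace (Euclidean_space k). x j \<in> {-pi<..<pi}}) = V"
    by (auto simp: V_def)
  ultimately have oV: "openin (Euclidean_space k) V" by simp
  have cis_nonpos: "cis x \<notin> \<real>\<^sub>\<le>\<^sub>0" if "-pi < x" "x < pi" for x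
    using that Arg_cis[of x] Arg_eq_pi[of "cis x"] cis_neq_zero[of x]
    by (auto simp: complex_nonpos_Reals_iff complex_eq_iff less_le)
  have gquot: "g x j * inverse (t j) = cis (x j)" if "j < k" for x j
    using torus_nz[OF t, of j] that by (simp add: g_def)
  have gT: "g x \<in> torus k" for x
    by (auto simp: g_def norm_mult torus_norm[OF t] intro!: torusI)
  have "homeomorphic_maps (subtopology (torus_space k) (torus k \<inter> W)) (subtopology (Euclidean_space k) V) f g"
    unfolding homeomorphic_maps_def
  proof (intro conjI ballI)
    have c1: "continuous_on (torus k \<inter> W) (\<lambda>s. Arg (s j * inverse (t j)))" if "j < k" for j
      by (intro continuous_intros continuous_on_coord) (use that in \<open>auto simp: W_def\<close>)
    have Arg: "-pi < Arg z" "Arg z < pi" if "z \<notin> \<real>\<^sub>\<le>\<^sub>0" for z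
      using that Arg_bounded[of z] Arg_eq_pi[of z] by (auto simp: complex_nonpos_Reals_iff less_le)
    have "continuous_map (top_of_set (torus k \<inter> W)) euclideanreal (\<lambda>s. f s j)" for j
      by (cases "j < k") (auto simp: f_def c1)
    then have "continuous_map (top_of_set (torus k \<inter> W)) (Euclidean_space k) f"
      unfolding continuous_map_Euclidean_iff by (auto simp: f_def topspace_Euclidean_space)
    moreover have "f s \<in> V" if "s \<in> torus k \<inter> W" for s
      using that Arg by (auto simp: f_def V_def W_def topspace_Euclidean_space)
    ultimately show "continuous_map (subtopology (torus_space k) (torus k \<inter> W)) (subtopology (Euclidean_space k) V) f"
      by (auto simp: continuous_map_in_subtopology subtopology_subtopology)
    have "continuous_map (Euclidean_space k) euclidean (\<lambda>x. g x j)" for j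
    proof (cases "j < k")
      case True
      have "continuous_map euclideanreal euclidean (\<lambda>x. t j * cis x)"
        by (simp, intro continuous_intros)
      then have "continuous_map (Euclidean_space k) euclidean ((\<lambda>x. t j * cis x) \<circ> (\<lambda>x. x j))"
        by (rule continuous_map_compose[OF continuous_map_Euclidean_coord])
      then show ?thesis using True by (simp add: g_def o_def)
    qed (simp add: g_def)
    then have "continuous_map (Euclidean_space k) (torus_space k) g"
      using gT by (auto simp: continuous_map_cvec_iff)
    moreover have "g x \<in> W" if "x \<in> V" for x
    proof -
      show ?thesis
        using \<open>x \<in> V\<close> cis_nonpos gquot unfolding W_def V_def by simp
    qed
    ultimately show "continuous_map (subtopology (Euclidean_space k) V) (subtopology (torus_space k) (torus k \<inter> W)) g"
      using gT by (auto simp: continuous_map_in_subtopology continuous_map_from_subtopology)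
    show "g (f s) = s" if "s \<in> topspace (subtopology (torus_space k) (torus k \<inter> W))" for s
    proof
      fix j
      have s: "s \<in> torus k" using that by simp
      have "cis (Arg (s j * inverse (t j))) = s j * inverse (t j)"
        using torus_norm[OF s] torus_norm[OF t] torus_nz[OF s] torus_nz[OF t]
        by (subst cis_Arg) (auto simp: sgn_div_norm norm_mult norm_inverse)
      then show "g (f s) j = s j"
        using torus_nz[OF t] torus_ge[OF s] by (auto simp: f_def g_def)
    qed
    show "f (g x) = x" if "x \<in> topspace (subtopology (Euclidean_space k) V)" for x
    proof
      fix j
      show "f (g x) j = x j"
        using that gquot[of j x] Arg_cis[of "x j"]
        by (auto simp: f_def V_def topspace_Euclidean_space)
    qed
  qed
  then have "subtopology (Euclidean_space k) V homeomorphic_space subtopology (torus_space k) (torus k \<inter> W)"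
    using homeomorphic_space_def homeomorphic_space_sym by blast
  then have "topological_manifold k (subtopology (torus_space k) (torus k \<inter> W))"
    using homeomorphic_topological_manifold topological_manifold_openin[OF topological_manifold_Euclidean_space oV]
    by blast
  then show "\<exists>U. openin (torus_space k) U \<and> t \<in> U \<and> topological_manifold k (subtopology (torus_space k) U)"
    using oW tW by blast
qed simp_all

section \<open>Boxes\<close>

text \<open>Boxes serve as the contractible sets because they split: a box in \<open>l + i\<close>
  coordinates is the product of a box in the first \<open>l\<close> and a box in the last
  \<open>i\<close>, and only the latter is merged with torus coordinates.\<close>

definition box_at :: "nat \<Rightarrow> (nat \<Rightarrow> real) \<Rightarrow> real \<Rightarrow> (nat \<Rightarrow> real) set" where
  "box_at k b \<epsilon> = {x \<in> topspace (Euclidean_space k). \<forall>j<k. \<bar>x j - b j\<bar> < \<epsilon>}"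

lemma openin_box_at: "openin (Euclidean_space k) (box_at k b \<epsilon>)"
proof -
  have "openin (Euclidean_space k) {x \<in> topspace (Euclidean_space k). x j \<in> ball (b j) \<epsilon>}" for j
    by (rule openin_continuous_map_preimage[OF continuous_map_Euclidean_coord]) simp
  then have "openin (Euclidean_space k)
      (topspace (Euclidean_space k) \<inter> (\<Inter>j\<in>{..<k}. {x \<in> topspace (Euclidean_space k). x j \<in> ball (b j) \<epsilon>}))"
    by (intro openin_Int_Inter) auto
  moreover have "topspace (Euclidean_space k) \<inter>
      (\<Inter>j\<in>{..<k}. {x \<in> topspace (Euclidean_space k). x j \<in> ball (b j) \<epsilon>}) = box_at k b \<epsilon>"
    by (auto simp: box_at_def dist_real_def abs_minus_commute)
  ultimately show ?thesis by simp
qed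

lemma box_at_subset: "box_at k b \<epsilon> \<subseteq> topspace (Euclidean_space k)"
  by (auto simp: box_at_def)

lemma topspace_box_at: "topspace (subtopology (Euclidean_space k) (box_at k b \<epsilon>)) = box_at k b \<epsilon>"
  using box_at_subset by auto

lemma center_in_box_at: "b \<in> topspace (Euclidean_space k) \<Longrightarrow> \<epsilon> > 0 \<Longrightarrow> b \<in> box_at k b \<epsilon>"
  by (simp add: box_at_def)

lemma box_at_basis:
  assumes "openin (Euclidean_space k) U" "b \<in> U"
  obtains \<epsilon> where "\<epsilon> > 0" "box_at k b \<epsilon> \<subseteq> U"
proof -
  obtain T where T: "openin (powertop_real UNIV) T" "U = T \<inter> {x. \<forall>i\<ge>k. x i = 0}"
    using assms(1) by (auto simp: Euclidean_space_def openin_subtopology)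
  then obtain X where X: "b \<in> PiE UNIV X" "\<And>i. open (X i)" "PiE UNIV X \<subseteq> T"
    using product_topology_open_contains_basis[OF T(1), of b] assms(2) by auto
  then have "\<exists>e>0. ball (b i) e \<subseteq> X i" for i
    using openE[OF X(2)] by (metis PiE_mem UNIV_I)
  then obtain e where e: "\<And>i. e i > 0" "\<And>i. ball (b i) (e i) \<subseteq> X i" by metis
  \<comment> \<open>Coordinates from \<open>k\<close> on vanish on both sides, so a minimum over
    finitely many radii suffices; the entry 1 covers the case \<open>k = 0\<close>.\<close>
  define \<epsilon> where "\<epsilon> = Min (insert 1 (e ` {..<k}))"
  have "\<epsilon> > 0"
    unfolding \<epsilon>_def using e(1) by (subst Min_gr_iff) auto
  moreover have "box_at k b \<epsilon> \<subseteq> U"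
  proof
    fix x assume x: "x \<in> box_at k b \<epsilon>"
    have "x i \<in> X i" for i
    proof (cases "i < k")
      case True
      then have "\<epsilon> \<le> e i" by (auto simp: \<epsilon>_def)
      then have "x i \<in> ball (b i) (e i)"
        using x True by (auto simp: box_at_def dist_real_def abs_minus_commute)
      then show ?thesis using e(2) by blast
    next
      case False
      then have "x i = b i"
        using x assms(2) T(2) by (auto simp: box_at_def topspace_Euclidean_space)
      then show ?thesis using X(1) by auto
    qed
    then have "x \<in> T" using X(3) by auto
    then show "x \<in> U" using x T(2) by (auto simp: box_at_def topspace_Euclidean_space)
  qed
  ultimately show thesis by (rule that)
qed

lemma contractible_box_at: "contractible_space (subtopology (Euclidean_space k) (box_at k b \<epsilon>))"
proof (cases "box_at k b \<epsilon> = {}")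
  case True
  then show ?thesis by (simp add: contractible_space_empty)
next
  case False
  then obtain a where a: "a \<in> box_at k b \<epsilon>" by blast
  let ?E = "subtopology (Euclidean_space k) (box_at k b \<epsilon>)"
  let ?D = "prod_topology (top_of_set {0..1::real}) ?E"
  \<comment> \<open>The straight-line contraction onto \<open>a\<close>, which stays in the box
    because each coordinate interval is convex.\<close>
  define h where "h = (\<lambda>(t::real, x::nat \<Rightarrow> real) j. (1 - t) * x j + t * a j)"
  have fst: "continuous_map ?D euclideanreal fst"
    using continuous_map_fst[of "top_of_set {0..1::real}" ?E] continuous_map_in_subtopology by blast
  have co: "continuous_map ?D euclideanreal (\<lambda>z. snd z j)" for j
    using continuous_map_compose[OF continuous_map_snd continuous_map_from_subtopology[OF continuous_map_Euclidean_coord]]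
    by (simp add: o_def)
  have cj: "continuous_map ?D euclideanreal (\<lambda>z. h z j)" for j
    unfolding h_def case_prod_unfold by (intro continuous_intros fst co)
  have mem: "h (t, x) \<in> box_at k b \<epsilon>" if tx: "t \<in> {0..1}" "x \<in> box_at k b \<epsilon>" for t x
  proof -
    have "\<bar>h (t, x) j - b j\<bar> < \<epsilon>" if "j < k" for j
    proof -
      have "h (t, x) j \<in> ball (b j) \<epsilon>"
        using convexD[OF convex_ball[of "b j" \<epsilon>], of "x j" "a j" "1 - t" t] tx a that
        by (auto simp: box_at_def h_def dist_real_def abs_minus_commute)
      then show ?thesis by (simp add: dist_real_def abs_minus_commute)
    qed
    then show ?thesis using tx a by (auto simp: box_at_def h_def topspace_Euclidean_space)
  qed
  have "continuous_map ?D ?E h"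
    unfolding continuous_map_in_subtopology continuous_map_Euclidean_iff
    using cj mem box_at_subset by (fastforce simp: topspace_box_at)
  then have "homotopic_with (\<lambda>x. True) ?E ?E id (\<lambda>x. a)"
    unfolding homotopic_with_def by (intro exI[of _ h]) (auto simp: h_def)
  then show ?thesis unfolding contractible_space_def by blast
qed

lemma connected_box_at: "connected_space (subtopology (Euclidean_space k) (box_at k b \<epsilon>))"
  by (simp add: contractible_box_at contractible_imp_connected_space)

lemma Euclidean_split_box_at:
  assumes "x \<in> topspace (Euclidean_space (a + d))"
  shows "x \<in> box_at (a + d) b \<epsilon> \<longleftrightarrow> Euclidean_split a d x \<in>
    box_at a (fst (Euclidean_split a d b)) \<epsilon> \<times> box_at d (snd (Euclidean_split a d b)) \<epsilon>"
proof -
  have "(\<forall>j<a + d. \<bar>x j - b j\<bar> < \<epsilon>) \<longleftrightarrow> (\<forall>j<a. \<bar>x j - b j\<bar> < \<epsilon>) \<and> (\<forall>j<d. \<bar>x (a + j) - b (a + j)\<bar> < \<epsilon>)"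
  proof safe
    fix j assume *: "\<forall>j<a. \<bar>x j - b j\<bar> < \<epsilon>" "\<forall>j<d. \<bar>x (a + j) - b (a + j)\<bar> < \<epsilon>" "j < a + d"
    show "\<bar>x j - b j\<bar> < \<epsilon>"
    proof (cases "j < a")
      case False
      then have "j - a < d" "a + (j - a) = j" using *(3) by auto
      then show ?thesis using *(2) by metis
    qed (use * in simp)
  qed simp_all
  then show ?thesis
    using assms by (auto simp: box_at_def Euclidean_split_def topspace_Euclidean_space)
qed

lemma homeomorphic_map_split_box_at:
  "homeomorphic_map (subtopology (Euclidean_space (a + d)) (box_at (a + d) b \<epsilon>))
     (prod_topology (subtopology (Euclidean_space a) (box_at a (fst (Euclidean_split a d b)) \<epsilon>))
       (subtopology (Euclidean_space d) (box_at d (snd (Euclidean_split a d b)) \<epsilon>)))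
     (Euclidean_split a d)"
  unfolding subtopology_Times[symmetric]
proof (rule homeomorphic_map_subtopologies_alt)
  show "homeomorphic_map (Euclidean_space (a + d)) (prod_topology (Euclidean_space a) (Euclidean_space d)) (Euclidean_split a d)"
    using homeomorphic_maps_Euclidean_split homeomorphic_maps_map by blast
qed (simp add: Euclidean_split_box_at)

section \<open>Logarithmic polar coordinates\<close>

definition polar :: "nat \<Rightarrow> (nat \<Rightarrow> real) \<times> cvec \<Rightarrow> cvec" where
  "polar k = (\<lambda>(x, s) j. if j < k then of_real (exp (x j)) * s j else 1)"

text \<open>A product of annuli: the image under \<open>polar\<close> of a box times the torus.
  Taking logarithms of the radii lets an arbitrary box occur, and the torus moves only the angles,
  so the set is invariant and can serve as the factor \<open>\<Omega>\<close> of a chart.\<close>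

definition annuli :: "nat \<Rightarrow> (nat \<Rightarrow> real) \<Rightarrow> real \<Rightarrow> cvec set" where
  "annuli k b \<epsilon> = {w \<in> cstar k. \<forall>j<k. \<bar>ln (cmod (w j)) - b j\<bar> < \<epsilon>}"

lemma polar_cmult: "t \<in> torus k \<Longrightarrow> polar k (x, cmult t s) = cmult t (polar k (x, s))"
  by (auto simp: polar_def cmult_def torus_ge fun_eq_iff)

lemma cmult_annuli: "t \<in> torus k \<Longrightarrow> w \<in> annuli k b \<epsilon> \<Longrightarrow> cmult t w \<in> annuli k b \<epsilon>"
  by (auto simp: annuli_def cstar_def cmult_def norm_mult torus_norm torus_nz torus_ge)

lemma openin_annuli: "openin (top_of_set (cstar k)) (annuli k b \<epsilon>)"
proof -
  have "openin (top_of_set (cstar k)) (cstar k \<inter> (\<lambda>w. ln (cmod (w j))) -` ball (b j) \<epsilon>)" if "j < k" for j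
    by (intro continuous_openin_preimage_gen continuous_intros continuous_on_coord)
       (use that in \<open>auto simp: cstar_def\<close>)
  then have "openin (top_of_set (cstar k))
      (topspace (top_of_set (cstar k)) \<inter> (\<Inter>j\<in>{..<k}. cstar k \<inter> (\<lambda>w. ln (cmod (w j))) -` ball (b j) \<epsilon>))"
    by (intro openin_Int_Inter) auto
  moreover have "topspace (top_of_set (cstar k)) \<inter>
      (\<Inter>j\<in>{..<k}. cstar k \<inter> (\<lambda>w. ln (cmod (w j))) -` ball (b j) \<epsilon>) = annuli k b \<epsilon>"
    by (auto simp: annuli_def dist_real_def abs_minus_commute)
  ultimately show ?thesis by simp
qed

lemma homeomorphic_map_polar:
  "homeomorphic_map (prod_topology (subtopology (Euclidean_space k) (box_at k b \<epsilon>)) (torus_space k))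
     (top_of_set (annuli k b \<epsilon>)) (polar k)"
proof -
  let ?D = "prod_topology (subtopology (Euclidean_space k) (box_at k b \<epsilon>)) (torus_space k)"
  define g where "g = (\<lambda>w::cvec. ((\<lambda>j. if j < k then ln (cmod (w j)) else 0), (\<lambda>j. w j / of_real (cmod (w j)))))"
  have "homeomorphic_maps ?D (top_of_set (annuli k b \<epsilon>)) (polar k) g"
    unfolding homeomorphic_maps_def
  proof (intro conjI ballI)
    have c1: "continuous_map ?D euclidean (\<lambda>z. complex_of_real (exp (fst z j)))" for j
    proof -
      have "continuous_map euclideanreal euclidean (\<lambda>x. complex_of_real (exp x))"
        by (simp, intro continuous_intros)
      from continuous_map_compose[OF continuous_map_compose[OF continuous_map_fst
          continuous_map_from_subtopology[OF continuous_map_Euclidean_coord]] this]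
      show ?thesis by (simp add: o_def)
    qed
    have cs: "continuous_map (torus_space k) euclidean (\<lambda>s. s j)" for j
      by (simp add: continuous_on_coord)
    have c2: "continuous_map ?D euclidean (\<lambda>z. snd z j)" for j
      using continuous_map_compose[OF continuous_map_snd cs] by (simp only: o_def)
    have mult: "continuous_map euclidean euclidean (\<lambda>(x::complex, y). x * y)"
      by (simp add: case_prod_unfold, intro continuous_intros)
    have "continuous_map ?D euclidean (\<lambda>z. polar k z j)" for j
    proof (cases "j < k")
      case True
      have "continuous_map ?D (prod_topology euclidean euclidean) (\<lambda>z. (complex_of_real (exp (fst z j)), snd z j))"
        unfolding continuous_map_paired using c1 c2 by blast
      then have "continuous_map ?D euclidean (\<lambda>z. (complex_of_real (exp (fst z j)), snd z j))"
        by simp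
      from continuous_map_compose[OF this mult] show ?thesis
        using True by (simp add: polar_def case_prod_unfold o_def)
    qed (simp add: polar_def case_prod_unfold)
    moreover have "polar k z \<in> annuli k b \<epsilon>" if "z \<in> topspace ?D" for z
      using that by (auto simp: polar_def annuli_def cstar_def box_at_def norm_mult torus_norm torus_nz)
    ultimately show "continuous_map ?D (top_of_set (annuli k b \<epsilon>)) (polar k)"
      by (auto simp: continuous_map_cvec_iff)
    have nz: "w j \<noteq> 0" if "w \<in> annuli k b \<epsilon>" for w j
      using that by (cases "j < k") (auto simp: annuli_def cstar_def)
    have "continuous_on (annuli k b \<epsilon>) (\<lambda>w. fst (g w) j)" for j
      by (cases "j < k") (auto simp: g_def intro!: continuous_intros continuous_on_coord dest: nz)
    moreover have gb: "fst (g w) \<in> box_at k b \<epsilon>" if "w \<in> annuli k b \<epsilon>" for w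
      using that by (auto simp: g_def box_at_def annuli_def topspace_Euclidean_space)
    ultimately have "continuous_map (top_of_set (annuli k b \<epsilon>))
        (subtopology (Euclidean_space k) (box_at k b \<epsilon>)) (\<lambda>w. fst (g w))"
      using box_at_subset unfolding continuous_map_in_subtopology continuous_map_Euclidean_iff
      by (fastforce simp: Pi_iff)
    moreover have "continuous_on (annuli k b \<epsilon>) (\<lambda>w. snd (g w) j)" for j
      by (auto simp: g_def intro!: continuous_intros continuous_on_coord dest: nz)
    moreover have gt: "snd (g w) \<in> torus k" if "w \<in> annuli k b \<epsilon>" for w
      using that nz[OF that] by (auto simp: g_def annuli_def cstar_def norm_divide intro!: torusI)
    ultimately show "continuous_map (top_of_set (annuli k b \<epsilon>)) ?D g"
      unfolding continuous_map_pairwise o_def continuous_map_cvec_iff by auto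
    show "polar k (g w) = w" if "w \<in> topspace (top_of_set (annuli k b \<epsilon>))" for w
      using that nz[of w] by (auto simp: polar_def g_def annuli_def cstar_def fun_eq_iff)
    show "g (polar k z) = z" if "z \<in> topspace ?D" for z
      using that by (auto simp: polar_def g_def topspace_Euclidean_space torus_norm torus_ge norm_mult
          ln_mult fun_eq_iff box_at_def)
  qed
  then show ?thesis using homeomorphic_maps_map by blast
qed

section \<open>Perfect maps and cones\<close>

lemma perfect_map_restriction:
  assumes "perfect_map X Y f" "{x \<in> topspace X. f x \<in> V} = U"
  shows "perfect_map (subtopology X U) (subtopology Y V) f"
  unfolding perfect_map_def
proof (intro conjI)
  have c: "continuous_map X Y f" and p: "proper_map X Y f" and s: "f ` topspace X = topspace Y"
    using assms(1) by (auto simp: perfect_map_def)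
  show "continuous_map (subtopology X U) (subtopology Y V) f"
    unfolding continuous_map_in_subtopology using c assms(2) by (auto intro: continuous_map_from_subtopology)
  show "proper_map (subtopology X U) (subtopology Y V) f"
    by (rule proper_map_restriction[OF p assms(2)])
  show "f ` topspace (subtopology X U) = topspace (subtopology Y V)"
  proof (intro subset_antisym subsetI)
    fix y assume "y \<in> topspace (subtopology Y V)"
    then have "y \<in> f ` topspace X" "y \<in> V" using s by auto
    then obtain x where "x \<in> topspace X" "y = f x" by blast
    then show "y \<in> f ` topspace (subtopology X U)"
      using \<open>y \<in> V\<close> assms(2) by auto
  qed (use s assms(2) in auto)
qed

lemma perfect_map_prod:
  assumes "perfect_map X X' f" "perfect_map Y Y' g"
  shows "perfect_map (prod_topology X Y) (prod_topology X' Y') (\<lambda>(x, y). (f x, g y))"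
  using assms unfolding perfect_map_def
  by (auto simp: proper_map_prod continuous_map_prod_top image_iff) (metis imageE)+

lemma perfect_map_compact_Hausdorff:
  assumes "continuous_map X Y f" "compact_space X" "Hausdorff_space Y" "f ` topspace X = topspace Y"
  shows "perfect_map X Y f"
  using assms by (simp add: perfect_map_def continuous_imp_proper_map Hausdorff_imp_kc_space)

text \<open>Perfect maps are quotient maps, so each of the two maps factors through the other as
  soon as they identify the same points. In contrast to general quotient maps, the hypotheses can be
  verified factor by factor on products.\<close>

lemma homeomorphic_map_perfect_maps:
  assumes f: "perfect_map D X f" and g: "perfect_map D Y g"
    and ker: "\<And>x y. \<lbrakk>x \<in> topspace D; y \<in> topspace D\<rbrakk> \<Longrightarrow> f x = f y \<longleftrightarrow> g x = g y"
  obtains h where "homeomorphic_map X Y h" "\<And>x. x \<in> topspace D \<Longrightarrow> h (f x) = g x"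
proof -
  have qf: "quotient_map D X f" and qg: "quotient_map D Y g"
    using f g perfect_imp_quotient_map by blast+
  obtain h where h: "continuous_map X Y h" "\<And>x. x \<in> topspace D \<Longrightarrow> h (f x) = g x"
    using quotient_map_lift_exists[OF qf quotient_imp_continuous_map[OF qg]] ker by metis
  obtain k where k: "continuous_map Y X k" "\<And>x. x \<in> topspace D \<Longrightarrow> k (g x) = f x"
    using quotient_map_lift_exists[OF qg quotient_imp_continuous_map[OF qf]] ker by metis
  have "homeomorphic_maps X Y h k"
    unfolding homeomorphic_maps_def
    using h k quotient_imp_surjective_map[OF qf] quotient_imp_surjective_map[OF qg] by force
  then show thesis using that h(2) homeomorphic_maps_map by blast
qed

section \<open>The topology of open cones\<close>

lemma topspace_open_cone [simp]: "topspace (open_cone L) = cone_set (topspace L)"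
proof -
  have "{p \<in> topspace (half_open_cylinder L). cone_proj p \<in> cone_set (topspace L)} = topspace (half_open_cylinder L)"
    by (auto simp: half_open_cylinder_def cone_set_def)
  then have "openin (open_cone L) (cone_set (topspace L))"
    unfolding openin_open_cone by simp
  then show ?thesis
    using openin_open_cone openin_subset openin_topspace by (metis subset_antisym)
qed

lemma topspace_half_open_cylinder [simp]: "topspace (half_open_cylinder L) = topspace L \<times> {0..<1}"
  by (simp add: half_open_cylinder_def)

lemma cone_proj_eq_None [simp]: "cone_proj p = None \<longleftrightarrow> snd p = 0"
  by (simp add: cone_proj_def)

lemma cone_proj_eq: "cone_proj p = cone_proj q \<longleftrightarrow> snd p = snd q \<and> (snd p = 0 \<or> p = q)"
  by (auto simp: cone_proj_def)

lemma continuous_map_cone_proj: "continuous_map (half_open_cylinder L) (open_cone L) cone_proj"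
  unfolding continuous_map_def
  by (auto simp: openin_open_cone cone_set_def)

lemma closedin_cylinder_base: "closedin (half_open_cylinder L) (topspace L \<times> {0})"
proof -
  have "closedin (half_open_cylinder L) {p \<in> topspace (half_open_cylinder L). snd p \<in> {0}}"
    unfolding half_open_cylinder_def
    by (rule closedin_continuous_map_preimage[OF continuous_map_snd]) (auto intro: closed_subset)
  moreover have "{p \<in> topspace (half_open_cylinder L). snd p \<in> {0}} = topspace L \<times> {0::real}"
    by auto
  ultimately show ?thesis by simp
qed

text \<open>The saturation \<open>C'\<close> of a closed set is the set itself or its union with the
  base of the cylinder, and both are closed.\<close>

lemma closed_map_cone_proj: "closed_map (half_open_cylinder L) (open_cone L) cone_proj"
  unfolding closed_map_def
proof (intro allI impI)
  fix C assume C: "closedin (half_open_cylinder L) C"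
  have Csub: "C \<subseteq> topspace L \<times> {0..<1}"
    using closedin_subset[OF C] by simp
  define C' where "C' = (if C \<inter> topspace L \<times> {0} = {} then C else C \<union> topspace L \<times> {0})"
  have "closedin (half_open_cylinder L) C'"
    using closedin_Un[OF C closedin_cylinder_base] C by (simp add: C'_def)
  then have o: "openin (half_open_cylinder L) (topspace (half_open_cylinder L) - C')"
    by (rule openin_diff[OF openin_topspace])
  have eq: "{p \<in> topspace (half_open_cylinder L). cone_proj p \<in> cone_set (topspace L) - cone_proj ` C}
      = topspace (half_open_cylinder L) - C'"
  proof (rule Set.set_eqI)
    fix p
    show "p \<in> {p \<in> topspace (half_open_cylinder L). cone_proj p \<in> cone_set (topspace L) - cone_proj ` C}
      \<longleftrightarrow> p \<in> topspace (half_open_cylinder L) - C'"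
    proof (cases "p \<in> topspace L \<times> {0..<1}")
      case True
      have "cone_proj p \<in> cone_proj ` C \<longleftrightarrow> p \<in> C'"
      proof (cases "snd p = 0")
        case z: True
        have "cone_proj p \<in> cone_proj ` C \<longleftrightarrow> (\<exists>q\<in>C. snd q = 0)"
          using z by (auto simp: image_iff cone_proj_eq)
        also have "\<dots> \<longleftrightarrow> C \<inter> topspace L \<times> {0} \<noteq> {}"
          using Csub by fastforce
        also have "\<dots> \<longleftrightarrow> p \<in> C'"
          using z True by (auto simp: C'_def)
        finally show ?thesis .
      next
        case False
        then show ?thesis by (auto simp: image_iff cone_proj_eq C'_def)
      qed
      then show ?thesis using True by (auto simp: cone_set_def)
    qed auto
  qed
  have "openin (open_cone L) (cone_set (topspace L) - cone_proj ` C)"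
    unfolding openin_open_cone eq using o by blast
  moreover have "cone_proj ` C \<subseteq> cone_set (topspace L)"
    using Csub by (auto simp: cone_set_def)
  ultimately show "closedin (open_cone L) (cone_proj ` C)"
    by (simp add: closedin_def)
qed

text \<open>Compactness of \<open>L\<close> is compactness of the fibre over the apex. Nonemptiness
  is what puts the apex into the image, since the cone on the empty space is still a point.\<close>

lemma perfect_map_cone_proj:
  assumes "compact_space L" "topspace L \<noteq> {}"
  shows "perfect_map (half_open_cylinder L) (open_cone L) cone_proj"
  unfolding perfect_map_def proper_map_def
proof (intro conjI ballI continuous_map_cone_proj closed_map_cone_proj)
  fix c assume "c \<in> topspace (open_cone L)"
  then consider "c = None" | y r where "c = Some (y, r)" "r \<noteq> 0" "y \<in> topspace L" "r \<in> {0..<1}"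
    by (auto simp: cone_set_def cone_proj_def split: if_splits)
  then show "compactin (half_open_cylinder L) {p \<in> topspace (half_open_cylinder L). cone_proj p = c}"
  proof cases
    case 1
    then have "{p \<in> topspace (half_open_cylinder L). cone_proj p = c} = topspace L \<times> {0}"
      by auto
    moreover have "compactin (half_open_cylinder L) (topspace L \<times> {0})"
      unfolding half_open_cylinder_def using assms(1)
      by (auto simp: compactin_Times compact_space_def compactin_subtopology)
    ultimately show ?thesis by simp
  next
    case 2
    then have "{p \<in> topspace (half_open_cylinder L). cone_proj p = c} = {(y, r)}"
      by (auto simp: cone_proj_def split: if_splits)
    then show ?thesis using 2 by simp
  qed
next
  show "cone_proj ` topspace (half_open_cylinder L) = topspace (open_cone L)"
  proof -
    have "None \<in> cone_proj ` (topspace L \<times> {0..<1})"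
    proof -
      obtain y where "y \<in> topspace L" using assms(2) by blast
      then show ?thesis
        by (intro image_eqI[of _ _ "(y, 0)"]) (auto simp: cone_proj_def)
    qed
    then show ?thesis by (auto simp: cone_set_def)
  qed
qed

text \<open>The tube lemma around the compact base of the cylinder gives one height that works over
  the whole link.\<close>

lemma open_cone_apex_basis:
  assumes L: "compact_space L" and N: "openin (open_cone L) N" "None \<in> N"
  obtains \<delta> where "0 < \<delta>" "\<delta> \<le> 1" "insert None (cone_proj ` (topspace L \<times> {0..<\<delta>})) \<subseteq> N"
proof -
  define W where "W = {p \<in> topspace (half_open_cylinder L). cone_proj p \<in> N}"
  have W: "openin (prod_topology L (top_of_set {0..<1::real})) W"
    using N(1) unfolding openin_open_cone W_def half_open_cylinder_def by blast
  have "topspace L \<times> {0} \<subseteq> W"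
    using N(2) by (auto simp: W_def cone_proj_def)
  then obtain U V where UV: "openin L U" "openin (top_of_set {0..<1::real}) V" "topspace L \<subseteq> U" "0 \<in> V" "U \<times> V \<subseteq> W"
    using tube_lemma_left[OF W, of "topspace L" 0] L by (auto simp: compact_space_def)
  obtain e where e: "e > 0" "\<And>r. r \<in> {0..<1} \<Longrightarrow> dist r 0 < e \<Longrightarrow> r \<in> V"
    using UV(2,4) unfolding openin_euclidean_subtopology_iff by metis
  have "insert None (cone_proj ` (topspace L \<times> {0..<min 1 e})) \<subseteq> N"
  proof
    fix c assume "c \<in> insert None (cone_proj ` (topspace L \<times> {0..<min 1 e}))"
    then consider "c = None" | y r where "c = cone_proj (y, r)" "y \<in> topspace L" "0 \<le> r" "r < 1" "r < e"
      by auto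
    then show "c \<in> N"
    proof cases
      case 2
      then have "r \<in> V" using e(2)[of r] by simp
      then have "(y, r) \<in> W" using UV(3,5) 2(2) by auto
      then show ?thesis using 2(1) by (simp add: W_def)
    qed (use N(2) in simp)
  qed
  then show thesis using that[of "min 1 e"] e(1) by simp
qed

text \<open>Small cones are cones: rescaling the parameter by \<open>\<delta>\<close> parametrises a
  neighbourhood of the apex by the whole cylinder again. Charts can thus be shrunk without changing
  the link.\<close>

lemma perfect_map_cone_scale:
  assumes L: "compact_space L" "topspace L \<noteq> {}" and d: "0 < \<delta>" "\<delta> \<le> 1"
  shows "openin (open_cone L) (insert None (cone_proj ` (topspace L \<times> {0..<\<delta>})))"
    and "perfect_map (half_open_cylinder L) (subtopology (open_cone L) (insert None (cone_proj ` (topspace L \<times> {0..<\<delta>}))))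
      (\<lambda>(y, r). cone_proj (y, \<delta> * r))"
proof -
  let ?N = "insert None (cone_proj ` (topspace L \<times> {0..<\<delta>}))"
  have pre: "{p \<in> topspace (half_open_cylinder L). cone_proj p \<in> ?N} = topspace L \<times> {0..<\<delta>}"
    using d by (auto simp: image_iff cone_proj_eq)
  have "openin (top_of_set {0..<1::real}) {0..<\<delta>}"
  proof -
    have "{0..<\<delta>} = {0..<1} \<inter> {..<\<delta>}" using d by auto
    then show ?thesis by (metis openin_open_Int open_lessThan)
  qed
  then have "openin (half_open_cylinder L) (topspace L \<times> {0..<\<delta>})"
    by (simp add: half_open_cylinder_def openin_prod_Times_iff)
  moreover have "?N \<subseteq> cone_set (topspace L)"
    using d by (auto simp: cone_set_def)
  ultimately show "openin (open_cone L) ?N"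
    unfolding openin_open_cone pre by blast
  have "homeomorphic_maps (top_of_set {0..<1}) (top_of_set {0..<\<delta>}) (\<lambda>r. \<delta> * r) (\<lambda>r. r / \<delta>)"
    using d by (auto simp: homeomorphic_maps_def continuous_map_in_subtopology field_simps intro!: continuous_intros)
  then have "homeomorphic_maps (half_open_cylinder L) (prod_topology L (top_of_set {0..<\<delta>}))
      (\<lambda>(y, r). (y, \<delta> * r)) (\<lambda>(y, r). (y, r / \<delta>))"
    unfolding half_open_cylinder_def
    using homeomorphic_maps_prod[of L "top_of_set {0..<1}" L "top_of_set {0..<\<delta>}" "\<lambda>y. y" "\<lambda>r. \<delta> * r" "\<lambda>y. y" "\<lambda>r. r / \<delta>"]
    by (simp add: homeomorphic_maps_def)
  then have "perfect_map (half_open_cylinder L) (prod_topology L (top_of_set {0..<\<delta>})) (\<lambda>(y, r). (y, \<delta> * r))"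
    using homeomorphic_imp_perfect_map homeomorphic_maps_map by blast
  moreover have "prod_topology L (top_of_set {0..<\<delta>}) = subtopology (half_open_cylinder L) (topspace L \<times> {0..<\<delta>})"
  proof -
    have "{0..<1} \<inter> {0..<\<delta>} = {0..<\<delta>}" using d by auto
    then show ?thesis
      by (simp add: half_open_cylinder_def subtopology_Times subtopology_subtopology)
  qed
  moreover have "perfect_map (subtopology (half_open_cylinder L) (topspace L \<times> {0..<\<delta>})) (subtopology (open_cone L) ?N) cone_proj"
    by (rule perfect_map_restriction[OF perfect_map_cone_proj[OF L] pre])
  ultimately have "perfect_map (half_open_cylinder L) (subtopology (open_cone L) ?N) (cone_proj \<circ> (\<lambda>(y, r). (y, \<delta> * r)))"
    using perfect_map_compose by metis
  then show "perfect_map (half_open_cylinder L) (subtopology (open_cone L) ?N) (\<lambda>(y, r). cone_proj (y, \<delta> * r))"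
    by (simp add: o_def case_prod_unfold)
qed

section \<open>Cone charts of stratified pseudomanifolds\<close>

text \<open>
  A cone chart is used through the map \<open>e\<close> from box \<open>\<times>\<close> link \<open>\<times>\<close> interval that collapses the
  end \<open>r = 0\<close>.  Over a point of the top stratum, whose link is empty, \<open>A\<close> is an arbitrary
  point and \<open>J = {0}\<close>, so that both cases have the same shape.
\<close>

definition conical_chart ::
  "nat \<Rightarrow> nat \<Rightarrow> 'a topology \<Rightarrow> (int \<Rightarrow> 'a set) \<Rightarrow> nat \<Rightarrow> 'a set \<Rightarrow> (nat \<Rightarrow> real) \<Rightarrow> real \<Rightarrow>
   'a topology \<Rightarrow> real set \<Rightarrow> (int \<Rightarrow> 'a set) \<Rightarrow> ((nat \<Rightarrow> real) \<times> 'a \<times> real \<Rightarrow> 'a) \<Rightarrow> bool" where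
  "conical_chart l n Q F i U b \<epsilon> A J G e \<longleftrightarrow>
     openin Q U \<and> \<epsilon> > 0 \<and> b \<in> topspace (Euclidean_space (l + i)) \<and> compact_space A \<and> topspace A \<noteq> {} \<and>
     perfect_map (prod_topology (subtopology (Euclidean_space (l + i)) (box_at (l + i) b \<epsilon>))
        (prod_topology A (top_of_set J))) (subtopology Q U) e \<and>
     (\<forall>x\<in>box_at (l + i) b \<epsilon>. \<forall>x'\<in>box_at (l + i) b \<epsilon>. \<forall>q\<in>topspace A \<times> J. \<forall>q'\<in>topspace A \<times> J.
        e (x, q) = e (x', q') \<longleftrightarrow> x = x' \<and> cone_proj q = cone_proj q') \<and>
     (\<forall>x\<in>box_at (l + i) b \<epsilon>. \<forall>y\<in>topspace A. \<forall>r\<in>J. \<forall>j. -1 \<le> j \<longrightarrow> j \<le> int n - int i - 1 \<longrightarrow>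
        (e (x, (y, r)) \<in> F (int l + int i + j + 1) \<longleftrightarrow> r = 0 \<or> y \<in> G j)) \<and>
     (i = n \<and> J = {0} \<and> (\<forall>j. G j = {}) \<or>
      i < n \<and> J = {0..<1} \<and> (\<exists>l' n'. l' + n' = n - i - 1 \<and> stratified_pseudomanifold l' n' A G))"

lemma stratified_pseudomanifold_filtration: "stratified_pseudomanifold l n Q F \<Longrightarrow> filtration l n Q F"
  by (erule stratified_pseudomanifold.cases) auto

lemma stratified_pseudomanifold_Hausdorff: "stratified_pseudomanifold l n Q F \<Longrightarrow> Hausdorff_space Q"
  by (erule stratified_pseudomanifold.cases) (auto, metis Hausdorff_space_discrete_topology)

text \<open>A given cone chart is shrunk into \<open>V\<close> without changing its shape: the
  contractible set is replaced by a box around the first coordinate of \<open>p\<close>, and the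
  cone by a smaller cone with the same link.\<close>

lemma conical_chart_from_cone:
  assumes chart: "cone_chart l n Q F i p U0 B L G \<phi>" and V: "openin Q V" "p \<in> V"
    and pF: "p \<in> F (int (l + i))" and i: "i \<le> n" and L: "compact_space L"
    and cs: "(i = n \<and> topspace L = {} \<and> (\<forall>j. G j = {})) \<or>
      (i < n \<and> (\<exists>l' n'. l' + n' = n - i - 1 \<and> stratified_pseudomanifold l' n' L G))"
  obtains U b \<epsilon> A J e where "conical_chart l n Q F i U b \<epsilon> A J G e" "U \<subseteq> V"
    "\<And>y. y \<in> topspace A \<Longrightarrow> e (b, (y, 0)) = p" "0 \<in> J"
proof -
  let ?E = "Euclidean_space (l + i)"
  let ?P = "prod_topology (subtopology ?E B) (open_cone L)"
  have U0: "openin Q U0" "p \<in> U0" and B: "openin ?E B"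
    and \<phi>: "homeomorphic_map (subtopology Q U0) ?P \<phi>"
    and fil: "\<And>j. -1 \<le> j \<Longrightarrow> j \<le> int n - int i - 1 \<Longrightarrow>
        \<phi> ` (U0 \<inter> F (int l + int i + j + 1)) = B \<times> cone_set (G j)"
    using chart unfolding cone_chart_def by auto
  have U0t: "topspace (subtopology Q U0) = U0" and Bt: "topspace (subtopology ?E B) = B"
    using openin_subset[OF U0(1)] openin_subset[OF B] by auto
  obtain \<psi> where maps: "homeomorphic_maps (subtopology Q U0) ?P \<phi> \<psi>"
    using \<phi> homeomorphic_map_maps by blast
  have \<psi>: "homeomorphic_map ?P (subtopology Q U0) \<psi>"
    using maps homeomorphic_maps_map by blast
  have \<psi>\<phi>: "\<psi> (\<phi> q) = q" "\<phi> q \<in> B \<times> cone_set (topspace L)" if "q \<in> U0" for q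
    using maps that U0t Bt by (auto simp: homeomorphic_maps_def continuous_map_def Pi_iff)
  have \<phi>\<psi>: "\<phi> (\<psi> z) = z" "\<psi> z \<in> U0" if "z \<in> B \<times> cone_set (topspace L)" for z
    using maps that U0t Bt by (auto simp: homeomorphic_maps_def continuous_map_def Pi_iff)
  \<comment> \<open>At level -1 the filtration condition identifies the lowest stratum in the chart
    with the cone on the empty set, that is, with the apex. This locates \<open>p\<close> at an
    apex.\<close>
  have "G (-1) = {}"
    using cs
  proof (elim disjE conjE exE)
    fix l' n' assume "stratified_pseudomanifold l' n' L G"
    then have "\<forall>k<int l'. G k = {}"
      using stratified_pseudomanifold_filtration unfolding filtration_def by blast
    then show "G (-1) = {}" by simp
  qed simp
  then have "\<phi> ` (U0 \<inter> F (int l + int i)) = B \<times> {None}"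
    using fil[of "-1"] i by (simp add: cone_set_def)
  moreover have "\<phi> p \<in> \<phi> ` (U0 \<inter> F (int l + int i))"
    using U0(2) pF by simp
  ultimately obtain b where b: "\<phi> p = (b, None)" "b \<in> B"
    by auto
  have "openin (subtopology Q U0) (U0 \<inter> V)"
    using V(1) by (rule openin_subtopology_Int2)
  then have "openin ?P (\<phi> ` (U0 \<inter> V))"
    using homeomorphic_imp_open_map[OF \<phi>] by (simp add: open_map_def)
  moreover have "(b, None) \<in> \<phi> ` (U0 \<inter> V)"
    using b(1) U0(2) V(2) by (metis IntI imageI)
  ultimately obtain O1 N where N: "openin (subtopology ?E B) O1" "openin (open_cone L) N" "b \<in> O1" "None \<in> N"
      "O1 \<times> N \<subseteq> \<phi> ` (U0 \<inter> V)"
    unfolding openin_prod_topology_alt by meson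
  have "openin ?E O1" using N(1) B openin_trans_full by blast
  then obtain \<epsilon> where \<epsilon>: "\<epsilon> > 0" "box_at (l + i) b \<epsilon> \<subseteq> O1"
    using box_at_basis N(3) by blast
  let ?box = "box_at (l + i) b \<epsilon>"
  have boxB: "?box \<subseteq> B"
    using \<epsilon>(2) openin_subset[OF N(1)] Bt by auto
  have bE: "b \<in> topspace ?E" using b(2) openin_subset[OF B] by blast
  \<comment> \<open>\<open>K\<close> parametrises a small cone inside \<open>N\<close>: by the
    rescaled projection when there is a link, and by a constant map from a one-point space when
    \<open>i = n\<close> and the cone is just its apex.\<close>
  obtain N' K A J where N': "openin (open_cone L) N'" "N' \<subseteq> N"
    and A: "compact_space A" "topspace A \<noteq> {}" and J0: "0 \<in> J"
    and K: "perfect_map (prod_topology A (top_of_set J)) (subtopology (open_cone L) N') K"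
    and Kker: "\<And>q q'. \<lbrakk>q \<in> topspace A \<times> J; q' \<in> topspace A \<times> J\<rbrakk> \<Longrightarrow> K q = K q' \<longleftrightarrow> cone_proj q = cone_proj q'"
    and K0: "\<And>y. y \<in> topspace A \<Longrightarrow> K (y, 0) = None"
    and KG: "\<And>y r j. \<lbrakk>y \<in> topspace A; r \<in> J\<rbrakk> \<Longrightarrow> K (y, r) \<in> cone_set (G j) \<longleftrightarrow> r = 0 \<or> y \<in> G j"
    and AJ: "i = n \<and> J = {0} \<and> (\<forall>j. G j = {}) \<or>
      i < n \<and> J = {0..<1} \<and> (\<exists>l' n'. l' + n' = n - i - 1 \<and> stratified_pseudomanifold l' n' A G)"
  proof (cases "i = n")
    case True
    then have e: "topspace L = {}" "\<And>j. G j = {}" using cs by auto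
    show thesis
    proof (rule that[of "{None}" "discrete_topology {p}" "{0}" "\<lambda>_. None"])
      show "openin (open_cone L) {None}"
        using openin_topspace[of "open_cone L"] e(1) by (simp add: cone_set_def)
      show "perfect_map (prod_topology (discrete_topology {p}) (top_of_set {0::real})) (subtopology (open_cone L) {None}) (\<lambda>_. None)"
      proof (rule perfect_map_compact_Hausdorff)
        show "compact_space (prod_topology (discrete_topology {p}) (top_of_set {0::real}))"
          by (simp add: compact_space_prod_topology compact_space_discrete_topology compact_space_subtopology)
        show "Hausdorff_space (subtopology (open_cone L) {None})"
          unfolding Hausdorff_space_def by auto
      qed (auto simp: cone_set_def)
    qed (use True e N in \<open>auto simp: cone_proj_def cone_set_def compact_space_discrete_topology\<close>)
  next
    case False
    then obtain l' n' where sp: "i < n" "l' + n' = n - i - 1" "stratified_pseudomanifold l' n' L G"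
      using cs by blast
    have "topspace L \<noteq> {}"
      using stratified_pseudomanifold_filtration[OF sp(3)] by (auto simp: filtration_def)
    obtain \<delta> where \<delta>: "0 < \<delta>" "\<delta> \<le> 1" "insert None (cone_proj ` (topspace L \<times> {0..<\<delta>})) \<subseteq> N"
      using open_cone_apex_basis[OF L N(2,4)] by blast
    note sc = perfect_map_cone_scale[OF L \<open>topspace L \<noteq> {}\<close> \<delta>(1,2)]
    show thesis
    proof (rule that[OF sc(1) \<delta>(3) L \<open>topspace L \<noteq> {}\<close> _ sc(2)[unfolded half_open_cylinder_def]])
      have dr: "\<delta> * r < 1" if "0 \<le> r" "r < 1" for r
      proof -
        have "\<delta> * r \<le> 1 * r" using \<delta> that by (intro mult_right_mono) auto
        then show ?thesis using that by linarith
      qed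
      show "(case (y, r) of (y, r) \<Rightarrow> cone_proj (y, \<delta> * r)) \<in> cone_set (G j) \<longleftrightarrow> r = 0 \<or> y \<in> G j"
        if "y \<in> topspace L" "r \<in> {0..<1}" for y r j
        using that \<delta> dr[of r] by (auto simp: cone_set_def image_iff cone_proj_eq)
    qed (use sp \<delta> in \<open>auto simp: cone_proj_eq\<close>)
  qed
  let ?N = "?box \<times> N'"
  have N'c: "N' \<subseteq> cone_set (topspace L)" using openin_subset[OF N'(1)] by simp
  define U where "U = \<psi> ` ?N"
  define e where "e = \<psi> \<circ> (\<lambda>(x, q). (x, K q))"
  have Nsub: "?N \<subseteq> B \<times> cone_set (topspace L)" using boxB N'c by blast
  have UV: "U \<subseteq> V"
  proof
    fix q assume "q \<in> U"
    then obtain z where z: "z \<in> ?N" "q = \<psi> z" by (auto simp: U_def)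
    then have "z \<in> \<phi> ` (U0 \<inter> V)" using \<epsilon>(2) N'(2) N(5) by blast
    then show "q \<in> V" using z(2) \<psi>\<phi>(1) by auto
  qed
  have "openin ?P ?N"
    using N'(1) openin_box_at boxB by (simp add: openin_prod_Times_iff openin_subset_topspace_eq openin_open_subtopology B)
  then have "openin (subtopology Q U0) U"
    using homeomorphic_imp_open_map[OF \<psi>] by (simp add: open_map_def U_def)
  then have oU: "openin Q U" using U0(1) openin_trans_full by blast
  have UU0: "U \<subseteq> U0" using \<phi>\<psi>(2) Nsub by (auto simp: U_def)
  have "homeomorphic_map (subtopology ?P ?N) (subtopology (subtopology Q U0) U) \<psi>"
  proof (rule homeomorphic_map_subtopologies[OF \<psi>])
    have "topspace ?P \<inter> ?N = ?N" using Nsub Bt by auto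
    then show "\<psi> ` (topspace ?P \<inter> ?N) = topspace (subtopology Q U0) \<inter> U"
      using UU0 U0t by (auto simp: U_def)
  qed
  moreover have "subtopology (subtopology Q U0) U = subtopology Q U"
    using UU0 by (simp add: subtopology_subtopology Int_absorb1)
  moreover have "subtopology ?P ?N = prod_topology (subtopology ?E ?box) (subtopology (open_cone L) N')"
    using boxB by (simp add: subtopology_Times subtopology_subtopology Int_absorb1)
  ultimately have \<psi>N: "perfect_map (prod_topology (subtopology ?E ?box) (subtopology (open_cone L) N')) (subtopology Q U) \<psi>"
    using homeomorphic_imp_perfect_map by metis
  have "perfect_map (prod_topology (subtopology ?E ?box) (prod_topology A (top_of_set J)))
      (prod_topology (subtopology ?E ?box) (subtopology (open_cone L) N')) (\<lambda>(x, q). (x, K q))"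
    using perfect_map_prod[OF perfect_map_id K] by simp
  then have e: "perfect_map (prod_topology (subtopology ?E ?box) (prod_topology A (top_of_set J))) (subtopology Q U) e"
    unfolding e_def by (rule perfect_map_compose[OF _ \<psi>N])
  have KN: "K q \<in> N'" if "q \<in> topspace A \<times> J" for q
    using perfect_imp_surjective_map[OF K] that by auto
  show thesis
  proof (rule that[of U b \<epsilon> A J e])
    show "conical_chart l n Q F i U b \<epsilon> A J G e"
      unfolding conical_chart_def
    proof (intro conjI ballI allI impI)
      fix x x' q q' assume x: "x \<in> ?box" "x' \<in> ?box" "q \<in> topspace A \<times> J" "q' \<in> topspace A \<times> J"
      then have in1: "(x, K q) \<in> B \<times> cone_set (topspace L)" and in2: "(x', K q') \<in> B \<times> cone_set (topspace L)"
        using KN Nsub by auto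
      have "e (x, q) = \<psi> (x, K q)" "e (x', q') = \<psi> (x', K q')" by (simp_all add: e_def)
      then have "e (x, q) = e (x', q') \<longleftrightarrow> (x, K q) = (x', K q')"
        using \<phi>\<psi>(1)[OF in1] \<phi>\<psi>(1)[OF in2] by metis
      then show "e (x, q) = e (x', q') \<longleftrightarrow> x = x' \<and> cone_proj q = cone_proj q'"
        using Kker[OF x(3,4)] by simp
    next
      fix x y r and j :: int assume x: "x \<in> ?box" "y \<in> topspace A" "r \<in> J" and j: "-1 \<le> j" "j \<le> int n - int i - 1"
      then have in1: "(x, K (y, r)) \<in> B \<times> cone_set (topspace L)"
        using KN[of "(y, r)"] Nsub by auto
      let ?q = "e (x, (y, r))"
      have q: "\<phi> ?q = (x, K (y, r))" "?q \<in> U0" using \<phi>\<psi>[OF in1] by (auto simp: e_def)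
      have "?q \<in> F (int l + int i + j + 1) \<longleftrightarrow> \<phi> ?q \<in> \<phi> ` (U0 \<inter> F (int l + int i + j + 1))"
      proof
        assume "\<phi> ?q \<in> \<phi> ` (U0 \<inter> F (int l + int i + j + 1))"
        then obtain w where "w \<in> U0" "w \<in> F (int l + int i + j + 1)" "\<phi> ?q = \<phi> w" by blast
        then show "?q \<in> F (int l + int i + j + 1)" using \<psi>\<phi>(1) q(2) by metis
      qed (use q(2) in blast)
      also have "\<dots> \<longleftrightarrow> K (y, r) \<in> cone_set (G j)"
        unfolding fil[OF j] q(1) using x(1) boxB by auto
      finally show "?q \<in> F (int l + int i + j + 1) \<longleftrightarrow> r = 0 \<or> y \<in> G j"
        using KG[OF x(2,3)] by simp
    qed (use oU \<epsilon> bE A e AJ in auto)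
    show "e (b, (y, 0)) = p" if "y \<in> topspace A" for y
      using K0[OF that] b(1) \<psi>\<phi>(1)[OF U0(2)] by (simp add: e_def)
  qed (use UV J0 in auto)
qed

theorem conical_chart_exists:
  assumes Q: "stratified_pseudomanifold l n Q F" and i: "i \<le> n" and p: "p \<in> F (int (l + i)) - F (int (l + i) - 1)"
    and V: "openin Q V" "p \<in> V"
  obtains U b \<epsilon> A J G e where "conical_chart l n Q F i U b \<epsilon> A J G e" "U \<subseteq> V"
    "\<And>y. y \<in> topspace A \<Longrightarrow> e (b, (y, 0)) = p" "0 \<in> J"
  using Q
proof cases
  case discrete
  have pQ: "p \<in> topspace Q" using V openin_subset by blast
  \<comment> \<open>In dimension 0 the point \<open>p\<close> is open, and the chart has a box in
    0-dimensional space, which is a single point.\<close>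
  have E0: "topspace (Euclidean_space 0) = {\<lambda>_. 0}" by (auto simp: topspace_Euclidean_space)
  have box: "box_at 0 (\<lambda>_. 0) 1 = {\<lambda>_. 0}" by (auto simp: box_at_def E0)
  have F: "F 0 = topspace Q" using discrete by (simp add: filtration_def)
  have i0: "i = 0" using i discrete by simp
  have oP: "openin Q {p}"
    using pQ discrete(4) by (metis empty_subsetI insert_subset openin_discrete_topology)
  have "conical_chart l n Q F i {p} (\<lambda>_. 0) 1 (discrete_topology {p}) {0} (\<lambda>_. {}) (\<lambda>_. p)"
    unfolding conical_chart_def
  proof (intro conjI ballI allI impI)
    show "perfect_map (prod_topology (subtopology (Euclidean_space (l + i)) (box_at (l + i) (\<lambda>_. 0) 1))
       (prod_topology (discrete_topology {p}) (top_of_set {0::real}))) (subtopology Q {p}) (\<lambda>_. p)"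
    proof (rule perfect_map_compact_Hausdorff)
      have "compact_space (subtopology (Euclidean_space 0) {\<lambda>_. 0})"
        by (simp add: compact_space_subtopology finite_imp_compactin E0)
      then show "compact_space (prod_topology (subtopology (Euclidean_space (l + i)) (box_at (l + i) (\<lambda>_. 0) 1))
         (prod_topology (discrete_topology {p}) (top_of_set {0::real})))"
        using discrete i0
        by (simp add: box compact_space_prod_topology compact_space_discrete_topology compact_space_subtopology)
      show "Hausdorff_space (subtopology Q {p})" unfolding Hausdorff_space_def by auto
    qed (use pQ discrete i0 in \<open>auto simp: box E0\<close>)
  qed (use oP F discrete i0 pQ in \<open>auto simp: compact_space_discrete_topology E0 box cone_proj_def\<close>)
  then show thesis using that[of "{p}" "\<lambda>_. 0" 1 "discrete_topology {p}" "{0}" "\<lambda>_. {}" "\<lambda>_. p"] V by simp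
next
  case conical
  then obtain U B L G \<phi> where "compact_space L"
      "(i = n \<and> topspace L = {} \<and> (\<forall>j. G j = {})) \<or>
         (i < n \<and> (\<exists>l' n'. l' + n' = n - i - 1 \<and> stratified_pseudomanifold l' n' L G))"
      "cone_chart l n Q F i p U B L G \<phi>"
    using i p by metis
  then show thesis
    using conical_chart_from_cone[of l n Q F i p U B L G \<phi> V] V p i that by (metis DiffD1)
qed

section \<open>Layers, strata and the frontier condition\<close>

definition layer :: "nat \<Rightarrow> (int \<Rightarrow> 'a set) \<Rightarrow> nat \<Rightarrow> 'a set" where
  "layer l F i = F (int (l + i)) - F (int (l + i) - 1)"

lemma filtration_mono:
  assumes F: "filtration l n Q F" and jk: "j \<le> k" "k \<le> int (l + n)"
  shows "F j \<subseteq> F k"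
  using jk
proof (induction k rule: int_ge_induct)
  case (step k)
  have "F (k + 1 - 1) \<subseteq> F (k + 1)"
    using F step.prems unfolding filtration_def by blast
  then show ?case using step by simp
qed simp

lemma filtration_closedin: "filtration l n Q F \<Longrightarrow> k \<le> int (l + n) \<Longrightarrow> closedin Q (F k)"
  unfolding filtration_def by blast

lemma filtration_layer:
  assumes F: "filtration l n Q F" and q: "q \<in> topspace Q"
  obtains i where "i \<le> n" "q \<in> layer l F i"
proof -
  define i where "i = (LEAST i. q \<in> F (int (l + i)))"
  have n: "q \<in> F (int (l + n))" using F q by (simp add: filtration_def)
  have qi: "q \<in> F (int (l + i))" unfolding i_def using n by (rule LeastI)
  have "i \<le> n" unfolding i_def using n by (rule Least_le)
  moreover have "q \<notin> F (int (l + i) - 1)"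
  proof (cases i)
    case 0
    have "F (int l - 1) = {}" using F by (simp add: filtration_def)
    then show ?thesis by (simp add: 0)
  next
    case (Suc k)
    then have "q \<notin> F (int (l + k))" using not_less_Least[of k "\<lambda>i. q \<in> F (int (l + i))"] by (simp add: i_def)
    then show ?thesis by (simp add: Suc)
  qed
  ultimately show thesis using that qi by (simp add: layer_def)
qed

lemma layer_mem_iff:
  assumes F: "filtration l n Q F" and "i \<le> n" "q \<in> layer l F i" "d \<le> int n"
  shows "q \<in> F (int l + d) \<longleftrightarrow> int i \<le> d"
proof
  assume "q \<in> F (int l + d)"
  show "int i \<le> d"
  proof (rule ccontr)
    assume "\<not> int i \<le> d"
    then have "F (int l + d) \<subseteq> F (int (l + i) - 1)"
      using assms(2) by (intro filtration_mono[OF F]) auto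
    then show False using \<open>q \<in> F (int l + d)\<close> assms(3) by (auto simp: layer_def)
  qed
next
  assume "int i \<le> d"
  then have "F (int (l + i)) \<subseteq> F (int l + d)"
    using assms(4) by (intro filtration_mono[OF F]) auto
  then show "q \<in> F (int l + d)" using assms(3) by (auto simp: layer_def)
qed

lemma layer_unique:
  assumes F: "filtration l n Q F" and "i \<le> n" "j \<le> n" "q \<in> layer l F i" "q \<in> layer l F j"
  shows "i = j"
  using layer_mem_iff[OF F assms(2,4), of "int j"] layer_mem_iff[OF F assms(3,5), of "int j"]
    layer_mem_iff[OF F assms(2,4), of "int i"] layer_mem_iff[OF F assms(3,5), of "int i"] assms(2,3)
  by auto

lemma layer_subset: "filtration l n Q F \<Longrightarrow> i \<le> n \<Longrightarrow> layer l F i \<subseteq> topspace Q"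
  using closedin_subset[OF filtration_closedin, of l n Q F "int (l + i)"] by (auto simp: layer_def)

lemma strata_iff:
  "S \<in> strata l n Q F \<longleftrightarrow> (\<exists>i\<le>n. S \<in> connected_components_of (subtopology Q (layer l F i)))"
  by (auto simp: strata_def strata_of_dim_def layer_def)

lemma component_subset: "S \<in> connected_components_of (subtopology Q A) \<Longrightarrow> S \<subseteq> A"
  using connected_components_of_subset by fastforce

lemma component_connectedin: "S \<in> connected_components_of (subtopology Q A) \<Longrightarrow> connectedin Q S"
  using connectedin_connected_components_of connectedin_subtopology by blast

lemma component_maximal:
  assumes "S \<in> connected_components_of (subtopology Q A)" "connectedin Q C" "C \<subseteq> A" "C \<inter> S \<noteq> {}"
  shows "C \<subseteq> S"
  using connected_components_of_maximal[OF assms(1)] assms(2-4)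
  by (auto simp: connectedin_subtopology disjnt_def)

lemma layer_component:
  assumes "filtration l n Q F" "i \<le> n" "q \<in> layer l F i"
  obtains S where "S \<in> connected_components_of (subtopology Q (layer l F i))" "q \<in> S"
proof -
  have "q \<in> \<Union>(connected_components_of (subtopology Q (layer l F i)))"
    unfolding Union_connected_components_of using assms layer_subset by fastforce
  then show thesis using that by blast
qed

text \<open>The lower members of the filtration are closed and miss \<open>p\<close>, so the chart
  can avoid them. Layer \<open>i\<close> is then the lowest one in \<open>U\<close> and coincides
  there with the set of cone parameter 0.\<close>

theorem layer_chart:
  assumes Q: "stratified_pseudomanifold l n Q F" and i: "i \<le> n" and p: "p \<in> layer l F i"
    and V: "openin Q V" "p \<in> V"
  obtains U b \<epsilon> A J G e where "conical_chart l n Q F i U b \<epsilon> A J G e" "U \<subseteq> V" "U \<inter> F (int (l + i) - 1) = {}"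
    "\<And>y. y \<in> topspace A \<Longrightarrow> e (b, (y, 0)) = p" "0 \<in> J"
proof -
  have "closedin Q (F (int (l + i) - 1))"
    using i by (intro filtration_closedin[OF stratified_pseudomanifold_filtration[OF Q]]) auto
  then have V': "openin Q (V - F (int (l + i) - 1))" using V(1) by blast
  have "p \<in> V - F (int (l + i) - 1)" using V(2) p by (auto simp: layer_def)
  then show thesis
  proof (rule conical_chart_exists[OF Q i p[unfolded layer_def] V'])
    fix U b \<epsilon> A J G e
    assume *: "conical_chart l n Q F i U b \<epsilon> A J G e" "U \<subseteq> V - F (int (l + i) - 1)"
      "\<And>y. y \<in> topspace A \<Longrightarrow> e (b, (y, 0)) = p" "0 \<in> J"
    show thesis by (rule that[OF *(1) _ _ *(3,4)]) (use *(2) in auto)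
  qed
qed

locale chart =
  fixes l n Q F i U b \<epsilon> A J G e
  assumes F: "filtration l n Q F" and i: "i \<le> n"
    and ch: "conical_chart l n Q F i U b \<epsilon> A J G e"
    and low: "U \<inter> F (int (l + i) - 1) = {}" and J0: "0 \<in> J"
begin

abbreviation "BX \<equiv> box_at (l + i) b \<epsilon>"
abbreviation "D \<equiv> prod_topology (subtopology (Euclidean_space (l + i)) BX) (prod_topology A (top_of_set J))"

lemma open_U: "openin Q U" and eps: "\<epsilon> > 0" and bE: "b \<in> topspace (Euclidean_space (l + i))"
  and A: "compact_space A" "topspace A \<noteq> {}" and perfect: "perfect_map D (subtopology Q U) e"
  using ch unfolding conical_chart_def by auto

lemma U_subset: "U \<subseteq> topspace Q" using openin_subset[OF open_U] .

lemma topspace_D: "topspace D = BX \<times> topspace A \<times> J"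
  by (simp only: topspace_prod_topology topspace_box_at topspace_euclidean_subtopology)

lemma J_cases: "J = {0} \<or> J = {0..<1}"
  using ch unfolding conical_chart_def by auto

lemma J_subset: "J \<subseteq> {0..<1}"
  using J_cases by auto

lemma b_in: "b \<in> BX"
  using center_in_box_at[OF bE eps] .

lemma e_image: "e ` (BX \<times> topspace A \<times> J) = U"
  using perfect_imp_surjective_map[OF perfect] U_subset topspace_D by auto

lemma e_in: "x \<in> BX \<Longrightarrow> y \<in> topspace A \<Longrightarrow> r \<in> J \<Longrightarrow> e (x, (y, r)) \<in> U"
  using e_image by blast

lemma e_cont: "continuous_map D Q e"
  using perfect_imp_continuous_map[OF perfect] continuous_map_in_subtopology by blast

lemma e_eq:
  assumes "x \<in> BX" "y \<in> topspace A" "r \<in> J" "x' \<in> BX" "y' \<in> topspace A" "r' \<in> J"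
  shows "e (x, (y, r)) = e (x', (y', r')) \<longleftrightarrow> x = x' \<and> r = r' \<and> (r = 0 \<or> y = y')"
proof -
  have "e (x, (y, r)) = e (x', (y', r')) \<longleftrightarrow> x = x' \<and> cone_proj (y, r) = cone_proj (y', r')"
    using ch assms unfolding conical_chart_def by blast
  then show ?thesis by (auto simp: cone_proj_eq)
qed

lemma e_F:
  assumes "x \<in> BX" "y \<in> topspace A" "r \<in> J" "-1 \<le> j" "j \<le> int n - int i - 1"
  shows "e (x, (y, r)) \<in> F (int l + int i + j + 1) \<longleftrightarrow> r = 0 \<or> y \<in> G j"
proof -
  have "\<forall>x\<in>BX. \<forall>y\<in>topspace A. \<forall>r\<in>J. \<forall>j. -1 \<le> j \<longrightarrow> j \<le> int n - int i - 1 \<longrightarrow>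
        (e (x, (y, r)) \<in> F (int l + int i + j + 1) \<longleftrightarrow> r = 0 \<or> y \<in> G j)"
    by (rule ch[unfolded conical_chart_def, THEN conjunct2, THEN conjunct2, THEN conjunct2, THEN conjunct2,
        THEN conjunct2, THEN conjunct2, THEN conjunct2, THEN conjunct1])
  then show ?thesis using assms by blast
qed

lemma link_cases: "i = n \<and> J = {0} \<and> (\<forall>j. G j = {}) \<or>
      i < n \<and> J = {0..<1} \<and> (\<exists>l' n'. l' + n' = n - i - 1 \<and> stratified_pseudomanifold l' n' A G)"
  by (rule ch[unfolded conical_chart_def, THEN conjunct2, THEN conjunct2, THEN conjunct2, THEN conjunct2,
      THEN conjunct2, THEN conjunct2, THEN conjunct2, THEN conjunct2])

lemma G_neg: "G (-1) = {}"
  using link_cases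
proof (elim disjE conjE exE)
  fix l' n' assume "stratified_pseudomanifold l' n' A G"
  then have "\<forall>k<int l'. G k = {}"
    using stratified_pseudomanifold_filtration unfolding filtration_def by blast
  then show "G (-1) = {}" by simp
qed simp

lemma e_layer: "x \<in> BX \<Longrightarrow> y \<in> topspace A \<Longrightarrow> r \<in> J \<Longrightarrow> e (x, (y, r)) \<in> layer l F i \<longleftrightarrow> r = 0"
  using e_F[of x y r "-1"] G_neg low e_in[of x y r] i by (auto simp: layer_def)

text \<open>Dimension count: a link layer of dimension \<open>l' + k\<close> is multiplied by the
  box, of dimension \<open>l + i\<close>, and by the open ray of positive cone parameters, which
  accounts for the extra 1.\<close>

lemma e_layer_link:
  assumes "x \<in> BX" "y \<in> topspace A" "r \<in> J" "r \<noteq> 0" "l' + n' = n - i - 1" "i < n" "k \<le> n'"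
  shows "e (x, (y, r)) \<in> layer l F (i + l' + k + 1) \<longleftrightarrow> y \<in> layer l' G k"
proof -
  \<comment> \<open>A link layer is the difference of two consecutive members of \<open>G\<close>,
    and both indices have to be in the range of \<open>e_F\<close>; the lower one reaches -1 when
    \<open>l'\<close> and \<open>k\<close> are 0.\<close>
  have "-1 \<le> int (l' + k)" "int (l' + k) \<le> int n - int i - 1"
    "-1 \<le> int (l' + k) - 1" "int (l' + k) - 1 \<le> int n - int i - 1"
    using assms(5-7) by auto
  note e_F[OF assms(1-3) this(1,2)] e_F[OF assms(1-3) this(3,4)]
  moreover have "int l + int i + int (l' + k) + 1 = int (l + (i + l' + k + 1))"
    "int l + int i + (int (l' + k) - 1) + 1 = int (l + (i + l' + k + 1)) - 1" by auto
  ultimately show ?thesis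
    using assms(4) unfolding layer_def by (simp only: Diff_iff simp_thms)
qed

lemma connected_slice:
  assumes "connected J'" "J' \<subseteq> J" "y \<in> topspace A"
  shows "connectedin Q (e ` (BX \<times> {y} \<times> J'))"
proof -
  have "connectedin (subtopology (Euclidean_space (l + i)) BX) BX"
    using connected_box_at box_at_subset by (auto simp: connectedin_def subtopology_subtopology)
  moreover have "connectedin (top_of_set J) J'"
    using assms by (simp add: connectedin_subtopology)
  moreover have "connectedin A {y}" using assms(3) by simp
  ultimately have "connectedin D (BX \<times> {y} \<times> J')"
    by (simp add: connectedin_Times)
  then show ?thesis by (rule connectedin_continuous_map_image[OF e_cont])
qed

text \<open>The part of layer \<open>i\<close> inside \<open>U\<close> is the image of the box at
  cone parameter 0, hence connected, and lies in a single component.\<close>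

lemma core_subset_component:
  assumes S: "S \<in> connected_components_of (subtopology Q (layer l F i))" and ne: "U \<inter> S \<noteq> {}"
  shows "U \<inter> layer l F i \<subseteq> S"
proof -
  obtain y0 where y0: "y0 \<in> topspace A" using A(2) by blast
  have core: "U \<inter> layer l F i = e ` (BX \<times> {y0} \<times> {0})"
  proof
    show "U \<inter> layer l F i \<subseteq> e ` (BX \<times> {y0} \<times> {0})"
    proof
      fix q assume q: "q \<in> U \<inter> layer l F i"
      then obtain x y r where *: "x \<in> BX" "y \<in> topspace A" "r \<in> J" "q = e (x, (y, r))"
        using e_image by (auto simp: image_iff)
      then have "r = 0" using e_layer q by blast
      then have "q = e (x, (y0, 0))" using e_eq[of x y 0 x y0 0] * y0 J0 by simp
      then show "q \<in> e ` (BX \<times> {y0} \<times> {0})" using *(1) by blast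
    qed
  qed (use e_in e_layer y0 J0 in auto)
  have "connectedin Q (U \<inter> layer l F i)"
    unfolding core by (rule connected_slice) (use y0 J0 in auto)
  moreover have "(U \<inter> layer l F i) \<inter> S \<noteq> {}"
    using ne component_subset[OF S] by blast
  ultimately show ?thesis
    by (rule component_maximal[OF S _ Int_lower2])
qed

text \<open>If \<open>S'\<close> meets the chart off the core, over a link point \<open>y\<close>,
  then it contains everything over \<open>y\<close> with positive parameter, because that set is
  connected and lies in one layer. Letting the parameter tend to 0 reaches every point of the
  core.\<close>

lemma core_subset_closure:
  assumes "S' \<in> strata l n Q F" and ne: "U \<inter> S' \<noteq> {}"
  shows "U \<inter> layer l F i \<subseteq> Q closure_of S'"
proof -
  obtain k where k: "k \<le> n" and S': "S' \<in> connected_components_of (subtopology Q (layer l F k))"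
    using assms(1) strata_iff by blast
  obtain x y r where q: "x \<in> BX" "y \<in> topspace A" "r \<in> J" "e (x, (y, r)) \<in> S'"
    using ne e_image by (auto simp: image_iff)
  have qk: "e (x, (y, r)) \<in> layer l F k" using q(4) component_subset[OF S'] by blast
  show ?thesis
  proof (cases "r = 0")
    case True
    then have "e (x, (y, r)) \<in> layer l F i" using e_layer q by blast
    then have "k = i" using layer_unique[OF F k i qk] by blast
    then have "U \<inter> layer l F i \<subseteq> S'"
      using core_subset_component S' ne by blast
    moreover have "S' \<subseteq> topspace Q"
      using component_connectedin[OF S'] by (simp add: connectedin_subset_topspace)
    ultimately show ?thesis using closure_of_subset by blast
  next
    case False
    then have J: "J = {0..<1}" using J_cases q(3) by auto
    obtain l' n' where lk: "i < n" "l' + n' = n - i - 1" "stratified_pseudomanifold l' n' A G"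
      using link_cases q(3) False by auto
    obtain k' where k': "k' \<le> n'" "y \<in> layer l' G k'"
      using filtration_layer[OF stratified_pseudomanifold_filtration[OF lk(3)] q(2)] by blast
    have lay: "e (x', (y, r')) \<in> layer l F (i + l' + k' + 1)" if "x' \<in> BX" "r' \<in> J" "r' \<noteq> 0" for x' r'
      using e_layer_link[OF that(1) q(2) that(2,3) lk(2,1) k'(1)] k'(2) by blast
    have "k = i + l' + k' + 1"
      using layer_unique[OF F k _ qk lay[OF q(1,3) False]] lk k'(1) by simp
    then have "e ` (BX \<times> {y} \<times> {0<..<1}) \<subseteq> layer l F k"
      using lay J by auto
    moreover have "connectedin Q (e ` (BX \<times> {y} \<times> {0<..<1}))"
      by (rule connected_slice) (use q J in auto)
    moreover have "e (x, (y, r)) \<in> e ` (BX \<times> {y} \<times> {0<..<1}) \<inter> S'"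
      using q False J by auto
    ultimately have sub: "e ` (BX \<times> {y} \<times> {0<..<1}) \<subseteq> S'"
      using component_maximal[OF S'] by blast
    show ?thesis
    proof
      fix s assume s: "s \<in> U \<inter> layer l F i"
      then obtain x' y' r' where *: "x' \<in> BX" "y' \<in> topspace A" "r' \<in> J" "s = e (x', (y', r'))"
        using e_image by (auto simp: image_iff)
      then have "r' = 0" using e_layer s by blast
      \<comment> \<open>At parameter 0 all link points are identified, so the core point may be
        approached along the ray over the particular \<open>y\<close> at which \<open>S'\<close> was
        met.\<close>
      then have s: "s = e (x', (y, 0))" using e_eq[of x' y' 0 x' y 0] * q(2) J0 by simp
      define g where "g = (\<lambda>r::real. e (x', (y, r)))"
      have "continuous_map (top_of_set J) D (\<lambda>r. (x', (y, r)))"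
        using *(1) q(2) box_at_subset by (auto simp: continuous_map_paired)
      then have g: "continuous_map (top_of_set J) Q g"
        unfolding g_def using continuous_map_compose[OF _ e_cont] by (simp add: o_def)
      have "(0::real) \<in> closure {0<..<1}" by simp
      then have "0 \<in> top_of_set J closure_of {0<..<1}"
        using J by (simp add: closure_of_subtopology Int_absorb1 greaterThanLessThan_subseteq_atLeastLessThan_iff)
      then have "g 0 \<in> Q closure_of (g ` {0<..<1})"
        using continuous_map_image_closure_subset[OF g] by blast
      moreover have "g ` {0<..<1} \<subseteq> S'" using sub *(1) by (auto simp: g_def)
      ultimately show "s \<in> Q closure_of S'"
        using s closure_of_mono by (fastforce simp: g_def)
    qed
  qed
qed

end

text \<open>\<open>stratified_pseudomanifold\<close> does not postulate the frontier condition. In a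
  chart the closure of \<open>S'\<close> contains all of the core or none of it, so its trace on
  \<open>S\<close> is open as well as closed, and \<open>S\<close> is connected.\<close>

theorem strata_frontier:
  assumes Q: "stratified_pseudomanifold l n Q F"
    and S: "S \<in> strata l n Q F" and S': "S' \<in> strata l n Q F" and ne: "S \<inter> Q closure_of S' \<noteq> {}"
  shows "S \<subseteq> Q closure_of S'"
proof -
  have F: "filtration l n Q F" by (rule stratified_pseudomanifold_filtration[OF Q])
  obtain i where i: "i \<le> n" and Si: "S \<in> connected_components_of (subtopology Q (layer l F i))"
    using S strata_iff by blast
  have Slay: "S \<subseteq> layer l F i" by (rule component_subset[OF Si])
  let ?T = "S \<inter> Q closure_of S'"
  have "openin (subtopology Q S) ?T"
    unfolding openin_subopen[of _ ?T]
  proof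
    fix p assume p: "p \<in> ?T"
    then have pl: "p \<in> layer l F i" "p \<in> topspace Q" using Slay layer_subset[OF F i] by blast+
    obtain U b \<epsilon> A J G e where ch: "conical_chart l n Q F i U b \<epsilon> A J G e" "U \<inter> F (int (l + i) - 1) = {}"
        "\<And>y. y \<in> topspace A \<Longrightarrow> e (b, (y, 0)) = p" "0 \<in> J"
      by (rule layer_chart[OF Q i pl(1) openin_topspace pl(2)]) (rule that)
    note ep = ch(3)
    interpret chart l n Q F i U b \<epsilon> A J G e by unfold_locales (use F i ch in auto)
    have pU: "p \<in> U" using A(2) ep e_in[OF b_in _ J0] by (metis ex_in_conv)
    then have "U \<inter> S' \<noteq> {}" using p open_U by (auto simp: in_closure_of)
    then have "U \<inter> layer l F i \<subseteq> Q closure_of S'" by (rule core_subset_closure[OF S'])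
    then have "S \<inter> U \<subseteq> ?T" using Slay by blast
    then show "\<exists>V. openin (subtopology Q S) V \<and> p \<in> V \<and> V \<subseteq> ?T"
      using pU p open_U by (intro exI[of _ "S \<inter> U"]) (auto simp: openin_subtopology_Int2)
  qed
  moreover have "closedin (subtopology Q S) ?T"
    by (simp add: closedin_subtopology_Int_closed closedin_closure_of)
  moreover have "connected_space (subtopology Q S)"
    using component_connectedin[OF Si] by (simp add: connectedin_def)
  ultimately have "?T = topspace (subtopology Q S)"
    using ne unfolding connected_space_clopen_in by blast
  then show ?thesis
    using component_connectedin[OF Si] connectedin_subset_topspace by fastforce
qed

section \<open>Orbit models\<close>

text \<open>
  These are the properties of a canonical model over \<open>Q\<close> that are inherited by the links of its
  points; they make the induction possible.  Sections exist only locally, since the principal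
  bundle may be nontrivial.
\<close>

locale orbit_model =
  fixes l n m :: nat and Q :: "'q topology" and F :: "int \<Rightarrow> 'q set"
    and X :: "'a topology" and act :: "cvec \<Rightarrow> 'a \<Rightarrow> 'a" and \<pi> :: "'a \<Rightarrow> 'q" and \<mu> :: "'q \<Rightarrow> cvec set"
  assumes nm: "n \<le> m"
    and strat: "stratified_pseudomanifold l n Q F"
    and compact_X: "compact_space X" and Hausdorff_X: "Hausdorff_space X" and sc_X: "second_countable X"
    and action: "torus_action m X act"
    and proj: "continuous_map X Q \<pi>" and proj_onto: "\<pi> ` topspace X = topspace Q"
    and fibre: "\<And>x y. \<lbrakk>x \<in> topspace X; y \<in> topspace X\<rbrakk> \<Longrightarrow> \<pi> x = \<pi> y \<longleftrightarrow> (\<exists>t\<in>torus m. y = act t x)"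
    and local_section: "\<And>q. q \<in> topspace Q \<Longrightarrow>
      \<exists>U s. openin Q U \<and> q \<in> U \<and> continuous_map (subtopology Q U) X s \<and> (\<forall>u\<in>U. \<pi> (s u) = u)"
    and isotropy_eq: "\<And>x. x \<in> topspace X \<Longrightarrow> isotropy m act x = \<mu> (\<pi> x)"
    and mu_dim: "\<And>i q. \<lbrakk>i \<le> n; q \<in> layer l F i\<rbrakk> \<Longrightarrow> subtorus_of_dim m (n - i) (\<mu> q)"
    and mu_const: "\<And>i C q q'. \<lbrakk>i \<le> n; connectedin Q C; C \<subseteq> layer l F i; q \<in> C; q' \<in> C\<rbrakk> \<Longrightarrow> \<mu> q = \<mu> q'"
    and mu_semicont: "\<And>q. q \<in> topspace Q \<Longrightarrow> \<exists>U. openin Q U \<and> q \<in> U \<and> (\<forall>q'\<in>U. \<mu> q' \<subseteq> \<mu> q)"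
begin

lemma filt: "filtration l n Q F"
  by (rule stratified_pseudomanifold_filtration[OF strat])

lemma Hausdorff_Q: "Hausdorff_space Q"
  by (rule stratified_pseudomanifold_Hausdorff[OF strat])

lemma act_cont: "continuous_map (prod_topology (torus_space m) X) X (\<lambda>(t, x). act t x)"
  using action by (simp add: torus_action_def)

lemma act_one: "x \<in> topspace X \<Longrightarrow> act (\<lambda>_. 1) x = x"
  using action by (simp add: torus_action_def)

lemma act_mult: "\<lbrakk>s \<in> torus m; t \<in> torus m; x \<in> topspace X\<rbrakk> \<Longrightarrow> act (cmult s t) x = act s (act t x)"
  using action by (simp add: torus_action_def)

lemma act_in: "t \<in> torus m \<Longrightarrow> x \<in> topspace X \<Longrightarrow> act t x \<in> topspace X"
  using continuous_map_image_subset_topspace[OF act_cont] by auto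

lemma proj_in: "x \<in> topspace X \<Longrightarrow> \<pi> x \<in> topspace Q"
  using proj_onto by blast

lemma proj_act: "t \<in> torus m \<Longrightarrow> x \<in> topspace X \<Longrightarrow> \<pi> (act t x) = \<pi> x"
  using fibre[of x "act t x"] act_in by auto

lemma act_cinv: "t \<in> torus m \<Longrightarrow> x \<in> topspace X \<Longrightarrow> act (cinv t) (act t x) = x"
  using act_mult[of "cinv t" t x] by (simp add: cmult_cinv act_one)

lemma act_eq_iff:
  assumes "s \<in> torus m" "t \<in> torus m" "x \<in> topspace X"
  shows "act s x = act t x \<longleftrightarrow> cmult (cinv s) t \<in> \<mu> (\<pi> x)"
proof -
  have "act s x = act t x \<longleftrightarrow> act (cmult (cinv s) t) x = x"
  proof
    assume "act s x = act t x"
    then show "act (cmult (cinv s) t) x = x"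
      using assms act_mult[of "cinv s" t x] act_cinv[of s x] by simp
  next
    assume "act (cmult (cinv s) t) x = x"
    then have "act s (act (cmult (cinv s) t) x) = act s x" by simp
    then show "act s x = act t x"
      using assms act_mult[of s "cmult (cinv s) t" x] by simp
  qed
  also have "\<dots> \<longleftrightarrow> cmult (cinv s) t \<in> isotropy m act x"
    using assms by (simp add: isotropy_def)
  finally show ?thesis using isotropy_eq[OF assms(3)] by simp
qed

lemma proj_layer:
  assumes "x \<in> topspace X"
  obtains i where "i \<le> n" "\<pi> x \<in> layer l F i"
  using filtration_layer[OF filt proj_in[OF assms]] .

lemma perfect_proj: "perfect_map X Q \<pi>"
  by (rule perfect_map_compact_Hausdorff[OF proj compact_X Hausdorff_Q proj_onto])

lemma act_continuous: "t \<in> torus m \<Longrightarrow> continuous_map X X (act t)"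
  using continuous_map_compose[OF _ act_cont, of X "\<lambda>x. (t, x)"] by (simp add: o_def continuous_map_paired)

text \<open>The saturation of an open set is the union of its translates under the torus.\<close>

lemma open_map_proj: "open_map X Q \<pi>"
  unfolding open_map_def
proof (intro allI impI)
  fix W assume W: "openin X W"
  have Wt: "W \<subseteq> topspace X" using openin_subset[OF W] .
  have eq: "{x \<in> topspace X. \<pi> x \<in> \<pi> ` W} = (\<Union>t\<in>torus m. {x \<in> topspace X. act t x \<in> W})"
  proof (intro Set.set_eqI iffI)
    fix x assume "x \<in> {x \<in> topspace X. \<pi> x \<in> \<pi> ` W}"
    then obtain w where "x \<in> topspace X" "w \<in> W" "\<pi> x = \<pi> w" by blast
    then show "x \<in> (\<Union>t\<in>torus m. {x \<in> topspace X. act t x \<in> W})"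
      using fibre[of x w] Wt by auto
  next
    fix x assume "x \<in> (\<Union>t\<in>torus m. {x \<in> topspace X. act t x \<in> W})"
    then obtain t where "t \<in> torus m" "x \<in> topspace X" "act t x \<in> W" by blast
    then show "x \<in> {x \<in> topspace X. \<pi> x \<in> \<pi> ` W}"
      using proj_act[of t x] by (metis (mono_tags, lifting) imageI mem_Collect_eq)
  qed
  have "openin X {x \<in> topspace X. \<pi> x \<in> \<pi> ` W}"
    unfolding eq using openin_continuous_map_preimage[OF act_continuous W] by blast
  moreover have "\<pi> ` W \<subseteq> topspace Q" using Wt proj_in by blast
  ultimately show "openin Q (\<pi> ` W)"
    using perfect_imp_quotient_map[OF perfect_proj] by (simp add: quotient_map_def)
qed

text \<open>For an open map the preimage of a closure lies in the closure of the preimage. Density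
  and the frontier condition are lifted to \<open>X\<close> by this.\<close>

lemma preimage_closure:
  assumes "C \<subseteq> topspace Q" "x \<in> topspace X" "\<pi> x \<in> Q closure_of C"
  shows "x \<in> X closure_of {x \<in> topspace X. \<pi> x \<in> C}"
  unfolding in_closure_of
proof (intro conjI allI impI assms)
  fix W assume W: "x \<in> W \<and> openin X W"
  then have "openin Q (\<pi> ` W)" using open_map_proj by (simp add: open_map_def)
  moreover have "\<pi> x \<in> \<pi> ` W" using W by blast
  ultimately obtain c where c: "c \<in> C" "c \<in> \<pi> ` W"
    using assms(3) unfolding in_closure_of by blast
  then obtain w where "w \<in> W" "c = \<pi> w" by blast
  then show "\<exists>y. y \<in> {x \<in> topspace X. \<pi> x \<in> C} \<and> y \<in> W"
    using c W openin_subset by blast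
qed

text \<open>\<open>\<pi>\<close> is open and its fibres are orbits of a connected group, so
  connectedness lifts.\<close>

lemma connected_preimage:
  assumes "connectedin Q C"
  shows "connectedin X {x \<in> topspace X. \<pi> x \<in> C}"
proof -
  have "connectedin X {x \<in> topspace X. \<pi> x = q}" for q
  proof (cases "\<exists>x\<in>topspace X. \<pi> x = q")
    case True
    then obtain x where x: "x \<in> topspace X" "\<pi> x = q" by blast
    have "{x \<in> topspace X. \<pi> x = q} = (\<lambda>t. act t x) ` torus m"
    proof (intro Set.set_eqI iffI)
      fix y assume "y \<in> {x \<in> topspace X. \<pi> x = q}"
      then show "y \<in> (\<lambda>t. act t x) ` torus m" using fibre[of x y] x by auto
    next
      fix y assume "y \<in> (\<lambda>t. act t x) ` torus m"
      then show "y \<in> {x \<in> topspace X. \<pi> x = q}" using x act_in proj_act by auto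
    qed
    moreover have "continuous_map (torus_space m) X (\<lambda>t. act t x)"
      using continuous_map_compose[OF _ act_cont, of "torus_space m" "\<lambda>t. (t, x)"] x(1)
      by (simp add: o_def continuous_map_paired)
    then have "connectedin X ((\<lambda>t. act t x) ` torus m)"
      using connectedin_continuous_map_image connectedin_topspace connected_torus_space
      by (metis topspace_euclidean_subtopology)
    ultimately show ?thesis by simp
  next
    case False
    then have "{x \<in> topspace X. \<pi> x = q} = {}" by blast
    then show ?thesis by (simp only: connectedin_empty)
  qed
  then have "monotone_map X Q \<pi>"
    using proj_in by (auto simp: monotone_map)
  then show ?thesis
    using monotone_open_map[OF proj open_map_proj proj_onto] assms by blast
qed

text \<open>The orbit is the quotient of T^m by the isotropy group. Splitting T^m along that group
  leaves two complementary factors of dimensions \<open>i\<close> and \<open>m - n\<close>, and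
  \<open>g\<close> maps them bijectively, hence by compactness homeomorphically, onto the
  orbit.\<close>

lemma orbit_dim_eq:
  assumes x: "x \<in> topspace X" and i: "i \<le> n" "\<pi> x \<in> layer l F i"
  shows "orbit_dim m X act x = i + (m - n)"
proof -
  have "m = i + (m - n) + (n - i)" using i nm by simp
  from split_torus_exists[OF mu_dim[OF i] this]
  obtain \<alpha> f where "split_torus m (n - i) i (m - n) (\<mu> (\<pi> x)) \<alpha> f" .
  then interpret S: split_torus m "n - i" i "m - n" "\<mu> (\<pi> x)" \<alpha> f .
  define g where "g = (\<lambda>(s, u). act (f (s, u, (\<lambda>_. 1))) x)"
  let ?T = "prod_topology (torus_space i) (torus_space (m - n))"
  have "continuous_map ?T (prod_topology (torus_space i) (prod_topology (torus_space (m - n)) (torus_space (n - i))))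
      (\<lambda>p. (fst p, snd p, (\<lambda>_. 1)))"
    by (auto simp only: continuous_map_paired continuous_map_fst continuous_map_snd continuous_map_const) simp
  moreover have "continuous_map (prod_topology (torus_space i) (prod_topology (torus_space (m - n)) (torus_space (n - i))))
      (torus_space m) f"
    using S.maps by (simp only: homeomorphic_maps_def)
  ultimately have "continuous_map ?T (torus_space m) (f \<circ> (\<lambda>p. (fst p, snd p, (\<lambda>_. 1))))"
    by (rule continuous_map_compose)
  then have "continuous_map ?T (prod_topology (torus_space m) X) (\<lambda>p. (f (fst p, snd p, (\<lambda>_. 1)), x))"
    using x by (auto simp only: continuous_map_paired o_def continuous_map_const)
  from continuous_map_compose[OF this act_cont] have gc: "continuous_map ?T X g"
    by (simp only: g_def case_prod_unfold o_def fst_conv snd_conv)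
  have Tt: "topspace ?T = torus i \<times> torus (m - n)" by simp
  have fm: "f (s, u, (\<lambda>_. 1)) \<in> torus m" if "s \<in> torus i" "u \<in> torus (m - n)" for s u
    using that by (intro S.f_in) simp
  have img: "g ` (torus i \<times> torus (m - n)) = torus_orbit m act x"
  proof (intro subset_antisym subsetI)
    fix y assume "y \<in> g ` (torus i \<times> torus (m - n))"
    then show "y \<in> torus_orbit m act x" using fm by (auto simp: g_def torus_orbit_def)
  next
    fix y assume "y \<in> torus_orbit m act x"
    then obtain t where t: "t \<in> torus m" "y = act t x" by (auto simp: torus_orbit_def)
    obtain s u r where a: "\<alpha> t = (s, u, r)" by (cases "\<alpha> t")
    then have sur: "s \<in> torus i" "u \<in> torus (m - n)" "r \<in> torus (n - i)" using S.\<alpha>_in[OF t(1)] by auto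
    have "\<alpha> (f (s, u, (\<lambda>_. 1))) = (s, u, (\<lambda>_. 1))" using sur by (intro S.\<alpha>_f) simp
    then have "cmult (cinv (f (s, u, (\<lambda>_. 1)))) t \<in> \<mu> (\<pi> x)"
      using S.\<alpha>_cinv_cmult[OF fm[OF sur(1,2)] t(1)] a by simp
    then have "act (f (s, u, (\<lambda>_. 1))) x = act t x"
      using act_eq_iff[OF fm[OF sur(1,2)] t(1) x] by simp
    then show "y \<in> g ` (torus i \<times> torus (m - n))"
      using t(2) sur by (auto simp: g_def intro!: image_eqI[of _ _ "(s, u)"])
  qed
  have inj: "inj_on g (torus i \<times> torus (m - n))"
  proof (rule inj_onI, clarify)
    fix s u s' u' assume *: "s \<in> torus i" "u \<in> torus (m - n)" "s' \<in> torus i" "u' \<in> torus (m - n)" "g (s, u) = g (s', u')"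
    have "\<alpha> (f (s, u, (\<lambda>_. 1))) = (s, u, (\<lambda>_. 1))" "\<alpha> (f (s', u', (\<lambda>_. 1))) = (s', u', (\<lambda>_. 1))"
      using * by (auto intro!: S.\<alpha>_f)
    then show "s = s' \<and> u = u'"
      using S.\<alpha>_cinv_cmult[OF fm[OF *(1,2)] fm[OF *(3,4)]] act_eq_iff[OF fm[OF *(1,2)] fm[OF *(3,4)] x] *(5)
      by (simp add: g_def)
  qed
  have orb: "torus_orbit m act x \<subseteq> topspace X" using act_in x by (auto simp: torus_orbit_def)
  have "homeomorphic_map ?T (subtopology X (torus_orbit m act x)) g"
  proof (rule continuous_imp_homeomorphic_map)
    show "continuous_map ?T (subtopology X (torus_orbit m act x)) g"
      using gc img Tt by (auto simp only: continuous_map_in_subtopology)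
    show "compact_space ?T" by (simp only: compact_space_prod_topology compact_torus_space simp_thms)
    show "Hausdorff_space (subtopology X (torus_orbit m act x))" by (rule Hausdorff_space_subtopology[OF Hausdorff_X])
    show "g ` topspace ?T = topspace (subtopology X (torus_orbit m act x))"
      using img orb Tt by auto
    show "inj_on g (topspace ?T)" using inj Tt by simp
  qed
  then have mf: "topological_manifold (i + (m - n)) (subtopology X (torus_orbit m act x))"
    using homeomorphic_topological_manifold[OF _ topological_manifold_prod[OF topological_manifold_torus topological_manifold_torus]]
      homeomorphic_map_imp_homeomorphic_space by blast
  have ne: "topspace (subtopology X (torus_orbit m act x)) \<noteq> {}"
  proof -
    have "act (\<lambda>_. 1) x \<in> torus_orbit m act x" unfolding torus_orbit_def by (rule imageI) simp
    then show ?thesis using orb by auto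
  qed
  show ?thesis
    unfolding orbit_dim_def
  proof (rule the_equality)
    show "topological_manifold (i + (m - n)) (subtopology X (torus_orbit m act x))" by (rule mf)
  qed (rule topological_manifold_dimension_unique[OF _ mf ne])
qed

text \<open>An orbit has dimension at most \<open>i + (m - n)\<close> exactly over the points of
  filtration level \<open>l + i\<close>. The halving makes two consecutive members upstairs agree,
  and the index bound is there because members of \<open>F\<close> above \<open>l + n\<close> are
  unconstrained.\<close>

lemma orbit_filtration_eq:
  assumes "(k - int l - (int m - int n)) div 2 \<le> int n"
  shows "orbit_filtration l n m X act k =
    {x \<in> topspace X. \<pi> x \<in> F (int l + (k - int l - (int m - int n)) div 2)}"
proof -
  have "int (orbit_dim m X act x) \<le> (k - int l - (int m - int n)) div 2 + (int m - int n) \<longleftrightarrow>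
      \<pi> x \<in> F (int l + (k - int l - (int m - int n)) div 2)" if x: "x \<in> topspace X" for x
  proof -
    obtain i where i: "i \<le> n" "\<pi> x \<in> layer l F i" using proj_layer[OF x] .
    show ?thesis
      unfolding orbit_dim_eq[OF x i] layer_mem_iff[OF filt i assms] using nm by (auto simp: of_nat_diff)
  qed
  then show ?thesis unfolding orbit_filtration_def by (intro Collect_cong conj_cong) simp_all
qed

lemma orbit_filtration_top:
  assumes "int n \<le> (k - int l - (int m - int n)) div 2"
  shows "orbit_filtration l n m X act k = topspace X"
proof -
  have "int (orbit_dim m X act x) \<le> (k - int l - (int m - int n)) div 2 + (int m - int n)" if x: "x \<in> topspace X" for x
  proof -
    obtain i where i: "i \<le> n" "\<pi> x \<in> layer l F i" using proj_layer[OF x] .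
    show ?thesis unfolding orbit_dim_eq[OF x i] using nm assms i(1) by (auto simp: of_nat_diff)
  qed
  then have "x \<in> orbit_filtration l n m X act k" if "x \<in> topspace X" for x
    unfolding orbit_filtration_def mem_Collect_eq using that by simp
  then show ?thesis
    by (intro subset_antisym subsetI) (simp_all add: orbit_filtration_def)
qed

lemma orbit_filtration_closed: "closedin X (orbit_filtration l n m X act k)"
proof (cases "(k - int l - (int m - int n)) div 2 \<le> int n")
  case True
  then show ?thesis
    unfolding orbit_filtration_eq[OF True]
    by (intro closedin_continuous_map_preimage[OF proj] filtration_closedin[OF filt]) simp
next
  case False
  then show ?thesis by (simp add: orbit_filtration_top)
qed

lemma orbit_stratum_eq:
  assumes "i \<le> n"
  shows "orbit_stratum l n m X act i = {x \<in> topspace X. \<pi> x \<in> layer l F i}"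
proof -
  have "(int l + 2 * int i + (int m - int n) - int l - (int m - int n)) div 2 = int i"
    "(int l + 2 * (int i - 1) + (int m - int n) - int l - (int m - int n)) div 2 = int i - 1" by auto
  then show ?thesis
    unfolding orbit_stratum_def layer_def using assms by (subst (1 2) orbit_filtration_eq) (auto simp: add_diff_eq)
qed

text \<open>Maximality is used on both sides: the preimage of a component is connected, and so is
  the image of a component. The strata of \<open>X\<close> are therefore governed by those of
  \<open>Q\<close>.\<close>

lemma orbit_stratum_component:
  assumes i: "i \<le> n" and S: "S \<in> connected_components_of (subtopology X (orbit_stratum l n m X act i))"
  obtains C where "C \<in> strata l n Q F" "S = {x \<in> topspace X. \<pi> x \<in> C}"
proof -
  have Ssub: "S \<subseteq> orbit_stratum l n m X act i" by (rule component_subset[OF S])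
  have "S \<noteq> {}" using S nonempty_connected_components_of by blast
  then obtain x where x: "x \<in> S" by blast
  then have xl: "x \<in> topspace X" "\<pi> x \<in> layer l F i" using Ssub orbit_stratum_eq[OF i] by auto
  obtain C where C: "C \<in> connected_components_of (subtopology Q (layer l F i))" "\<pi> x \<in> C"
    by (rule layer_component[OF filt i xl(2)])
  have "{x \<in> topspace X. \<pi> x \<in> C} \<subseteq> S"
  proof (rule component_maximal[OF S])
    show "connectedin X {x \<in> topspace X. \<pi> x \<in> C}"
      by (rule connected_preimage[OF component_connectedin[OF C(1)]])
    show "{x \<in> topspace X. \<pi> x \<in> C} \<subseteq> orbit_stratum l n m X act i"
      using component_subset[OF C(1)] orbit_stratum_eq[OF i] by blast
    show "{x \<in> topspace X. \<pi> x \<in> C} \<inter> S \<noteq> {}" using x xl C by blast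
  qed
  moreover have "\<pi> ` S \<subseteq> C"
  proof (rule component_maximal[OF C(1)])
    show "connectedin Q (\<pi> ` S)"
      by (rule connectedin_continuous_map_image[OF proj component_connectedin[OF S]])
    show "\<pi> ` S \<subseteq> layer l F i" using Ssub orbit_stratum_eq[OF i] by blast
    show "\<pi> ` S \<inter> C \<noteq> {}" using x C by blast
  qed
  ultimately have "S = {x \<in> topspace X. \<pi> x \<in> C}"
    using Ssub orbit_stratum_eq[OF i] by blast
  moreover have "C \<in> strata l n Q F" using C(1) i strata_iff by blast
  ultimately show thesis using that by blast
qed

text \<open>Continuity of \<open>\<pi>\<close> sends a meeting of closures down to \<open>Q\<close>,
  the frontier condition there applies, and openness of \<open>\<pi>\<close> brings the inclusion
  back up.\<close>

lemma orbit_strata_frontier: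
  assumes S: "S \<in> orbit_strata l n m X act" and S': "S' \<in> orbit_strata l n m X act"
    and ne: "S \<inter> X closure_of S' \<noteq> {}"
  shows "S \<subseteq> X closure_of S'"
proof -
  obtain i j where ij: "i \<le> n" "S \<in> connected_components_of (subtopology X (orbit_stratum l n m X act i))"
      "j \<le> n" "S' \<in> connected_components_of (subtopology X (orbit_stratum l n m X act j))"
    using S S' unfolding orbit_strata_def by blast
  obtain C where C: "C \<in> strata l n Q F" "S = {x \<in> topspace X. \<pi> x \<in> C}"
    using orbit_stratum_component[OF ij(1,2)] .
  obtain C' where C': "C' \<in> strata l n Q F" "S' = {x \<in> topspace X. \<pi> x \<in> C'}"
    using orbit_stratum_component[OF ij(3,4)] .
  obtain x where x: "x \<in> S" "x \<in> X closure_of S'" using ne by blast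
  have "\<pi> x \<in> Q closure_of (\<pi> ` S')"
    using continuous_map_image_closure_subset[OF proj] x(2) by blast
  moreover have "Q closure_of (\<pi> ` S') \<subseteq> Q closure_of C'"
    using C'(2) by (intro closure_of_mono) auto
  ultimately have "C \<inter> Q closure_of C' \<noteq> {}" using x(1) C(2) by blast
  then have sub: "C \<subseteq> Q closure_of C'" by (rule strata_frontier[OF strat C(1) C'(1)])
  have "C' \<subseteq> topspace Q"
  proof -
    obtain j where "j \<le> n" "C' \<in> connected_components_of (subtopology Q (layer l F j))"
      using C'(1) strata_iff by blast
    then show ?thesis using component_subset layer_subset[OF filt] by blast
  qed
  then show ?thesis
    unfolding C(2) C'(2) using sub preimage_closure by blast
qed

end

section \<open>Charts of orbit models\<close>

lemma continuous_map_fstI: "continuous_map Z (prod_topology X Y) f \<Longrightarrow> continuous_map Z X (\<lambda>z. fst (f z))"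
  using continuous_map_compose[OF _ continuous_map_fst] by (simp add: o_def)

lemma continuous_map_sndI: "continuous_map Z (prod_topology X Y) f \<Longrightarrow> continuous_map Z Y (\<lambda>z. snd (f z))"
  using continuous_map_compose[OF _ continuous_map_snd] by (simp add: o_def)

lemma continuous_map_pairI:
  "continuous_map Z X f \<Longrightarrow> continuous_map Z Y g \<Longrightarrow> continuous_map Z (prod_topology X Y) (\<lambda>z. (f z, g z))"
  by (simp add: continuous_map_paired)

text \<open>Regrouping for \<open>g2\<close>. The inputs are the two halves of the box, the link,
  the interval and the three torus factors; the output puts the second half of the box next to the
  first torus factor and the link next to the third.\<close>

lemma homeomorphic_map_permute7:
  "homeomorphic_map
     (prod_topology (prod_topology (prod_topology X1 X2) (prod_topology X3 X4)) (prod_topology X5 (prod_topology X6 X7)))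
     (prod_topology X1 (prod_topology (prod_topology (prod_topology X2 X5) X6) (prod_topology (prod_topology X3 X7) X4)))
     (\<lambda>(((x1, x2), (x3, x4)), (x5, x6, x7)). (x1, (((x2, x5), x6), ((x3, x7), x4))))"
proof -
  have "homeomorphic_maps
     (prod_topology (prod_topology (prod_topology X1 X2) (prod_topology X3 X4)) (prod_topology X5 (prod_topology X6 X7)))
     (prod_topology X1 (prod_topology (prod_topology (prod_topology X2 X5) X6) (prod_topology (prod_topology X3 X7) X4)))
     (\<lambda>(((x1, x2), (x3, x4)), (x5, x6, x7)). (x1, (((x2, x5), x6), ((x3, x7), x4))))
     (\<lambda>(x1, (((x2, x5), x6), ((x3, x7), x4))). (((x1, x2), (x3, x4)), (x5, x6, x7)))"
    unfolding homeomorphic_maps_def case_prod_unfold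
    by (intro conjI continuous_map_pairI; (intro continuous_map_fstI continuous_map_sndI)?)
       (auto intro!: continuous_map_fstI continuous_map_sndI continuous_map_id[unfolded id_def])
  then show ?thesis using homeomorphic_maps_map by blast
qed

lemma proper_map_fst_compact:
  assumes "compact_space Y"
  shows "proper_map (prod_topology X Y) X fst"
  unfolding proper_map_def
proof (intro conjI ballI Abstract_Topological_Spaces.closed_map_fst assms)
  fix x assume "x \<in> topspace X"
  then have "{z \<in> topspace (prod_topology X Y). fst z = x} = {x} \<times> topspace Y" by auto
  then show "compactin (prod_topology X Y) {z \<in> topspace (prod_topology X Y). fst z = x}"
    using assms \<open>x \<in> topspace X\<close> by (simp add: compactin_Times compact_space_def)
qed

lemma proper_map_cong:
  assumes "proper_map X Y f" "\<And>x. x \<in> topspace X \<Longrightarrow> f x = g x"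
  shows "proper_map X Y g"
  unfolding proper_map_def closed_map_def
proof (intro conjI allI impI ballI)
  fix C assume C: "closedin X C"
  then have "f ` C = g ` C" using assms(2) closedin_subset by (intro image_cong) blast+
  then show "closedin Y (g ` C)" using assms(1) C by (metis proper_map_def closed_map_def)
next
  fix y assume "y \<in> topspace Y"
  then have "compactin X {x \<in> topspace X. f x = y}" using assms(1) by (simp add: proper_map_def)
  moreover have "{x \<in> topspace X. f x = y} = {x \<in> topspace X. g x = y}" using assms(2) by auto
  ultimately show "compactin X {x \<in> topspace X. g x = y}" by (simp only:)
qed

text \<open>
  Over the domain \<open>U\<close> of a conical chart around \<open>p\<close> all isotropy groups lie in \<open>H = \<mu> p\<close>, and they
  are independent of the box coordinate and of the positive cone parameter.  Hence the maps \<open>g1\<close>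
  to the orbit model and \<open>g2\<close> to the local model, both from box \<open>\<times>\<close> link \<open>\<times>\<close> interval \<open>\<times>\<close> torus,
  are perfect with the same kernel and induce a homeomorphism.
\<close>

locale orbit_chart = orbit_model l n m Q F X act \<pi> \<mu> + chart l n Q F i U b \<epsilon> A J G e +
    split_torus m "n - i" i "m - n" H \<alpha> f
  for l n m :: nat and Q :: "'q topology" and F :: "int \<Rightarrow> 'q set"
    and X :: "'a topology" and act :: "cvec \<Rightarrow> 'a \<Rightarrow> 'a" and \<pi> :: "'a \<Rightarrow> 'q" and \<mu> :: "'q \<Rightarrow> cvec set"
    and i U b \<epsilon> A J G e H \<alpha> f +
  fixes s :: "'q \<Rightarrow> 'a" and p :: 'q
  assumes s_cont: "continuous_map (subtopology Q U) X s" and s_sec: "\<And>u. u \<in> U \<Longrightarrow> \<pi> (s u) = u"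
    and core: "\<And>y. y \<in> topspace A \<Longrightarrow> e (b, (y, 0)) = p"
    and H_eq: "H = \<mu> p" and usc: "\<And>q. q \<in> U \<Longrightarrow> \<mu> q \<subseteq> H"
begin

definition "W = {x \<in> topspace X. \<pi> x \<in> U}"
text \<open>
  The link of the orbit model is realised inside it, over the slice of the chart at cone parameter
  \<open>1/2\<close>.  If \<open>i = n\<close> then \<open>1/2 \<notin> J\<close> and the values of \<open>j\<close> and \<open>c\<close> are junk; there the cone
  parameter is always 0.
\<close>

definition "j y = e (b, (y, 1/2))"
definition "c = (\<lambda>(y, r). act (\<iota> r) (s (j y)))"
text \<open>For \<open>i = n\<close> the link is the empty space, so that its open cone is a
  point.\<close>

definition "LX = subtopology X (if i < n then c ` (topspace A \<times> torus (n - i)) else {})"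
definition "actL r = act (\<iota> r)"
definition "g1 = (\<lambda>(z, t). act t (s (e z)))"
definition "\<kappa> = (\<lambda>(yr, r). cone_proj (c yr, r))"
abbreviation "BL \<equiv> box_at l (fst (Euclidean_split l i b)) \<epsilon>"
abbreviation "BI \<equiv> box_at i (snd (Euclidean_split l i b)) \<epsilon>"
abbreviation "\<Omega> \<equiv> annuli i (snd (Euclidean_split l i b)) \<epsilon>"
text \<open>The first \<open>l\<close> box coordinates survive as they are, the last
  \<open>i\<close> become logarithmic radii whose angles are the first torus component, the second
  torus component is kept, and the third, belonging to \<open>H\<close>, moves the point of the
  link.\<close>

definition "g2 = (\<lambda>((x, (y, r)), t). (fst (Euclidean_split l i x),
   ((polar i (snd (Euclidean_split l i x), fst (\<alpha> t)), fst (snd (\<alpha> t))), \<kappa> ((y, snd (snd (\<alpha> t))), r))))"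
abbreviation "M \<equiv> prod_topology (subtopology (Euclidean_space l) BL)
   (prod_topology (prod_topology (top_of_set \<Omega>) (torus_space (m - n))) (open_cone LX))"

section \<open>The two perfect maps and their common kernel\<close>

lemma U_top: "topspace (subtopology Q U) = U"
  using U_subset by auto

lemma s_in: "u \<in> U \<Longrightarrow> s u \<in> topspace X"
  using continuous_map_image_subset_topspace[OF s_cont] U_top by blast

lemma openW: "openin X W"
  unfolding W_def by (rule openin_continuous_map_preimage[OF proj open_U])

lemma W_subset: "W \<subseteq> topspace X"
  by (auto simp: W_def)

lemma topspace_W: "topspace (subtopology X W) = W"
  using W_subset by auto

lemma topspace_DT: "topspace (prod_topology D (torus_space m)) = (BX \<times> topspace A \<times> J) \<times> torus m"
  using topspace_D by simp

lemma g1_apply: "g1 (z, t) = act t (s (e z))"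
  by (simp add: g1_def)

lemma g1_in: "z \<in> BX \<times> topspace A \<times> J \<Longrightarrow> t \<in> torus m \<Longrightarrow> g1 (z, t) \<in> W"
  and proj_g1: "z \<in> BX \<times> topspace A \<times> J \<Longrightarrow> t \<in> torus m \<Longrightarrow> \<pi> (g1 (z, t)) = e z"
proof -
  assume z: "z \<in> BX \<times> topspace A \<times> J" and t: "t \<in> torus m"
  have ez: "e z \<in> U" using e_image z by blast
  show "\<pi> (g1 (z, t)) = e z" using proj_act[OF t s_in[OF ez]] s_sec[OF ez] by (simp add: g1_apply)
  then show "g1 (z, t) \<in> W" using act_in[OF t s_in[OF ez]] ez by (simp add: W_def g1_apply)
qed

text \<open>\<open>\<pi> \<circ> g1\<close> is the projection off the compact torus followed by the
  perfect map \<open>e\<close>, hence proper; as \<open>X\<close> is Hausdorff, properness is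
  inherited by \<open>g1\<close>. Surjectivity holds because the fibres of \<open>\<pi>\<close> are
  orbits and \<open>s\<close> meets each of them over \<open>U\<close>.\<close>

lemma perfect_g1: "perfect_map (prod_topology D (torus_space m)) (subtopology X W) g1"
  unfolding perfect_map_def
proof (intro conjI)
  have "continuous_map D (subtopology Q U) e" using perfect_imp_continuous_map[OF perfect] .
  then have "continuous_map D X (s \<circ> e)" by (rule continuous_map_compose[OF _ s_cont])
  then have "continuous_map (prod_topology D (torus_space m)) X ((s \<circ> e) \<circ> fst)"
    by (rule continuous_map_compose[OF continuous_map_fst])
  then have "continuous_map (prod_topology D (torus_space m)) (prod_topology (torus_space m) X) (\<lambda>w. (snd w, s (e (fst w))))"
    by (intro continuous_map_pairI continuous_map_snd) (simp only: o_def)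
  from continuous_map_compose[OF this act_cont] have cX: "continuous_map (prod_topology D (torus_space m)) X g1"
    by (simp only: g1_def case_prod_unfold o_def fst_conv snd_conv)
  then show cW: "continuous_map (prod_topology D (torus_space m)) (subtopology X W) g1"
    unfolding continuous_map_in_subtopology topspace_DT using g1_in by auto
  have "proper_map (prod_topology D (torus_space m)) (subtopology Q U) (e \<circ> fst)"
    using perfect_imp_proper_map[OF perfect] proper_map_fst_compact[OF compact_torus_space] by (rule proper_map_compose[rotated])
  then have "proper_map (prod_topology D (torus_space m)) (subtopology Q U) (\<pi> \<circ> g1)"
    by (rule proper_map_cong) (use proj_g1 topspace_DT in auto)
  moreover have "continuous_map (subtopology X W) (subtopology Q U) \<pi>"
    using proj by (auto simp: continuous_map_in_subtopology continuous_map_from_subtopology W_def)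
  ultimately show "proper_map (prod_topology D (torus_space m)) (subtopology X W) g1"
    using proper_map_from_composition_right[OF Hausdorff_space_subtopology[OF Hausdorff_X] _ cW] by blast
  show "g1 ` topspace (prod_topology D (torus_space m)) = topspace (subtopology X W)"
    unfolding topspace_DT topspace_W
  proof (intro subset_antisym subsetI)
    fix x assume x: "x \<in> W"
    then obtain z where z: "z \<in> BX \<times> topspace A \<times> J" "\<pi> x = e z" using e_image by (auto simp: W_def image_iff)
    then have "\<pi> (s (e z)) = \<pi> x" "s (e z) \<in> topspace X" using e_image s_sec s_in by auto
    then obtain t where "t \<in> torus m" "x = act t (s (e z))"
      using fibre[of "s (e z)" x] x by (auto simp: W_def)
    then show "x \<in> g1 ` ((BX \<times> topspace A \<times> J) \<times> torus m)"
      using z(1) by (intro image_eqI[of _ _ "(z, t)"]) (auto simp: g1_apply)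
  qed (use g1_in in auto)
qed

text \<open>Box points at parameter 0 form a connected subset of one layer, so their isotropy group
  is the one at the centre.\<close>

lemma mu_core:
  assumes "x \<in> BX" "y \<in> topspace A"
  shows "\<mu> (e (x, (y, 0))) = H"
proof -
  have "connectedin Q (e ` (BX \<times> {y} \<times> {0}))"
    by (rule connected_slice) (use assms J0 in auto)
  moreover have "e ` (BX \<times> {y} \<times> {0}) \<subseteq> layer l F i" using e_layer assms J0 by auto
  ultimately have "\<mu> (e (x, (y, 0))) = \<mu> (e (b, (y, 0)))"
    by (rule mu_const[OF i]) (use assms b_in in auto)
  then show ?thesis using core assms H_eq by simp
qed

lemma half_in: "i < n \<Longrightarrow> 1/2 \<in> J"
  using link_cases by auto

lemma j_in: "i < n \<Longrightarrow> y \<in> topspace A \<Longrightarrow> j y \<in> U"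
  unfolding j_def using e_in[OF b_in] half_in by blast

lemma i_less: "r \<in> J \<Longrightarrow> r \<noteq> 0 \<Longrightarrow> i < n"
  using link_cases by auto

text \<open>Over a fixed link point, all positive parameters and all box coordinates form a
  connected subset of one layer. The slice at 1/2 therefore records every isotropy group off the
  core.\<close>

lemma mu_slice:
  assumes "x \<in> BX" "y \<in> topspace A" "r \<in> J" "r \<noteq> 0"
  shows "\<mu> (e (x, (y, r))) = \<mu> (j y)"
proof -
  have J: "i < n" "J = {0..<1}" using link_cases assms by auto
  then obtain l' n' where lk: "l' + n' = n - i - 1" "stratified_pseudomanifold l' n' A G"
    using link_cases by auto
  obtain k' where k': "k' \<le> n'" "y \<in> layer l' G k'"
    using filtration_layer[OF stratified_pseudomanifold_filtration[OF lk(2)] assms(2)] by blast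
  have "connectedin Q (e ` (BX \<times> {y} \<times> {0<..<1}))"
    by (rule connected_slice) (use assms J in auto)
  moreover have "e ` (BX \<times> {y} \<times> {0<..<1}) \<subseteq> layer l F (i + l' + k' + 1)"
    using e_layer_link[OF _ assms(2) _ _ lk(1) J(1) k'(1)] J(2) k'(2) by auto
  ultimately show ?thesis
    unfolding j_def using lk k' J assms b_in by (intro mu_const[of "i + l' + k' + 1"]) auto
qed

lemma g1_eq_iff:
  assumes "x \<in> BX" "y \<in> topspace A" "r \<in> J" "t \<in> torus m" "x' \<in> BX" "y' \<in> topspace A" "r' \<in> J" "t' \<in> torus m"
  shows "g1 ((x, (y, r)), t) = g1 ((x', (y', r')), t') \<longleftrightarrow>
    x = x' \<and> r = r' \<and> (r = 0 \<or> y = y') \<and> cmult (cinv t) t' \<in> \<mu> (e (x, (y, r)))"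
proof -
  have "g1 ((x, (y, r)), t) = g1 ((x', (y', r')), t') \<longleftrightarrow>
      e (x, (y, r)) = e (x', (y', r')) \<and> cmult (cinv t) t' \<in> \<mu> (e (x, (y, r)))"
  proof (cases "e (x, (y, r)) = e (x', (y', r'))")
    case True
    have q: "e (x, (y, r)) \<in> U" using e_in assms by blast
    have "act t (s (e (x, (y, r)))) = act t' (s (e (x, (y, r)))) \<longleftrightarrow> cmult (cinv t) t' \<in> \<mu> (e (x, (y, r)))"
      using act_eq_iff[OF assms(4,8) s_in[OF q]] s_sec[OF q] by (simp only:)
    then show ?thesis unfolding g1_apply True by blast
  next
    case False
    then show ?thesis using proj_g1 assms by (metis SigmaI)
  qed
  then show ?thesis using e_eq[OF assms(1-3,5-7)] by blast
qed

lemma c_in: "i < n \<Longrightarrow> y \<in> topspace A \<Longrightarrow> r \<in> torus (n - i) \<Longrightarrow> c (y, r) \<in> topspace X"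
  and proj_c: "i < n \<Longrightarrow> y \<in> topspace A \<Longrightarrow> r \<in> torus (n - i) \<Longrightarrow> \<pi> (c (y, r)) = j y"
  using act_in[OF \<iota>_in s_in[OF j_in]] proj_act[OF \<iota>_in s_in[OF j_in]] s_sec[OF j_in] by (auto simp: c_def)

lemma j_eq_iff: "i < n \<Longrightarrow> y \<in> topspace A \<Longrightarrow> y' \<in> topspace A \<Longrightarrow> j y = j y' \<longleftrightarrow> y = y'"
  unfolding j_def using e_eq[OF b_in _ half_in b_in _ half_in] by simp

lemma c_eq_iff:
  assumes "i < n" "y \<in> topspace A" "r \<in> torus (n - i)" "y' \<in> topspace A" "r' \<in> torus (n - i)"
  shows "c (y, r) = c (y', r') \<longleftrightarrow> y = y' \<and> cmult (cinv (\<iota> r)) (\<iota> r') \<in> \<mu> (j y)"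
proof -
  have *: "c (y, r) = c (y, r') \<longleftrightarrow> cmult (cinv (\<iota> r)) (\<iota> r') \<in> \<mu> (j y)"
    using act_eq_iff[OF \<iota>_in[OF assms(3)] \<iota>_in[OF assms(5)] s_in[OF j_in[OF assms(1,2)]]] s_sec[OF j_in[OF assms(1,2)]]
    by (simp add: c_def)
  show ?thesis
    using * proj_c assms j_eq_iff by metis
qed

lemma topspace_LX: "i < n \<Longrightarrow> topspace LX = c ` (topspace A \<times> torus (n - i))"
  unfolding LX_def using c_in by auto

lemma j_continuous: "i < n \<Longrightarrow> continuous_map A (subtopology Q U) j"
proof -
  assume "i < n"
  have "continuous_map A D (\<lambda>y. (b, (y, 1/2)))"
    using b_in half_in[OF \<open>i < n\<close>] topspace_box_at bE
    by (intro continuous_map_pairI) (auto simp: continuous_map_id[unfolded id_def])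
  from continuous_map_compose[OF this perfect_imp_continuous_map[OF perfect]]
  show "continuous_map A (subtopology Q U) j" by (simp add: j_def[abs_def] o_def)
qed

lemma c_continuous: "i < n \<Longrightarrow> continuous_map (prod_topology A (torus_space (n - i))) X c"
proof -
  assume "i < n"
  have "continuous_map A X (s \<circ> j)"
    by (rule continuous_map_compose[OF j_continuous[OF \<open>i < n\<close>] s_cont])
  then have 1: "continuous_map (prod_topology A (torus_space (n - i))) X ((s \<circ> j) \<circ> fst)"
    by (rule continuous_map_compose[OF continuous_map_fst])
  have 2: "continuous_map (prod_topology A (torus_space (n - i))) (torus_space m) (\<iota> \<circ> snd)"
    by (rule continuous_map_compose[OF continuous_map_snd \<iota>_continuous])
  from continuous_map_compose[OF continuous_map_pairI[OF 2 1] act_cont]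
  show "continuous_map (prod_topology A (torus_space (n - i))) X c"
    by (simp only: c_def case_prod_unfold o_def fst_conv snd_conv)
qed

lemma perfect_c: "i < n \<Longrightarrow> perfect_map (prod_topology A (torus_space (n - i))) LX c"
proof (rule perfect_map_compact_Hausdorff)
  assume "i < n"
  show "continuous_map (prod_topology A (torus_space (n - i))) LX c"
    using c_continuous[OF \<open>i < n\<close>] \<open>i < n\<close> by (auto simp: LX_def continuous_map_in_subtopology)
  show "compact_space (prod_topology A (torus_space (n - i)))"
    using A(1) by (simp add: compact_space_prod_topology)
  show "Hausdorff_space LX"
    unfolding LX_def by (rule Hausdorff_space_subtopology[OF Hausdorff_X])
  show "c ` topspace (prod_topology A (torus_space (n - i))) = topspace LX"
    using topspace_LX[OF \<open>i < n\<close>] by simp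
qed

lemma compact_LX: "compact_space LX"
proof (cases "i < n")
  case True
  have "compact_space (prod_topology A (torus_space (n - i)))"
    using A(1) by (simp add: compact_space_prod_topology)
  then have "compactin LX (c ` topspace (prod_topology A (torus_space (n - i))))"
    unfolding compact_space_def by (rule image_compactin[OF _ perfect_imp_continuous_map[OF perfect_c[OF True]]])
  then show ?thesis
    using perfect_imp_surjective_map[OF perfect_c[OF True]] by (simp add: compact_space_def)
qed (simp add: LX_def)

text \<open>For \<open>i < n\<close> this is \<open>c\<close> times the interval followed by the
  collapse of the base; for \<open>i = n\<close> it is the constant map of a compact space onto the
  apex.\<close>

lemma perfect_\<kappa>: "perfect_map (prod_topology (prod_topology A (torus_space (n - i))) (top_of_set J)) (open_cone LX) \<kappa>"
proof (cases "i < n")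
  case True
  have J: "J = {0..<1}" using link_cases True by auto
  have ne: "topspace LX \<noteq> {}"
    unfolding topspace_LX[OF True] using A(2) one_in_torus[of "n - i"] by blast
  have "perfect_map (prod_topology (prod_topology A (torus_space (n - i))) (top_of_set J)) (half_open_cylinder LX) (\<lambda>(yr, r). (c yr, id r))"
    unfolding half_open_cylinder_def J by (rule perfect_map_prod[OF perfect_c[OF True] perfect_map_id])
  from perfect_map_compose[OF this perfect_map_cone_proj[OF compact_LX ne]]
  show ?thesis by (simp add: \<kappa>_def o_def case_prod_unfold)
next
  case False
  then have J: "J = {0}" using link_cases by auto
  have L: "topspace LX = {}" using False by (simp add: LX_def)
  show ?thesis
  proof (rule perfect_map_compact_Hausdorff)
    have "continuous_map (prod_topology (prod_topology A (torus_space (n - i))) (top_of_set J)) (open_cone LX) (\<lambda>_. None)"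
      by (simp add: cone_set_def)
    then show "continuous_map (prod_topology (prod_topology A (torus_space (n - i))) (top_of_set J)) (open_cone LX) \<kappa>"
      by (rule continuous_map_eq) (auto simp: \<kappa>_def cone_proj_def J)
    show "compact_space (prod_topology (prod_topology A (torus_space (n - i))) (top_of_set J))"
      using A(1) J by (simp add: compact_space_prod_topology compact_space_subtopology)
    show "Hausdorff_space (open_cone LX)"
      unfolding Hausdorff_space_def by (auto simp: cone_set_def L)
    show "\<kappa> ` topspace (prod_topology (prod_topology A (torus_space (n - i))) (top_of_set J)) = topspace (open_cone LX)"
    proof -
      obtain y where "y \<in> topspace A" using A(2) by blast
      then have mem: "((y, (\<lambda>_. 1)), 0) \<in> (topspace A \<times> torus (n - i)) \<times> J"
        by (simp add: J)
      have None: "\<kappa> w = None" if "w \<in> (topspace A \<times> torus (n - i)) \<times> J" for w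
        using that by (auto simp: \<kappa>_def J)
      have "\<kappa> ` ((topspace A \<times> torus (n - i)) \<times> J) = {None}"
      proof (rule subset_antisym)
        show "\<kappa> ` ((topspace A \<times> torus (n - i)) \<times> J) \<subseteq> {None}"
        proof (rule image_subsetI)
          show "\<kappa> w \<in> {None}" if "w \<in> (topspace A \<times> torus (n - i)) \<times> J" for w
            unfolding singleton_iff by (rule None[OF that])
        qed
        show "{None} \<subseteq> \<kappa> ` ((topspace A \<times> torus (n - i)) \<times> J)"
          using imageI[OF mem, of \<kappa>] unfolding None[OF mem] by (simp only: insert_subset empty_subsetI simp_thms)
      qed
      then show ?thesis by (simp add: cone_set_def L)
    qed
  qed
qed

text \<open>Each ingredient is perfect: splitting the box, splitting the torus, regrouping, polar
  coordinates, and the map onto the cone. Products and composites of these give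
  \<open>g2\<close>.\<close>

lemma perfect_g2: "perfect_map (prod_topology D (torus_space m)) M g2"
proof -
  let ?SL = "subtopology (Euclidean_space l) BL" and ?SI = "subtopology (Euclidean_space i) BI"
  let ?Ti = "torus_space i" and ?Td = "torus_space (m - n)" and ?Tk = "torus_space (n - i)"
  have 1: "perfect_map D (prod_topology (prod_topology ?SL ?SI) (prod_topology A (top_of_set J)))
      (\<lambda>(x, q). (Euclidean_split l i x, id q))"
    by (rule perfect_map_prod[OF homeomorphic_imp_perfect_map[OF homeomorphic_map_split_box_at] perfect_map_id])
  have 2: "perfect_map (torus_space m) (prod_topology ?Ti (prod_topology ?Td ?Tk)) \<alpha>"
    by (rule homeomorphic_imp_perfect_map[OF iso[unfolded top_group_iso_def, THEN conjunct2]])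
  note 3 = perfect_map_prod[OF 1 2]
  note 4 = perfect_map_compose[OF 3 homeomorphic_imp_perfect_map[OF homeomorphic_map_permute7]]
  have 5: "perfect_map (prod_topology (prod_topology ?SI ?Ti) ?Td) (prod_topology (top_of_set \<Omega>) ?Td) (\<lambda>(z, u). (polar i z, id u))"
    by (rule perfect_map_prod[OF homeomorphic_imp_perfect_map[OF homeomorphic_map_polar] perfect_map_id])
  note 6 = perfect_map_compose[OF 4 perfect_map_prod[OF perfect_map_id perfect_map_prod[OF 5 perfect_\<kappa>]]]
  have eq: "(\<lambda>(x, y). (id x, case y of (x, y) \<Rightarrow> (case x of (z, u) \<Rightarrow> (polar i z, id u), \<kappa> y))) \<circ>
      ((\<lambda>(((x1, x2), (x3, x4)), (x5, x6, x7)). (x1, (((x2, x5), x6), ((x3, x7), x4)))) \<circ>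
       (\<lambda>(x, y). (case x of (x, q) \<Rightarrow> (Euclidean_split l i x, id q), \<alpha> y))) = g2"
    by (auto simp: fun_eq_iff g2_def case_prod_unfold)
  show ?thesis using 6 unfolding eq .
qed

text \<open>\<open>t\<close> and \<open>t'\<close> share the factor \<open>a\<close> built from
  their first two components, and it cancels in the quotient.\<close>

lemma split_agree:
  assumes t: "t \<in> torus m" "t' \<in> torus m" and eq: "fst (\<alpha> t) = fst (\<alpha> t')" "fst (snd (\<alpha> t)) = fst (snd (\<alpha> t'))"
  shows "cmult (cinv t) t' = cmult (cinv (\<iota> (snd (snd (\<alpha> t))))) (\<iota> (snd (snd (\<alpha> t'))))"
proof -
  define r r' where "r = snd (snd (\<alpha> t))" and "r' = snd (snd (\<alpha> t'))"
  define a where "a = f (fst (\<alpha> t), fst (snd (\<alpha> t)), (\<lambda>_. 1))"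
  have in3: "fst (\<alpha> t) \<in> torus i" "fst (snd (\<alpha> t)) \<in> torus (m - n)" "r \<in> torus (n - i)" "r' \<in> torus (n - i)"
    using \<alpha>_in[OF t(1)] \<alpha>_in[OF t(2)] by (auto simp: r_def r'_def)
  have am: "a \<in> torus m" unfolding a_def using in3 by (intro f_in) simp
  have "f (cmult (fst (\<alpha> t)) (\<lambda>_. 1), cmult (fst (snd (\<alpha> t))) (\<lambda>_. 1), cmult (\<lambda>_. 1) x) = cmult a (\<iota> x)"
    if "x \<in> torus (n - i)" for x
    unfolding a_def \<iota>_def using in3 that by (intro f_cmult) auto
  then have *: "f (fst (\<alpha> t), fst (snd (\<alpha> t)), x) = cmult a (\<iota> x)" if "x \<in> torus (n - i)" for x
    using that by simp
  have "t = cmult a (\<iota> r)" using *[OF in3(3)] f_\<alpha>[OF t(1)] by (simp add: r_def)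
  moreover have "t' = cmult a (\<iota> r')" using *[OF in3(4)] f_\<alpha>[OF t(2)] eq by (simp add: r'_def)
  ultimately have "cmult (cinv t) t' = cmult (cinv (\<iota> r)) (\<iota> r')"
    using torus_nz[OF am] by (auto simp: cmult_def cinv_def fun_eq_iff field_simps)
  then show ?thesis by (simp add: r_def r'_def)
qed

lemma \<kappa>_eq_iff:
  assumes "y \<in> topspace A" "t \<in> torus (n - i)" "r \<in> J" "y' \<in> topspace A" "t' \<in> torus (n - i)" "r' \<in> J"
  shows "\<kappa> ((y, t), r) = \<kappa> ((y', t'), r') \<longleftrightarrow>
    r = r' \<and> (r = 0 \<or> y = y' \<and> cmult (cinv (\<iota> t)) (\<iota> t') \<in> \<mu> (j y))"
proof -
  have "\<kappa> ((y, t), r) = \<kappa> ((y', t'), r') \<longleftrightarrow> r = r' \<and> (r = 0 \<or> c (y, t) = c (y', t'))"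
    by (auto simp: \<kappa>_def cone_proj_eq)
  then show ?thesis using c_eq_iff[OF i_less assms(1,2,4,5)] assms(3) by blast
qed

text \<open>On the core the isotropy group is all of \<open>H\<close>: \<open>g1\<close> forgets
  exactly the third torus component, and \<open>g2\<close> forgets it because the cone is collapsed
  there. Off the core the isotropy group is a subgroup of \<open>H\<close>: the first two components
  must agree, and what remains is the relation that \<open>c\<close> induces over the link.\<close>

lemma g_kernel:
  assumes "w \<in> topspace (prod_topology D (torus_space m))" "w' \<in> topspace (prod_topology D (torus_space m))"
  shows "g1 w = g1 w' \<longleftrightarrow> g2 w = g2 w'"
proof -
  obtain x y r t where w: "w = ((x, (y, r)), t)" by (metis prod.exhaust)
  obtain x' y' r' t' where w': "w' = ((x', (y', r')), t')" by (metis prod.exhaust)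
  have a: "x \<in> BX" "y \<in> topspace A" "r \<in> J" "t \<in> torus m" "x' \<in> BX" "y' \<in> topspace A" "r' \<in> J" "t' \<in> torus m"
    using assms unfolding topspace_DT w w' by auto
  define t1 t2 t3 where "t1 = fst (\<alpha> t)" and "t2 = fst (snd (\<alpha> t))" and "t3 = snd (snd (\<alpha> t))"
  define t1' t2' t3' where "t1' = fst (\<alpha> t')" and "t2' = fst (snd (\<alpha> t'))" and "t3' = snd (snd (\<alpha> t'))"
  have T: "t1 \<in> torus i" "t3 \<in> torus (n - i)" "t1' \<in> torus i" "t3' \<in> torus (n - i)"
    using \<alpha>_in[OF a(4)] \<alpha>_in[OF a(8)] by (auto simp: t1_def t3_def t1'_def t3'_def)
  let ?S = "Euclidean_split l i"
  have Sx: "?S x \<in> BL \<times> BI" "?S x' \<in> BL \<times> BI"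
    using Euclidean_split_box_at box_at_subset a(1,5) by blast+
  have Sinj: "?S x = ?S x' \<longleftrightarrow> x = x'"
    using homeomorphic_imp_injective_map[OF homeomorphic_map_split_box_at[of l i b \<epsilon>]] a(1,5)
    unfolding topspace_box_at by (meson inj_on_eq_iff)
  have Pinj: "polar i (snd (?S x), t1) = polar i (snd (?S x'), t1') \<longleftrightarrow> snd (?S x) = snd (?S x') \<and> t1 = t1'"
  proof -
    have "(snd (?S x), t1) \<in> topspace (prod_topology (subtopology (Euclidean_space i) BI) (torus_space i))"
      "(snd (?S x'), t1') \<in> topspace (prod_topology (subtopology (Euclidean_space i) BI) (torus_space i))"
      unfolding topspace_prod_topology topspace_box_at using Sx T by auto
    then show ?thesis
      using homeomorphic_imp_injective_map[OF homeomorphic_map_polar[of i "snd (?S b)" \<epsilon>]]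
      by (metis inj_on_eq_iff prod.inject)
  qed
  have "g2 w = g2 w' \<longleftrightarrow> x = x' \<and> t1 = t1' \<and> t2 = t2' \<and> \<kappa> ((y, t3), r) = \<kappa> ((y', t3'), r')"
    using Pinj Sinj unfolding w w' g2_def t1_def t2_def t3_def t1'_def t2'_def t3'_def
    by (auto simp: prod_eq_iff)
  also have "\<dots> \<longleftrightarrow> x = x' \<and> t1 = t1' \<and> t2 = t2' \<and>
      r = r' \<and> (r = 0 \<or> y = y' \<and> cmult (cinv (\<iota> t3)) (\<iota> t3') \<in> \<mu> (j y))"
    using \<kappa>_eq_iff[OF a(2) T(2) a(3) a(6) T(4) a(7)] by blast
  also have "\<dots> \<longleftrightarrow> x = x' \<and> r = r' \<and> (r = 0 \<or> y = y') \<and> cmult (cinv t) t' \<in> \<mu> (e (x, (y, r)))"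
  proof (cases "r = 0")
    case True
    then have "\<mu> (e (x, (y, r))) = H" using mu_core a by simp
    then show ?thesis
      using \<alpha>_cinv_cmult[OF a(4,8)] True by (auto simp: t1_def t2_def t1'_def t2'_def)
  next
    case False
    then have mj: "\<mu> (e (x, (y, r))) = \<mu> (j y)" using mu_slice a by simp
    have sub: "\<mu> (e (x, (y, r))) \<subseteq> H" by (rule usc[OF e_in[OF a(1-3)]])
    have "t1 = t1' \<and> t2 = t2'" if "cmult (cinv t) t' \<in> \<mu> (j y)"
      using \<alpha>_cinv_cmult[OF a(4,8)] that sub mj by (auto simp: t1_def t2_def t1'_def t2'_def)
    moreover have "cmult (cinv t) t' \<in> \<mu> (j y) \<longleftrightarrow> cmult (cinv (\<iota> t3)) (\<iota> t3') \<in> \<mu> (j y)"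
      if "t1 = t1' \<and> t2 = t2'"
      using split_agree[OF a(4,8)] that by (simp add: t1_def t2_def t1'_def t2'_def t3_def t3'_def)
    ultimately show ?thesis unfolding mj using False by blast
  qed
  also have "\<dots> \<longleftrightarrow> g1 w = g1 w'"
    unfolding w w' using g1_eq_iff[OF a] by blast
  finally show ?thesis by blast
qed

end

section \<open>The induced chart and the subsets it matches\<close>

context orbit_chart
begin

lemma chart_map_exists:
  obtains \<phi> where "homeomorphic_map (subtopology X W) M \<phi>"
    "\<And>z t. \<lbrakk>z \<in> BX \<times> topspace A \<times> J; t \<in> torus m\<rbrakk> \<Longrightarrow> \<phi> (g1 (z, t)) = g2 (z, t)"
proof (rule homeomorphic_map_perfect_maps[OF perfect_g1 perfect_g2])
  fix w w' assume "w \<in> topspace (prod_topology D (torus_space m))" "w' \<in> topspace (prod_topology D (torus_space m))"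
  then show "g1 w = g1 w' \<longleftrightarrow> g2 w = g2 w'" by (rule g_kernel)
next
  fix h assume h: "homeomorphic_map (subtopology X W) M h"
    "\<And>w. w \<in> topspace (prod_topology D (torus_space m)) \<Longrightarrow> h (g1 w) = g2 w"
  show thesis
  proof (rule that[OF h(1)])
    show "h (g1 (z, t)) = g2 (z, t)" if "z \<in> BX \<times> topspace A \<times> J" "t \<in> torus m" for z t
      by (rule h(2)) (use that in \<open>simp only: topspace_DT mem_Sigma_iff simp_thms\<close>)
  qed
qed

lemma W_cases:
  assumes "v \<in> W"
  obtains x y r t where "x \<in> BX" "y \<in> topspace A" "r \<in> J" "t \<in> torus m" "v = g1 ((x, (y, r)), t)"
proof -
  have "v \<in> g1 ` ((BX \<times> topspace A \<times> J) \<times> torus m)"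
    using perfect_imp_surjective_map[OF perfect_g1] assms unfolding topspace_DT topspace_W by (simp only:)
  then show thesis using that by (elim imageE SigmaE) auto
qed

lemma topspace_M: "topspace M = BL \<times> ((\<Omega> \<times> torus (m - n)) \<times> cone_set (topspace LX))"
  by (simp only: topspace_prod_topology topspace_box_at topspace_euclidean_subtopology topspace_open_cone)

lemma M_cases:
  assumes "v \<in> topspace M"
  obtains x y r t where "x \<in> BX" "y \<in> topspace A" "r \<in> J" "t \<in> torus m" "v = g2 ((x, (y, r)), t)"
proof -
  have "v \<in> g2 ` ((BX \<times> topspace A \<times> J) \<times> torus m)"
    using perfect_imp_surjective_map[OF perfect_g2] assms unfolding topspace_DT by (simp only:)
  then show thesis using that by (elim imageE SigmaE) auto
qed

lemma g2_in_M:
  assumes "x \<in> BX" "y \<in> topspace A" "r \<in> J" "t \<in> torus m"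
  shows "g2 ((x, (y, r)), t) \<in> topspace M"
proof -
  have "g2 ((x, (y, r)), t) \<in> g2 ` ((BX \<times> topspace A \<times> J) \<times> torus m)" using assms by (intro imageI) simp
  then show ?thesis
    using perfect_imp_surjective_map[OF perfect_g2] unfolding topspace_DT by (simp only:)
qed

lemma g2_cone: "g2 ((x, (y, r)), t) = (fst (Euclidean_split l i x),
   ((polar i (snd (Euclidean_split l i x), fst (\<alpha> t)), fst (snd (\<alpha> t))), cone_proj (c (y, snd (snd (\<alpha> t))), r)))"
  by (simp add: g2_def \<kappa>_def)

text \<open>\<open>g1\<close> and \<open>g2\<close> are onto, so a subset of \<open>W\<close> and a
  subset of the local model can be compared on their common cover. Only conditions on the cone
  coordinate occur.\<close>

lemma chart_image:
  assumes \<phi>: "\<And>z t. \<lbrakk>z \<in> BX \<times> topspace A \<times> J; t \<in> torus m\<rbrakk> \<Longrightarrow> \<phi> (g1 (z, t)) = g2 (z, t)"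
    and K: "K \<subseteq> cone_set (topspace LX)"
    and mem: "\<And>x y r t. \<lbrakk>x \<in> BX; y \<in> topspace A; r \<in> J; t \<in> torus m\<rbrakk> \<Longrightarrow>
      g1 ((x, (y, r)), t) \<in> Z \<longleftrightarrow> cone_proj (c (y, snd (snd (\<alpha> t))), r) \<in> K"
  shows "\<phi> ` (W \<inter> Z) = BL \<times> ((\<Omega> \<times> torus (m - n)) \<times> K)"
proof (intro subset_antisym subsetI)
  fix v assume "v \<in> \<phi> ` (W \<inter> Z)"
  then obtain u where u: "u \<in> W" "u \<in> Z" "v = \<phi> u" by blast
  obtain x y r t where *: "x \<in> BX" "y \<in> topspace A" "r \<in> J" "t \<in> torus m" "u = g1 ((x, (y, r)), t)"
    using W_cases[OF u(1)] .
  have v: "v = g2 ((x, (y, r)), t)" using \<phi>[of "(x, (y, r))" t] * u(3) by simp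
  have "cone_proj (c (y, snd (snd (\<alpha> t))), r) \<in> K" using mem[OF *(1-4)] u(2) *(5) by simp
  then show "v \<in> BL \<times> ((\<Omega> \<times> torus (m - n)) \<times> K)"
    using g2_in_M[OF *(1-4)] unfolding v g2_cone topspace_M by simp
next
  fix v assume v: "v \<in> BL \<times> ((\<Omega> \<times> torus (m - n)) \<times> K)"
  then have "v \<in> topspace M" using K unfolding topspace_M by blast
  then obtain x y r t where *: "x \<in> BX" "y \<in> topspace A" "r \<in> J" "t \<in> torus m" "v = g2 ((x, (y, r)), t)"
    using M_cases by blast
  then have "g1 ((x, (y, r)), t) \<in> Z" using mem[OF *(1-4)] v unfolding *(5) g2_cone by simp
  moreover have "g1 ((x, (y, r)), t) \<in> W" using g1_in[of "(x, (y, r))" t] * by simp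
  moreover have "v = \<phi> (g1 ((x, (y, r)), t))" using \<phi>[of "(x, (y, r))" t] * by simp
  ultimately show "v \<in> \<phi> ` (W \<inter> Z)" by blast
qed

text \<open>The filtration of \<open>X\<close> moves only at every second index, while that of
  \<open>Q\<close> moves at each one. Level \<open>jj\<close> of the cone on the link upstairs thus
  belongs to level \<open>(jj + 1) div 2 - 1\<close> of the link of \<open>Q\<close>.\<close>

lemma g1_in_orbit_filtration:
  assumes "x \<in> BX" "y \<in> topspace A" "r \<in> J" "t \<in> torus m" and jj: "-1 \<le> jj" "jj \<le> 2 * int n - 2 * int i - 1"
  shows "g1 ((x, (y, r)), t) \<in> orbit_filtration l n m X act (int l + 2 * int i + (int m - int n) + jj + 1)
    \<longleftrightarrow> r = 0 \<or> y \<in> G ((jj + 1) div 2 - 1)"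
proof -
  define \<delta> where "\<delta> = (jj + 1) div 2"
  have \<delta>: "0 \<le> \<delta>" "\<delta> \<le> int n - int i" using jj by (auto simp: \<delta>_def)
  have "int l + 2 * int i + (int m - int n) + jj + 1 - int l - (int m - int n) = 2 * int i + (jj + 1)" by simp
  then have k: "(int l + 2 * int i + (int m - int n) + jj + 1 - int l - (int m - int n)) div 2 = int i + \<delta>"
    by (simp add: \<delta>_def)
  have "g1 ((x, (y, r)), t) \<in> topspace X" "\<pi> (g1 ((x, (y, r)), t)) = e (x, (y, r))"
    using g1_in[of "(x, (y, r))" t] proj_g1[of "(x, (y, r))" t] assms(1-4) W_subset by auto
  then have "g1 ((x, (y, r)), t) \<in> orbit_filtration l n m X act (int l + 2 * int i + (int m - int n) + jj + 1)
      \<longleftrightarrow> e (x, (y, r)) \<in> F (int l + (int i + \<delta>))"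
    using orbit_filtration_eq[of "int l + 2 * int i + (int m - int n) + jj + 1"] \<delta> i unfolding k by simp
  also have "int l + (int i + \<delta>) = int l + int i + (\<delta> - 1) + 1" by simp
  also have "e (x, (y, r)) \<in> F (int l + int i + (\<delta> - 1) + 1) \<longleftrightarrow> r = 0 \<or> y \<in> G (\<delta> - 1)"
    using \<delta> assms by (intro e_F) auto
  finally show ?thesis by (simp add: \<delta>_def)
qed

lemma manifold_annuli: "topological_manifold (i + i) (top_of_set \<Omega>)"
proof -
  have "topological_manifold i (subtopology (Euclidean_space i) BI)"
    by (rule topological_manifold_openin[OF topological_manifold_Euclidean_space openin_box_at])
  from topological_manifold_prod[OF this topological_manifold_torus]
  show ?thesis
    using homeomorphic_topological_manifold[OF homeomorphic_map_imp_homeomorphic_space[OF homeomorphic_map_polar]] by blast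
qed

text \<open>Inside the chart the stratum consists of the apexes, so it is a box of dimension
  \<open>l\<close>, times \<open>\<Omega>\<close> with its \<open>i\<close> radii and
  \<open>i\<close> angles, times a torus of dimension \<open>m - n\<close>.\<close>

theorem stratum_manifold: "topological_manifold (l + 2 * i + (m - n)) (subtopology X (W \<inter> orbit_stratum l n m X act i))"
proof -
  let ?S = "orbit_stratum l n m X act i" and ?R = "BL \<times> ((\<Omega> \<times> torus (m - n)) \<times> {None})"
  let ?E = "subtopology (Euclidean_space l) BL" and ?OT = "prod_topology (top_of_set \<Omega>) (torus_space (m - n))"
  let ?N = "subtopology (open_cone LX) {None}"
  obtain \<phi> where \<phi>: "homeomorphic_map (subtopology X W) M \<phi>"
    "\<And>z t. \<lbrakk>z \<in> BX \<times> topspace A \<times> J; t \<in> torus m\<rbrakk> \<Longrightarrow> \<phi> (g1 (z, t)) = g2 (z, t)"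
    by (rule chart_map_exists) (rule that)
  have im: "\<phi> ` (W \<inter> ?S) = ?R"
  proof (rule chart_image[OF \<phi>(2)])
    show "g1 ((x, (y, r)), t) \<in> ?S \<longleftrightarrow> cone_proj (c (y, snd (snd (\<alpha> t))), r) \<in> {None}"
      if "x \<in> BX" "y \<in> topspace A" "r \<in> J" "t \<in> torus m" for x y r t
    proof -
      have "g1 ((x, (y, r)), t) \<in> topspace X" "\<pi> (g1 ((x, (y, r)), t)) = e (x, (y, r))"
        using g1_in[of "(x, (y, r))" t] proj_g1[of "(x, (y, r))" t] that W_subset by auto
      then show ?thesis using e_layer[OF that(1-3)] orbit_stratum_eq[OF i] by simp
    qed
  qed (simp_all add: cone_set_def)
  have "homeomorphic_map (subtopology (subtopology X W) (W \<inter> ?S)) (subtopology M ?R) \<phi>"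
  proof (rule homeomorphic_map_subtopologies[OF \<phi>(1)])
    have "?R \<subseteq> topspace M" unfolding topspace_M by (auto simp: cone_set_def)
    then show "\<phi> ` (topspace (subtopology X W) \<inter> (W \<inter> ?S)) = topspace M \<inter> ?R"
      using im unfolding topspace_W by (simp add: Int_absorb1)
  qed
  moreover have "subtopology (subtopology X W) (W \<inter> ?S) = subtopology X (W \<inter> ?S)"
    by (simp add: subtopology_subtopology Int_absorb1)
  moreover have "subtopology M ?R = prod_topology ?E (prod_topology ?OT ?N)"
  proof -
    have "subtopology ?E BL = ?E" "subtopology ?OT (\<Omega> \<times> torus (m - n)) = ?OT"
      by (simp_all add: subtopology_subtopology Int_absorb1)
    then show ?thesis by (simp only: subtopology_Times)
  qed
  ultimately have 1: "subtopology X (W \<inter> ?S) homeomorphic_space prod_topology ?E (prod_topology ?OT ?N)"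
    using homeomorphic_map_imp_homeomorphic_space by metis
  have "?OT homeomorphic_space prod_topology ?OT ?N"
    by (rule homeomorphic_space_prod_topology_sing1) (simp add: cone_set_def)
  then have 2: "prod_topology ?E ?OT homeomorphic_space prod_topology ?E (prod_topology ?OT ?N)"
    by (rule homeomorphic_space_prod_topology[OF homeomorphic_space_refl])
  have 3: "prod_topology ?E ?OT homeomorphic_space subtopology X (W \<inter> ?S)"
    by (rule homeomorphic_space_trans[OF 2]) (rule homeomorphic_space_sym[THEN iffD1, OF 1])
  have "topological_manifold l ?E"
    by (rule topological_manifold_openin[OF topological_manifold_Euclidean_space openin_box_at])
  from topological_manifold_prod[OF this topological_manifold_prod[OF manifold_annuli topological_manifold_torus]]
  have "topological_manifold (l + ((i + i) + (m - n))) (prod_topology ?E ?OT)" .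
  then have "topological_manifold (l + ((i + i) + (m - n))) (subtopology X (W \<inter> ?S))"
    by (rule homeomorphic_topological_manifold[OF 3])
  moreover have "l + ((i + i) + (m - n)) = l + 2 * i + (m - n)" by simp
  ultimately show ?thesis by (simp only:)
qed

lemma c_cmult:
  assumes "i < n" "y \<in> topspace A" "r \<in> torus (n - i)" "r' \<in> torus (n - i)"
  shows "c (y, cmult r r') = act (\<iota> r) (c (y, r'))"
  using act_mult[OF \<iota>_in \<iota>_in s_in[OF j_in]] assms by (simp add: c_def \<iota>_cmult)

text \<open>The filtration \<open>G'\<close> of the link is left as a parameter: for
  \<open>i = n\<close> it is empty, and otherwise it is the orbit filtration of the link, which can
  be computed only after the link is known to be an orbit model.\<close>

theorem torus_cone_chart_exists:
  assumes x0: "x0 \<in> topspace X" "\<pi> x0 = p" "p \<in> U" "p \<in> layer l F i"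
    and G'_sub: "\<And>jj. G' jj \<subseteq> topspace LX"
    and G'_iff: "\<And>jj y r. \<lbrakk>i < n; -1 \<le> jj; jj \<le> 2 * int n - 2 * int i - 1; y \<in> topspace A; r \<in> torus (n - i)\<rbrakk> \<Longrightarrow>
      c (y, r) \<in> G' jj \<longleftrightarrow> y \<in> G ((jj + 1) div 2 - 1)"
  shows "\<exists>\<phi>. torus_cone_chart l n m X act i x0 W BL \<Omega> LX actL G' \<alpha> \<phi>"
proof -
  obtain \<phi> where \<phi>: "homeomorphic_map (subtopology X W) M \<phi>"
    "\<And>z t. \<lbrakk>z \<in> BX \<times> topspace A \<times> J; t \<in> torus m\<rbrakk> \<Longrightarrow> \<phi> (g1 (z, t)) = g2 (z, t)"
    by (rule chart_map_exists) (rule that)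
  have "torus_cone_chart l n m X act i x0 W BL \<Omega> LX actL G' \<alpha> \<phi>"
    unfolding torus_cone_chart_def
  proof (intro conjI allI impI ballI)
    show "openin X W" by (rule openW)
    show "x0 \<in> W" using x0 by (simp add: W_def)
    show "act t y \<in> W" if "t \<in> torus m" "y \<in> W" for t y
      using that act_in proj_act by (simp add: W_def)
    show "openin (Euclidean_space l) BL" by (rule openin_box_at)
    show "contractible_space (subtopology (Euclidean_space l) BL)" by (rule contractible_box_at)
    show "openin (top_of_set (cstar i)) \<Omega>" by (rule openin_annuli)
    show "cmult t w \<in> \<Omega>" if "t \<in> torus i" "w \<in> \<Omega>" for t w using that by (rule cmult_annuli)
    show "top_group_iso (torus_group m) (torus_space m) (torus_group i \<times>\<times> torus_group (m - n) \<times>\<times> torus_group (n - i))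
       (prod_topology (torus_space i) (prod_topology (torus_space (m - n)) (torus_space (n - i)))) \<alpha>"
      by (rule iso)
    show "\<alpha> ` isotropy m act x0 = {\<lambda>_. 1} \<times> {\<lambda>_. 1} \<times> torus (n - i)"
      using image_H isotropy_eq[OF x0(1)] x0(2) H_eq by simp
    show "homeomorphic_map (subtopology X W) M \<phi>" by (rule \<phi>(1))
    show "weakly_equivariant m W act (\<lambda>t. local_model_action actL (\<alpha> t)) \<phi>"
      unfolding weakly_equivariant_def
    proof (intro exI conjI ballI)
      \<comment> \<open>All twisting of the torus is already contained in \<open>\<alpha>\<close>,
        so the automorphism in weak equivariance is the identity.\<close>
      show "top_group_iso (torus_group m) (torus_space m) (torus_group m) (torus_space m) (\<lambda>t. t)"
        by (simp add: top_group_iso_def iso_set_refl homeomorphic_map_id[unfolded id_def])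
      fix t v assume t: "t \<in> torus m" and v: "v \<in> W"
      obtain x y r t0 where *: "x \<in> BX" "y \<in> topspace A" "r \<in> J" "t0 \<in> torus m" "v = g1 ((x, (y, r)), t0)"
        using W_cases[OF v] .
      have "act t v = g1 ((x, (y, r)), cmult t t0)"
        using act_mult[OF t *(4) s_in[OF e_in[OF *(1-3)]]] unfolding *(5) by (simp add: g1_apply)
      then have 1: "\<phi> (act t v) = g2 ((x, (y, r)), cmult t t0)" using \<phi>(2)[of "(x, (y, r))" "cmult t t0"] * t by simp
      have 2: "\<phi> v = g2 ((x, (y, r)), t0)" using \<phi>(2)[of "(x, (y, r))" t0] * by simp
      obtain s1 u1 r1 where a: "\<alpha> t = (s1, u1, r1)" by (metis prod.exhaust)
      obtain s0 u0 r0 where a0: "\<alpha> t0 = (s0, u0, r0)" by (metis prod.exhaust)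
      have m3: "s1 \<in> torus i" "r1 \<in> torus (n - i)" "r0 \<in> torus (n - i)"
        using \<alpha>_in[OF t] \<alpha>_in[OF *(4)] a a0 by auto
      have am: "\<alpha> (cmult t t0) = (cmult s1 s0, cmult u1 u0, cmult r1 r0)"
        using \<alpha>_cmult[OF t *(4)] a a0 by simp
      \<comment> \<open>At parameter 0 the link point is discarded, so junk values of
        \<open>c\<close> are harmless when \<open>i = n\<close>.\<close>
      have cone: "cone_proj (c (y, cmult r1 r0), r) = cone_action actL r1 (cone_proj (c (y, r0), r))"
      proof (cases "r = 0")
        case False
        have "c (y, cmult r1 r0) = actL r1 (c (y, r0))"
          unfolding actL_def by (rule c_cmult[OF i_less[OF *(3) False] *(2) m3(2,3)])
        then show ?thesis using False by (simp add: cone_proj_def cone_action_def)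
      qed (simp add: cone_proj_def cone_action_def)
      show "\<phi> (act t v) = local_model_action actL (\<alpha> t) (\<phi> v)"
        unfolding 1 2 g2_cone am a a0 local_model_action_def
        using polar_cmult[OF m3(1)] cone by simp
    qed
    fix jj :: int assume jj: "-1 \<le> jj \<and> jj \<le> 2 * int n - 2 * int i - 1"
    show "\<phi> ` (W \<inter> orbit_filtration l n m X act (int l + 2 * int i + (int m - int n) + jj + 1)) =
        BL \<times> (\<Omega> \<times> torus (m - n)) \<times> cone_set (G' jj)"
    proof (rule chart_image[OF \<phi>(2)])
      show "cone_set (G' jj) \<subseteq> cone_set (topspace LX)"
        using G'_sub by (auto simp: cone_set_def)
      fix x y r t assume *: "x \<in> BX" "y \<in> topspace A" "r \<in> J" "t \<in> torus m"
      have r3: "snd (snd (\<alpha> t)) \<in> torus (n - i)" using \<alpha>_in[OF *(4)] by auto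
      have "cone_proj (c (y, snd (snd (\<alpha> t))), r) \<in> cone_set (G' jj) \<longleftrightarrow> r = 0 \<or> y \<in> G ((jj + 1) div 2 - 1)"
      proof (cases "r = 0")
        case True
        then show ?thesis by (simp add: cone_proj_def cone_set_def)
      next
        case False
        have "cone_proj (c (y, snd (snd (\<alpha> t))), r) \<in> cone_set (G' jj) \<longleftrightarrow> c (y, snd (snd (\<alpha> t))) \<in> G' jj"
          using False *(3) J_subset by (auto simp: cone_set_def image_iff cone_proj_eq)
        then show ?thesis using G'_iff[OF i_less[OF *(3) False] _ _ *(2) r3] jj False by simp
      qed
      then show "g1 ((x, (y, r)), t) \<in> orbit_filtration l n m X act (int l + 2 * int i + (int m - int n) + jj + 1)
          \<longleftrightarrow> cone_proj (c (y, snd (snd (\<alpha> t))), r) \<in> cone_set (G' jj)"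
        using g1_in_orbit_filtration[OF *] jj by simp
    qed
  qed
  then show ?thesis by blast
qed

section \<open>The link as an orbit model\<close>

definition "\<pi>L x = inv_into (topspace A) j (\<pi> x)"
text \<open>The isotropy groups along the slice, pulled back to the standard torus that acts on the
  link.\<close>

definition "\<mu>L y = {r \<in> torus (n - i). \<iota> r \<in> \<mu> (j y)}"

lemma \<pi>L_c:
  assumes "i < n" "y \<in> topspace A" "r \<in> torus (n - i)"
  shows "\<pi>L (c (y, r)) = y"
proof -
  have "inj_on j (topspace A)" using j_eq_iff[OF assms(1)] by (intro inj_onI) blast
  then show ?thesis
    unfolding \<pi>L_def proj_c[OF assms] by (rule inv_into_f_f[OF _ assms(2)])
qed

text \<open>The inductive step. The link lies over the slice \<open>j\<close>, along which constancy
  and semicontinuity of the isotropy groups pull back. Since these groups lie in \<open>H\<close>,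
  they are subtori of the smaller torus, of the dimension prescribed by the layers of
  \<open>A\<close>.\<close>

theorem link_orbit_model:
  assumes i_n: "i < n" and ln: "l' + n' = n - i - 1" and strat_A: "stratified_pseudomanifold l' n' A G"
  shows "orbit_model l' n' (n - i) A G LX actL \<pi>L \<mu>L"
proof -
  have LXt: "topspace LX = c ` (topspace A \<times> torus (n - i))" by (rule topspace_LX[OF i_n])
  have LX_cases: "\<exists>y\<in>topspace A. \<exists>r\<in>torus (n - i). x = c (y, r)" if "x \<in> topspace LX" for x
    using that unfolding LXt by auto
  have c_LX: "c (y, r) \<in> topspace LX" if "y \<in> topspace A" "r \<in> torus (n - i)" for y r
    using that unfolding LXt by simp
  have LX_X: "topspace LX \<subseteq> topspace X" using LXt c_in[OF i_n] by auto
  have LX_sub: "LX = subtopology X (topspace LX)"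
    unfolding LXt using i_n by (simp only: LX_def if_True)
  have act_c: "actL r (c (y, r')) = c (y, cmult r r')" if "y \<in> topspace A" "r \<in> torus (n - i)" "r' \<in> torus (n - i)" for y r r'
    unfolding actL_def by (rule c_cmult[OF i_n that, symmetric])
  have lay: "j y \<in> layer l F (i + l' + k + 1)" if "k \<le> n'" "y \<in> layer l' G k" "y \<in> topspace A" for k y
    unfolding j_def using e_layer_link[OF b_in that(3) half_in[OF i_n] _ ln i_n that(1)] that(2) by simp
  have jQ: "continuous_map A Q j"
    using j_continuous[OF i_n] continuous_map_in_subtopology by blast
  show ?thesis
  proof
    show "n' \<le> n - i" using ln by simp
    show "stratified_pseudomanifold l' n' A G" by (rule strat_A)
    show "compact_space LX" by (rule compact_LX)
    show "Hausdorff_space LX" unfolding LX_def by (rule Hausdorff_space_subtopology[OF Hausdorff_X])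
    show "second_countable LX" unfolding LX_def by (rule second_countable_subtopology[OF sc_X])
    show "torus_action (n - i) LX actL"
      unfolding torus_action_def
    proof (intro conjI ballI)
      have "continuous_map (prod_topology (torus_space (n - i)) LX) X snd"
      proof -
        have "continuous_map LX X id"
          unfolding LX_def by (rule continuous_map_from_subtopology[OF continuous_map_id])
        from continuous_map_compose[OF continuous_map_snd this] show ?thesis by simp
      qed
      moreover have "continuous_map (prod_topology (torus_space (n - i)) LX) (torus_space m) (\<iota> \<circ> fst)"
        by (rule continuous_map_compose[OF continuous_map_fst \<iota>_continuous])
      ultimately have "continuous_map (prod_topology (torus_space (n - i)) LX) (prod_topology (torus_space m) X) (\<lambda>w. ((\<iota> \<circ> fst) w, snd w))"
        by (intro continuous_map_pairI)
      from continuous_map_compose[OF this act_cont]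
      have "continuous_map (prod_topology (torus_space (n - i)) LX) X (\<lambda>(r, x). actL r x)"
        by (simp only: actL_def case_prod_unfold o_def fst_conv snd_conv)
      moreover have "actL r x \<in> topspace LX" if "r \<in> torus (n - i)" "x \<in> topspace LX" for r x
        using LX_cases[OF that(2)] act_c that(1) c_LX by auto
      ultimately show "continuous_map (prod_topology (torus_space (n - i)) LX) LX (\<lambda>(r, x). actL r x)"
        by (subst (2) LX_sub) (auto simp: continuous_map_in_subtopology)
      show "actL (\<lambda>_. 1) x = x" if "x \<in> topspace LX" for x
        using LX_cases[OF that] act_c[OF _ one_in_torus] by auto
      show "actL (cmult r r') x = actL r (actL r' x)" if "r \<in> torus (n - i)" "r' \<in> torus (n - i)" "x \<in> topspace LX" for r r' x
        using LX_cases[OF that(3)] act_c that by (auto simp: cmult_assoc)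
    qed
    have q: "quotient_map (prod_topology A (torus_space (n - i))) LX c"
      by (rule perfect_imp_quotient_map[OF perfect_c[OF i_n]])
    \<comment> \<open>Continuity is tested after composition with the quotient map \<open>c\<close>,
      where \<open>\<pi>L\<close> becomes the first projection.\<close>
    have "continuous_map (prod_topology A (torus_space (n - i))) A (\<pi>L \<circ> c)"
      by (rule continuous_map_eq[OF continuous_map_fst]) (auto simp: \<pi>L_c[OF i_n])
    then show "continuous_map LX A \<pi>L"
      by (rule continuous_compose_quotient_map[OF q])
    show "\<pi>L ` topspace LX = topspace A"
    proof (intro subset_antisym subsetI)
      fix y assume "y \<in> topspace A"
      then have "y = \<pi>L (c (y, (\<lambda>_. 1)))" "c (y, (\<lambda>_. 1)) \<in> topspace LX"
        using \<pi>L_c[OF i_n] c_LX by simp_all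
      then show "y \<in> \<pi>L ` topspace LX" by blast
    next
      fix y assume "y \<in> \<pi>L ` topspace LX"
      then obtain x where x: "x \<in> topspace LX" "y = \<pi>L x" by blast
      obtain y' r where "y' \<in> topspace A" "r \<in> torus (n - i)" "x = c (y', r)"
        using LX_cases[OF x(1)] by blast
      then show "y \<in> topspace A" using x(2) \<pi>L_c[OF i_n] by simp
    qed
    show "\<pi>L x = \<pi>L x' \<longleftrightarrow> (\<exists>t\<in>torus (n - i). x' = actL t x)" if x: "x \<in> topspace LX" "x' \<in> topspace LX" for x x'
    proof -
      obtain y r y' r' where *: "y \<in> topspace A" "r \<in> torus (n - i)" "x = c (y, r)"
          "y' \<in> topspace A" "r' \<in> torus (n - i)" "x' = c (y', r')"
        using LX_cases[OF x(1)] LX_cases[OF x(2)] by blast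
      show ?thesis
      proof
        assume "\<pi>L x = \<pi>L x'"
        then have "y = y'" using \<pi>L_c[OF i_n] * by simp
        then have "x' = actL (cmult r' (cinv r)) x"
          using act_c[OF *(1) _ *(2), of "cmult r' (cinv r)"] * by (simp add: cmult_assoc cmult_cinv)
        then show "\<exists>t\<in>torus (n - i). x' = actL t x" using * by (intro bexI[of _ "cmult r' (cinv r)"]) simp_all
      next
        assume "\<exists>t\<in>torus (n - i). x' = actL t x"
        then show "\<pi>L x = \<pi>L x'" using act_c[OF *(1) _ *(2)] *(1-3) \<pi>L_c[OF i_n *(1)] by auto
      qed
    qed
    show "\<exists>V \<sigma>. openin A V \<and> y \<in> V \<and> continuous_map (subtopology A V) LX \<sigma> \<and> (\<forall>u\<in>V. \<pi>L (\<sigma> u) = u)"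
      if "y \<in> topspace A" for y
    proof (intro exI conjI)
      \<comment> \<open>The slice lies in the domain of the section \<open>s\<close>, so the link
        even has a global section.\<close>
      have "continuous_map A (prod_topology A (torus_space (n - i))) (\<lambda>y. (y, (\<lambda>_. 1)))"
        by (intro continuous_map_pairI continuous_map_id[unfolded id_def]) simp
      from continuous_map_compose[OF this quotient_imp_continuous_map[OF q]]
      show "continuous_map (subtopology A (topspace A)) LX (\<lambda>y. c (y, (\<lambda>_. 1)))" by (simp add: o_def)
    qed (use that \<pi>L_c[OF i_n] in auto)
    show "isotropy (n - i) actL x = \<mu>L (\<pi>L x)" if x: "x \<in> topspace LX" for x
    proof -
      obtain y r where *: "y \<in> topspace A" "r \<in> torus (n - i)" "x = c (y, r)" using LX_cases[OF x] by blast
      have "actL t x = x \<longleftrightarrow> \<iota> t \<in> \<mu> (j y)" if "t \<in> torus (n - i)" for t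
      proof -
        have "actL t x = x \<longleftrightarrow> \<iota> t \<in> isotropy m act x"
          using \<iota>_in[OF that] by (simp add: isotropy_def actL_def)
        also have "\<dots> \<longleftrightarrow> \<iota> t \<in> \<mu> (\<pi> x)" using isotropy_eq x LX_X by blast
        finally show ?thesis using proj_c[OF i_n *(1,2)] *(3) by simp
      qed
      then show ?thesis
        using \<pi>L_c[OF i_n *(1,2)] *(3) by (auto simp: isotropy_def \<mu>L_def)
    qed
    show "subtorus_of_dim (n - i) (n' - k) (\<mu>L y)" if k: "k \<le> n'" and y: "y \<in> layer l' G k" for k y
    proof -
      have yA: "y \<in> topspace A"
        using layer_subset[OF stratified_pseudomanifold_filtration[OF strat_A] k] y by blast
      have "subtorus_of_dim m (n - (i + l' + k + 1)) (\<mu> (j y))"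
        by (rule mu_dim[OF _ lay[OF k y yA]]) (use ln k i_n in simp)
      moreover have "n - (i + l' + k + 1) = n' - k" using ln k i_n by simp
      moreover have "\<mu> (j y) \<subseteq> \<iota> ` torus (n - i)"
        unfolding \<iota>_image by (rule usc[OF j_in[OF i_n yA]])
      ultimately show ?thesis
        unfolding \<mu>L_def using subtorus_of_dim_preimage[OF \<iota>_embedding] by simp
    qed
    show "\<mu>L y = \<mu>L y'" if k: "k \<le> n'" and C: "connectedin A C" "C \<subseteq> layer l' G k" "y \<in> C" "y' \<in> C" for k C y y'
    proof -
      have CA: "C \<subseteq> topspace A" using C(1) by (rule connectedin_subset_topspace)
      have "\<mu> (j y) = \<mu> (j y')"
      proof (rule mu_const)
        show "i + l' + k + 1 \<le> n" using ln k i_n by simp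
        show "connectedin Q (j ` C)" by (rule connectedin_continuous_map_image[OF jQ C(1)])
        show "j ` C \<subseteq> layer l F (i + l' + k + 1)" using lay[OF k] C(2) CA by blast
      qed (use C in auto)
      then show ?thesis by (simp add: \<mu>L_def)
    qed
    show "\<exists>V. openin A V \<and> y \<in> V \<and> (\<forall>y'\<in>V. \<mu>L y' \<subseteq> \<mu>L y)" if y: "y \<in> topspace A" for y
    proof -
      have "j y \<in> topspace Q" using j_in[OF i_n y] U_subset by blast
      then obtain V where V: "openin Q V" "j y \<in> V" "\<forall>q'\<in>V. \<mu> q' \<subseteq> \<mu> (j y)" using mu_semicont by blast
      have "openin A {y' \<in> topspace A. j y' \<in> V}" by (rule openin_continuous_map_preimage[OF jQ V(1)])
      then show ?thesis
        using y V by (intro exI[of _ "{y' \<in> topspace A. j y' \<in> V}"]) (auto simp: \<mu>L_def)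
    qed
  qed
qed

end

section \<open>Orbit models are locally standard\<close>

context orbit_model
begin

text \<open>The chart is shrunk into the intersection of two neighbourhoods: one carrying a section,
  and one over which all isotropy groups lie in that of \<open>q\<close>.\<close>

lemma chart_at:
  assumes i: "i \<le> n" and q: "q \<in> layer l F i"
  obtains U b \<epsilon> A J G e \<alpha> f s where
    "orbit_chart l n m Q F X act \<pi> \<mu> i U b \<epsilon> A J G e (\<mu> q) \<alpha> f s q" "q \<in> U"
proof -
  have qQ: "q \<in> topspace Q" using layer_subset[OF filt i] q by blast
  obtain V1 s where V1: "openin Q V1" "q \<in> V1" "continuous_map (subtopology Q V1) X s" "\<forall>u\<in>V1. \<pi> (s u) = u"
    using local_section[OF qQ] by blast
  obtain V2 where V2: "openin Q V2" "q \<in> V2" "\<forall>q'\<in>V2. \<mu> q' \<subseteq> \<mu> q"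
    using mu_semicont[OF qQ] by blast
  have V: "openin Q (V1 \<inter> V2)" "q \<in> V1 \<inter> V2" using V1 V2 by auto
  have md: "m = i + (m - n) + (n - i)" using i nm by simp
  obtain \<alpha> f where sp: "split_torus m (n - i) i (m - n) (\<mu> q) \<alpha> f"
    by (rule split_torus_exists[OF mu_dim[OF i q] md]) (rule that)
  show thesis
  proof (rule layer_chart[OF strat i q V])
    fix U b \<epsilon> A J G e
    assume c: "conical_chart l n Q F i U b \<epsilon> A J G e" "U \<subseteq> V1 \<inter> V2" "U \<inter> F (int (l + i) - 1) = {}"
      "\<And>y. y \<in> topspace A \<Longrightarrow> e (b, (y, 0)) = q" "0 \<in> J"
    have ch: "chart l n Q F i U b \<epsilon> A J G e"
      by unfold_locales (use filt i c in auto)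
    have "orbit_chart l n m Q F X act \<pi> \<mu> i U b \<epsilon> A J G e (\<mu> q) \<alpha> f s q"
    proof (intro orbit_chart.intro orbit_chart_axioms.intro)
      show "orbit_model l n m Q F X act \<pi> \<mu>" by unfold_locales
      show "continuous_map (subtopology Q U) X s"
        using continuous_map_from_subtopology_mono[OF V1(3)] c(2) by blast
    qed (use ch sp V1(4) V2(3) c(2,4) in auto)
    moreover have "q \<in> U"
    proof -
      obtain y where y: "y \<in> topspace A" using chart.A(2)[OF ch] by blast
      have "e (b, (y, 0)) \<in> U" by (rule chart.e_in[OF ch chart.b_in[OF ch] y c(5)])
      then show ?thesis using c(4)[OF y] by simp
    qed
    ultimately show thesis by (rule that)
  qed
qed

lemma orbit_stratum_manifold:
  assumes i: "i \<le> n"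
  shows "topological_manifold (l + 2 * i + (m - n)) (subtopology X (orbit_stratum l n m X act i))"
proof (rule topological_manifold_local)
  let ?S = "orbit_stratum l n m X act i"
  show "Hausdorff_space (subtopology X ?S)" "second_countable (subtopology X ?S)"
    by (rule Hausdorff_space_subtopology[OF Hausdorff_X], rule second_countable_subtopology[OF sc_X])
  fix x assume "x \<in> topspace (subtopology X ?S)"
  then have x: "x \<in> topspace X" "x \<in> ?S" by auto
  then have xl: "\<pi> x \<in> layer l F i" using orbit_stratum_eq[OF i] by blast
  show "\<exists>V. openin (subtopology X ?S) V \<and> x \<in> V \<and>
      topological_manifold (l + 2 * i + (m - n)) (subtopology (subtopology X ?S) V)"
  proof (rule chart_at[OF i xl])
    fix U b \<epsilon> A J G e \<alpha> f s
    assume oc: "orbit_chart l n m Q F X act \<pi> \<mu> i U b \<epsilon> A J G e (\<mu> (\<pi> x)) \<alpha> f s (\<pi> x)" and U: "\<pi> x \<in> U"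
    interpret C: orbit_chart l n m Q F X act \<pi> \<mu> i U b \<epsilon> A J G e "\<mu> (\<pi> x)" \<alpha> f s "\<pi> x" by (rule oc)
    have "openin (subtopology X ?S) (?S \<inter> C.W)" using C.openW by (rule openin_subtopology_Int2)
    moreover have "subtopology (subtopology X ?S) (?S \<inter> C.W) = subtopology X (C.W \<inter> ?S)"
    proof -
      have "?S \<inter> (?S \<inter> C.W) = C.W \<inter> ?S" by blast
      then show ?thesis by (simp only: subtopology_subtopology)
    qed
    moreover have "x \<in> ?S \<inter> C.W" using x U by (simp add: C.W_def)
    ultimately show ?thesis using C.stratum_manifold by metis
  qed
qed

theorem orbit_stratified_X: "orbit_stratified l n m X act"
  unfolding orbit_stratified_def
proof (intro conjI ballI allI impI)
  show "subtorus m (isotropy m act x)" if x: "x \<in> topspace X" for x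
  proof -
    obtain i where i: "i \<le> n" "\<pi> x \<in> layer l F i" using proj_layer[OF x] .
    show ?thesis unfolding isotropy_eq[OF x] using mu_dim[OF i] by (rule subtorus_of_dim_imp_subtorus)
  qed
  show "closedin X (orbit_filtration l n m X act k)" for k by (rule orbit_filtration_closed)
  show "S \<subseteq> X closure_of S'" if "S \<in> orbit_strata l n m X act" "S' \<in> orbit_strata l n m X act"
    "S \<inter> X closure_of S' \<noteq> {}" for S S'
    using that by (rule orbit_strata_frontier)
  show "topological_manifold (l + 2 * i + (m - n)) (subtopology X (orbit_stratum l n m X act i))" if "i \<le> n" for i
    using that by (rule orbit_stratum_manifold)
  have "\<not> int (orbit_dim m X act x) \<le> int m - int n - 1" if x: "x \<in> topspace X" for x
  proof -
    obtain i where i: "i \<le> n" "\<pi> x \<in> layer l F i" using proj_layer[OF x] .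
    show ?thesis unfolding orbit_dim_eq[OF x i] using nm by (simp add: of_nat_diff)
  qed
  then show "{x \<in> topspace X. int (orbit_dim m X act x) \<le> int m - int n - 1} = {}" by blast
  \<comment> \<open>The index \<open>l + m + n\<close> halves to level \<open>n\<close> and the
    index two lower to level \<open>n - 1\<close>, so a free orbit exists over any point outside the
    second largest member of \<open>F\<close>.\<close>
  have k: "(int (l + m + n) - 2 - int l - (int m - int n)) div 2 = int n - 1"
    "(int (l + m + n) - int l - (int m - int n)) div 2 = int n" by auto
  have top: "orbit_filtration l n m X act (int (l + m + n)) = topspace X"
    by (rule orbit_filtration_top) (simp add: k(2))
  have low: "orbit_filtration l n m X act (int (l + m + n) - 2) = {x \<in> topspace X. \<pi> x \<in> F (int l + (int n - 1))}"
    using orbit_filtration_eq[of "int (l + m + n) - 2"] unfolding k(1) by simp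
  have "F (int (l + n) - 1) \<subset> F (int (l + n))" "F (int (l + n)) = topspace Q"
    using filt by (auto simp: filtration_def)
  then obtain q where q: "q \<in> topspace Q" "q \<notin> F (int (l + n) - 1)" by blast
  then obtain x where x: "x \<in> topspace X" "\<pi> x = q" using proj_onto by (metis imageE)
  have "int (l + n) - 1 = int l + (int n - 1)" by simp
  then have "x \<notin> orbit_filtration l n m X act (int (l + m + n) - 2)" unfolding low using x q(2) by (simp only: mem_Collect_eq)  simp
  then show "orbit_filtration l n m X act (int (l + m + n) - 2) \<subset> orbit_filtration l n m X act (int (l + m + n))"
    unfolding top using x(1) low by blast
qed (use nm sc_X compact_X Hausdorff_X action in auto)

text \<open>The free part of \<open>X\<close> is the preimage of the top layer of \<open>Q\<close>,
  and preimages of dense sets under an open map are dense.\<close>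

lemma dense_top:
  assumes "Q closure_of (F (int (l + n)) - F (int (l + n) - 1)) = topspace Q"
  shows "X closure_of (orbit_filtration l n m X act (int (l + m + n)) -
                  orbit_filtration l n m X act (int (l + m + n) - 2)) = topspace X"
proof -
  let ?T = "orbit_filtration l n m X act (int (l + m + n)) - orbit_filtration l n m X act (int (l + m + n) - 2)"
  have k: "(int (l + m + n) - 2 - int l - (int m - int n)) div 2 = int n - 1"
    "(int (l + m + n) - int l - (int m - int n)) div 2 = int n" by auto
  have ln: "int l + (int n - 1) = int (l + n) - 1" "int l + int n = int (l + n)" by simp_all
  have "orbit_filtration l n m X act (int (l + m + n)) = {x \<in> topspace X. \<pi> x \<in> F (int (l + n))}"
    using orbit_filtration_eq[of "int (l + m + n)"] unfolding k ln by simp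
  moreover have "orbit_filtration l n m X act (int (l + m + n) - 2) = {x \<in> topspace X. \<pi> x \<in> F (int (l + n) - 1)}"
    using orbit_filtration_eq[of "int (l + m + n) - 2"] unfolding k ln by simp
  ultimately have T: "?T = {x \<in> topspace X. \<pi> x \<in> F (int (l + n)) - F (int (l + n) - 1)}"
    by blast
  have sub: "F (int (l + n)) - F (int (l + n) - 1) \<subseteq> topspace Q"
    using filt by (auto simp: filtration_def)
  show ?thesis
  proof (rule subset_antisym[OF closure_of_subset_topspace])
    show "topspace X \<subseteq> X closure_of ?T"
      unfolding T using preimage_closure[OF sub] assms proj_in by blast
  qed
qed

text \<open>A compact discrete \<open>Q\<close> is finite, and here all isotropy groups are trivial.
  Choosing a point \<open>x a\<close> in each fibre identifies \<open>X\<close> with finitely many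
  copies of the torus.\<close>

lemma zero_dimensional:
  assumes l0: "l = 0" and n0: "n = 0"
  shows "locally_standard l n m X act"
proof -
  have Q: "Q = discrete_topology (topspace Q)"
    using strat by cases (use l0 n0 in auto)
  have "compactin Q (\<pi> ` topspace X)"
    using image_compactin[OF _ proj] compact_X by (simp add: compact_space_def)
  then have "compact_space Q" using proj_onto by (simp add: compact_space_def)
  then have "finite (topspace Q)" using Q compact_space_discrete_topology by metis
  then obtain g where g: "bij_betw g {..<card (topspace Q)} (topspace Q)"
    using ex_bij_betw_nat_finite atLeast0LessThan by metis
  define N where "N = card (topspace Q)"
  define x where "x a = (SOME x. x \<in> topspace X \<and> \<pi> x = g a)" for a
  have x: "x a \<in> topspace X" "\<pi> (x a) = g a" if "a < N" for a
  proof -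
    have "g a \<in> \<pi> ` topspace X" using g that proj_onto by (auto simp: bij_betw_def N_def)
    then have "\<exists>x. x \<in> topspace X \<and> \<pi> x = g a" by auto
    then show "x a \<in> topspace X" "\<pi> (x a) = g a" unfolding x_def by (metis (mono_tags, lifting) someI_ex)+
  qed
  define h where "h = (\<lambda>(t, a). act t (x a))"
  let ?T = "prod_topology (torus_space m) (discrete_topology {..<N})"
  have layer0: "q \<in> layer l F 0" if "q \<in> topspace Q" for q
    using filtration_layer[OF filt that] n0 by (metis le_zero_eq)
  have triv: "\<mu> q = {\<lambda>_. 1}" if "q \<in> topspace Q" for q
    using mu_dim[OF _ layer0[OF that]] n0 subtorus_of_dim_0[of m "\<mu> q"] by simp
  have "homeomorphic_map ?T X h"
  proof (rule continuous_imp_homeomorphic_map)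
    have "continuous_map (discrete_topology {..<N}) X x" using x(1) by simp
    from continuous_map_compose[OF continuous_map_snd this]
    have "continuous_map ?T (prod_topology (torus_space m) X) (\<lambda>w. (fst w, (x \<circ> snd) w))"
      by (intro continuous_map_pairI continuous_map_fst)
    from continuous_map_compose[OF this act_cont] show "continuous_map ?T X h"
      by (simp only: h_def case_prod_unfold o_def fst_conv snd_conv)
    show "compact_space ?T" by (simp add: compact_space_prod_topology compact_space_discrete_topology)
    show "Hausdorff_space X" by (rule Hausdorff_X)
    show "h ` topspace ?T = topspace X"
    proof (intro subset_antisym subsetI)
      fix y assume y: "y \<in> topspace X"
      have "\<pi> y \<in> g ` {..<N}" using proj_in[OF y] g by (simp add: bij_betw_def N_def)
      then obtain a where a: "a < N" "\<pi> y = g a" by auto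
      then obtain t where "t \<in> torus m" "y = act t (x a)" using fibre[of "x a" y] x[OF a(1)] y by auto
      then show "y \<in> h ` topspace ?T" using a(1) by (intro image_eqI[of _ _ "(t, a)"]) (auto simp: h_def)
    next
      fix y assume "y \<in> h ` topspace ?T"
      then show "y \<in> topspace X" using act_in x(1) by (auto simp: h_def)
    qed
    show "inj_on h (topspace ?T)"
    proof (rule inj_onI)
      fix w w' assume w: "w \<in> topspace ?T" "w' \<in> topspace ?T" "h w = h w'"
      obtain t a t' a' where eq: "w = (t, a)" "w' = (t', a')" by (metis prod.exhaust)
      then have ta: "t \<in> torus m" "a < N" "t' \<in> torus m" "a' < N" using w by auto
      have "\<pi> (h w) = g a" "\<pi> (h w') = g a'" using proj_act x ta by (auto simp: eq h_def)
      then have "g a = g a'" using w(3) by simp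
      then have aa: "a = a'" using g ta by (auto simp: bij_betw_def N_def dest: inj_onD)
      have "cmult (cinv t) t' \<in> \<mu> (\<pi> (x a))"
        using act_eq_iff[OF ta(1,3) x(1)[OF ta(2)]] w(3) aa by (simp add: eq h_def)
      then have "cmult (cinv t) t' = (\<lambda>_. 1)" using triv proj_in[OF x(1)[OF ta(2)]] by simp
      then have "cmult t (cmult (cinv t) t') = t" by simp
      then show "w = w'" using ta(1) aa by (simp add: eq)
    qed
  qed
  moreover have "\<forall>t\<in>torus m. \<forall>s\<in>torus m. \<forall>a<N. act t (h (s, a)) = h (cmult t s, a)"
    using act_mult x(1) by (auto simp: h_def)
  ultimately show ?thesis
    using orbit_stratified_X unfolding l0 n0 by (intro locally_standard.copies)
qed

end

text \<open>Induction with all data generalised, the torus included. A link has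
  \<open>l' + n' = n - i - 1\<close>, which is smaller than \<open>l + n\<close>, and its own torus
  has dimension \<open>n - i\<close>.\<close>

theorem orbit_model_locally_standard:
  "orbit_model l n m Q F X act \<pi> \<mu> \<Longrightarrow> locally_standard l n m X act"
proof (induction "l + n" arbitrary: l n m Q F X act \<pi> \<mu> rule: less_induct)
  case less
  interpret orbit_model l n m Q F X act \<pi> \<mu> by (rule less.prems)
  show ?case
  proof (cases "l + n = 0")
    case True
    then show ?thesis by (intro zero_dimensional) auto
  next
    case False
    show ?thesis
    proof (rule locally_standard.conical[OF False orbit_stratified_X])
      show "X closure_of (orbit_filtration l n m X act (int (l + m + n)) -
                  orbit_filtration l n m X act (int (l + m + n) - 2)) = topspace X"
        by (rule dense_top, use strat in cases) (use False in auto)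
      show "\<forall>i\<le>n. \<forall>x\<in>orbit_stratum l n m X act i.
        \<exists>U B \<Omega> L actL G \<alpha> \<phi>. compact_space L \<and>
        ((i = n \<and> topspace L = {} \<and> (\<forall>j. G j = {})) \<or>
         (i < n \<and> (\<exists>l' n'. l' + (n - i) + n' = 2 * n - 2 * i - 1 \<and>
            locally_standard l' n' (n - i) L actL \<and>
            G = orbit_filtration l' n' (n - i) L actL))) \<and>
        torus_cone_chart l n m X act i x U B \<Omega> L actL G \<alpha> \<phi>"
      proof (intro allI impI ballI)
        fix i x assume i: "i \<le> n" and "x \<in> orbit_stratum l n m X act i"
        then have x: "x \<in> topspace X" "\<pi> x \<in> layer l F i" using orbit_stratum_eq[OF i] by auto
        show "\<exists>U B \<Omega> L actL G \<alpha> \<phi>. compact_space L \<and>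
          ((i = n \<and> topspace L = {} \<and> (\<forall>j. G j = {})) \<or>
           (i < n \<and> (\<exists>l' n'. l' + (n - i) + n' = 2 * n - 2 * i - 1 \<and>
              locally_standard l' n' (n - i) L actL \<and>
              G = orbit_filtration l' n' (n - i) L actL))) \<and>
          torus_cone_chart l n m X act i x U B \<Omega> L actL G \<alpha> \<phi>"
        proof (rule chart_at[OF i x(2)])
          fix U b \<epsilon> A J G e \<alpha> f s
          assume oc: "orbit_chart l n m Q F X act \<pi> \<mu> i U b \<epsilon> A J G e (\<mu> (\<pi> x)) \<alpha> f s (\<pi> x)" and U: "\<pi> x \<in> U"
          interpret C: orbit_chart l n m Q F X act \<pi> \<mu> i U b \<epsilon> A J G e "\<mu> (\<pi> x)" \<alpha> f s "\<pi> x" by (rule oc)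
          show ?thesis
          proof (cases "i < n")
            case False
            then have L0: "topspace C.LX = {}" by (simp add: C.LX_def)
            have "\<exists>\<phi>. torus_cone_chart l n m X act i x C.W C.BL C.\<Omega> C.LX C.actL (\<lambda>_. {}) \<alpha> \<phi>"
              by (rule C.torus_cone_chart_exists[OF x(1) refl U x(2)]) (use False in auto)
            then obtain \<phi> where \<phi>: "torus_cone_chart l n m X act i x C.W C.BL C.\<Omega> C.LX C.actL (\<lambda>_. {}) \<alpha> \<phi>" ..
            show ?thesis
            proof (intro exI conjI)
              show "torus_cone_chart l n m X act i x C.W C.BL C.\<Omega> C.LX C.actL (\<lambda>_. {}) \<alpha> \<phi>" by (rule \<phi>)
            qed (rule C.compact_LX, rule disjI1, use L0 False i in simp)
          next
            case True
            then obtain l' n' where ln: "l' + n' = n - i - 1" "stratified_pseudomanifold l' n' A G"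
              using C.link_cases by auto
            have om: "orbit_model l' n' (n - i) A G C.LX C.actL C.\<pi>L C.\<mu>L"
              by (rule C.link_orbit_model[OF True ln])
            interpret L: orbit_model l' n' "n - i" A G C.LX C.actL C.\<pi>L C.\<mu>L by (rule om)
            have ls: "locally_standard l' n' (n - i) C.LX C.actL"
              by (rule less.hyps[OF _ om]) (use ln(1) True in simp)
            let ?G = "orbit_filtration l' n' (n - i) C.LX C.actL"
            have "\<exists>\<phi>. torus_cone_chart l n m X act i x C.W C.BL C.\<Omega> C.LX C.actL ?G \<alpha> \<phi>"
            proof (rule C.torus_cone_chart_exists[OF x(1) refl U x(2)])
              show "?G jj \<subseteq> topspace C.LX" for jj by (auto simp: orbit_filtration_def)
              fix jj y r assume jj: "-1 \<le> jj" "jj \<le> 2 * int n - 2 * int i - 1" and y: "y \<in> topspace A" and r: "r \<in> torus (n - i)"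
              \<comment> \<open>Hence the index \<open>jj\<close> is shifted by
                \<open>2 * l' + 1\<close>, that is, to \<open>(jj + 1) - 2 * (l' + 1)\<close>. The
                shift of \<open>jj + 1\<close> is even, so the rounding in the orbit filtration of
                the link agrees with that of \<open>X\<close>.\<close>
              have ni: "int (n - i) - int n' = int l' + 1" using ln(1) True by simp
              have "jj - int l' - (int (n - i) - int n') = (jj + 1) - 2 * (int l' + 1)" unfolding ni by simp
              then have k: "(jj - int l' - (int (n - i) - int n')) div 2 = (jj + 1) div 2 - (int l' + 1)"
                by simp
              have "(jj + 1) div 2 - (int l' + 1) \<le> int n'" using ni jj(2) by simp
              then have "?G jj = {x \<in> topspace C.LX. C.\<pi>L x \<in> G (int l' + ((jj + 1) div 2 - (int l' + 1)))}"
                using L.orbit_filtration_eq[of jj] unfolding k by simp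
              moreover have "int l' + ((jj + 1) div 2 - (int l' + 1)) = (jj + 1) div 2 - 1" by simp
              moreover have "C.c (y, r) \<in> topspace C.LX" using C.topspace_LX[OF True] y r by simp
              ultimately show "C.c (y, r) \<in> ?G jj \<longleftrightarrow> y \<in> G ((jj + 1) div 2 - 1)"
                using C.\<pi>L_c[OF True y r] by simp
            qed
            then obtain \<phi> where \<phi>: "torus_cone_chart l n m X act i x C.W C.BL C.\<Omega> C.LX C.actL ?G \<alpha> \<phi>" ..
            \<comment> \<open>The link upstairs has the dimension \<open>n - i - 1\<close> of the
              link of \<open>Q\<close> plus the dimension \<open>n - i\<close> of its torus.\<close>
            have "l' + (n - i) + n' = 2 * n - 2 * i - 1" using ln(1) True by simp
            with True have d: "i < n \<and> (\<exists>l' n'. l' + (n - i) + n' = 2 * n - 2 * i - 1 \<and>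
                locally_standard l' n' (n - i) C.LX C.actL \<and> ?G = orbit_filtration l' n' (n - i) C.LX C.actL)"
              using ls by (intro conjI exI[of _ l'] exI[of _ n'] refl)
            show ?thesis
            proof (intro exI conjI)
              show "torus_cone_chart l n m X act i x C.W C.BL C.\<Omega> C.LX C.actL ?G \<alpha> \<phi>" by (rule \<phi>)
            qed (rule C.compact_LX, rule disjI2, rule d)
          qed
        qed
      qed
    qed
  qed
qed

section \<open>The canonical model\<close>

text \<open>A countable base of the image consists of the sets of points whose entire fibre lies in
  a finite union of basic open sets. They are open because the map is closed, and they suffice
  because fibres are compact.\<close>

lemma second_countable_perfect_image:
  assumes f: "perfect_map X Y f" and X: "second_countable X"
  shows "second_countable Y"
proof -
  have fc: "continuous_map X Y f" and fp: "proper_map X Y f" and fs: "f ` topspace X = topspace Y"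
    using f by (auto simp: perfect_map_def)
  obtain B where B: "countable B" "\<And>V. V \<in> B \<Longrightarrow> openin X V"
    "\<And>U x. openin X U \<Longrightarrow> x \<in> U \<Longrightarrow> \<exists>V\<in>B. x \<in> V \<and> V \<subseteq> U"
    using X unfolding second_countable_def by metis
  define sh where "sh A = topspace Y - f ` (topspace X - \<Union>A)" for A
  have "countable {A. finite A \<and> A \<subseteq> B}"
    using B(1) by (metis (no_types, lifting) Collect_cong countable_Collect_finite_subset)
  then have "countable (sh ` {A. finite A \<and> A \<subseteq> B})" by (rule countable_image)
  moreover have "openin Y V" if V: "V \<in> sh ` {A. finite A \<and> A \<subseteq> B}" for V
  proof -
    obtain A where A: "A \<subseteq> B" "V = sh A" using V by auto
    have "openin X (\<Union>A)" using A(1) B(2) by (intro openin_Union) auto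
    then have "closedin X (topspace X - \<Union>A)" by (rule closedin_diff[OF closedin_topspace])
    then have "closedin Y (f ` (topspace X - \<Union>A))"
      using proper_imp_closed_map[OF fp] by (simp add: closed_map_def)
    then show ?thesis unfolding A(2) sh_def by (rule openin_diff[OF openin_topspace])
  qed
  moreover have "\<exists>V\<in>sh ` {A. finite A \<and> A \<subseteq> B}. y \<in> V \<and> V \<subseteq> U" if U: "openin Y U" "y \<in> U" for U y
  proof -
    let ?K = "{x \<in> topspace X. f x = y}" and ?W = "{x \<in> topspace X. f x \<in> U}"
    have y: "y \<in> topspace Y" using U openin_subset by blast
    have K: "compactin X ?K" using fp y by (simp add: proper_map_def)
    have W: "openin X ?W" by (rule openin_continuous_map_preimage[OF fc U(1)])
    define \<U> where "\<U> = {V \<in> B. V \<subseteq> ?W}"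
    have op: "\<And>V. V \<in> \<U> \<Longrightarrow> openin X V" using B(2) by (auto simp: \<U>_def)
    have "?K \<subseteq> \<Union>\<U>"
    proof
      fix x assume "x \<in> ?K"
      then have "x \<in> ?W" using U(2) by auto
      then show "x \<in> \<Union>\<U>" using B(3)[OF W] by (fastforce simp: \<U>_def)
    qed
    then obtain A where A: "finite A" "A \<subseteq> \<U>" "?K \<subseteq> \<Union>A"
      using compactinD[OF K, of \<U>] op by blast
    have "y \<in> sh A" using y A(3) by (auto simp: sh_def)
    moreover have "sh A \<subseteq> U"
    proof
      fix z assume z: "z \<in> sh A"
      then obtain x where x: "x \<in> topspace X" "z = f x" using fs by (auto simp: sh_def)
      then have "x \<in> \<Union>A" using z by (auto simp: sh_def)
      then show "z \<in> U" using A(2) x(2) by (auto simp: \<U>_def)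
    qed
    moreover have "A \<subseteq> B" using A(2) by (auto simp: \<U>_def)
    ultimately show ?thesis using A(1) by blast
  qed
  ultimately show ?thesis unfolding second_countable_def by (intro exI[of _ "sh ` {A. finite A \<and> A \<subseteq> B}"] conjI ballI allI impI) blast+
qed

lemma second_countable_finite_open_cover:
  assumes "finite \<U>" "\<And>U. U \<in> \<U> \<Longrightarrow> openin X U \<and> second_countable (subtopology X U)" "topspace X \<subseteq> \<Union>\<U>"
  shows "second_countable X"
proof -
  have "\<exists>B. countable B \<and> (\<forall>V\<in>B. openin X V) \<and>
      (\<forall>W x. openin X W \<and> x \<in> W \<inter> U \<longrightarrow> (\<exists>V\<in>B. x \<in> V \<and> V \<subseteq> W))" if U: "U \<in> \<U>" for U
  proof -
    obtain B where B: "countable B" "\<And>V. V \<in> B \<Longrightarrow> openin (subtopology X U) V"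
      "\<And>W x. openin (subtopology X U) W \<Longrightarrow> x \<in> W \<Longrightarrow> \<exists>V\<in>B. x \<in> V \<and> V \<subseteq> W"
      using assms(2)[OF U] unfolding second_countable_def by metis
    show ?thesis
    proof (intro exI conjI ballI allI impI)
      show "countable B" by (rule B(1))
      show "openin X V" if "V \<in> B" for V using B(2)[OF that] assms(2)[OF U] openin_trans_full by blast
      fix W x assume "openin X W \<and> x \<in> W \<inter> U"
      then show "\<exists>V\<in>B. x \<in> V \<and> V \<subseteq> W"
        using B(3)[of "U \<inter> W" x] openin_subtopology_Int2[of X W U] by (metis IntI IntD1 IntD2 le_infE)
    qed
  qed
  then obtain B where B: "\<And>U. U \<in> \<U> \<Longrightarrow> countable (B U)" "\<And>U V. U \<in> \<U> \<Longrightarrow> V \<in> B U \<Longrightarrow> openin X V"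
    "\<And>U W x. U \<in> \<U> \<Longrightarrow> openin X W \<Longrightarrow> x \<in> W \<inter> U \<Longrightarrow> \<exists>V\<in>B U. x \<in> V \<and> V \<subseteq> W"
    by metis
  show ?thesis
    unfolding second_countable_def
  proof (intro exI conjI ballI allI impI)
    show "countable (\<Union>U\<in>\<U>. B U)" by (rule countable_UN[OF countable_finite[OF assms(1)]]) (rule B(1))
    show "openin X V" if "V \<in> (\<Union>U\<in>\<U>. B U)" for V using that B(2) by blast
    fix W x assume W: "openin X W \<and> x \<in> W"
    then have "x \<in> \<Union>\<U>" using assms(3) openin_subset by blast
    then obtain U where "U \<in> \<U>" "x \<in> U" by blast
    then show "\<exists>V\<in>\<Union>U\<in>\<U>. B U. x \<in> V \<and> V \<subseteq> W" using B(3)[of U W x] W by blast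
  qed
qed

section \<open>Isotropy groups on \<open>Q\<close> and the principal bundle\<close>

locale model_data =
  fixes l n m :: nat and Q :: "'q topology" and F :: "int \<Rightarrow> 'q set"
    and lam :: "'q set \<Rightarrow> cvec set" and P :: "'p topology" and \<xi> :: "'p \<Rightarrow> 'q" and \<rho> :: "cvec \<Rightarrow> 'p \<Rightarrow> 'p"
  assumes sc_Q: "second_countable Q" and compact_Q: "compact_space Q"
    and strat: "stratified_pseudomanifold l n Q F" and nm: "n \<le> m"
    and char_functor: "characteristic_functor m l n Q F lam"
    and torus_bundle: "principal_torus_bundle m Q P \<xi> \<rho>"
begin

lemma filt: "filtration l n Q F"
  by (rule stratified_pseudomanifold_filtration[OF strat])

lemma Hausdorff_Q: "Hausdorff_space Q"
  by (rule stratified_pseudomanifold_Hausdorff[OF strat])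

definition "stratum q = (THE S. S \<in> strata l n Q F \<and> q \<in> S)"
definition "\<mu> q = lam (stratum q)"

lemma stratum_unique:
  assumes "S \<in> strata l n Q F" "S' \<in> strata l n Q F" "q \<in> S" "q \<in> S'"
  shows "S = S'"
proof -
  obtain i where i: "i \<le> n" "S \<in> connected_components_of (subtopology Q (layer l F i))" using assms(1) strata_iff by blast
  obtain j where j: "j \<le> n" "S' \<in> connected_components_of (subtopology Q (layer l F j))" using assms(2) strata_iff by blast
  have "i = j"
    using layer_unique[OF filt i(1) j(1)] component_subset[OF i(2)] component_subset[OF j(2)] assms(3,4) by blast
  then show ?thesis using connected_components_of_overlap[of S _ S'] i(2) j(2) assms(3,4) by blast
qed

lemma stratum_eq:
  assumes "S \<in> strata l n Q F" "q \<in> S"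
  shows "stratum q = S"
  unfolding stratum_def
proof (rule the_equality)
  show "S' = S" if "S' \<in> strata l n Q F \<and> q \<in> S'" for S'
    using stratum_unique[of S' S q] that assms by blast
qed (use assms in blast)

lemma stratum_layer:
  assumes "i \<le> n" "q \<in> layer l F i"
  shows "stratum q \<in> connected_components_of (subtopology Q (layer l F i))" "q \<in> stratum q" "stratum q \<in> strata l n Q F"
proof -
  obtain S where S: "S \<in> connected_components_of (subtopology Q (layer l F i))" "q \<in> S"
    using layer_component[OF filt assms] .
  then have "S \<in> strata l n Q F" using assms(1) strata_iff by blast
  then show "stratum q \<in> connected_components_of (subtopology Q (layer l F i))" "q \<in> stratum q" "stratum q \<in> strata l n Q F"
    using S stratum_eq by auto
qed

lemma stratum_in: "q \<in> topspace Q \<Longrightarrow> q \<in> stratum q \<and> stratum q \<in> strata l n Q F"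
  using filtration_layer[OF filt] stratum_layer by metis

lemma mu_dim:
  assumes i: "i \<le> n" and q: "q \<in> layer l F i"
  shows "subtorus_of_dim m (n - i) (\<mu> q)"
proof -
  \<comment> \<open>\<open>characteristic_functor\<close> indexes strata by codimension,
    \<open>layer\<close> by dimension above \<open>l\<close>.\<close>
  have "l + n - (n - i) = l + i" using i by simp
  then have "stratum q \<in> strata_of_dim Q F (l + n - (n - i))"
    using stratum_layer(1)[OF i q] by (simp only: strata_of_dim_def layer_def)
  then show ?thesis using char_functor unfolding characteristic_functor_def \<mu>_def by simp
qed

lemma mu_subtorus:
  assumes "q \<in> topspace Q"
  obtains k where "subtorus_of_dim m k (\<mu> q)"
  using filtration_layer[OF filt assms] mu_dim by blast

lemma mu_const:
  assumes i: "i \<le> n" and C: "connectedin Q C" "C \<subseteq> layer l F i" "q \<in> C" "q' \<in> C"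
  shows "\<mu> q = \<mu> q'"
proof -
  have q: "q \<in> layer l F i" using C by blast
  have "C \<subseteq> stratum q"
    using component_maximal[OF stratum_layer(1)[OF i q] C(1,2)] stratum_layer(2)[OF i q] C(3) by blast
  then have "stratum q' = stratum q" using stratum_eq[OF stratum_layer(3)[OF i q]] C(4) by blast
  then show ?thesis by (simp add: \<mu>_def)
qed

text \<open>Every stratum that meets a small chart around \<open>q\<close> has the stratum of
  \<open>q\<close> in its closure, and \<open>lam\<close> reverses this order.\<close>

lemma mu_semicont:
  assumes q: "q \<in> topspace Q"
  shows "\<exists>U. openin Q U \<and> q \<in> U \<and> (\<forall>q'\<in>U. \<mu> q' \<subseteq> \<mu> q)"
proof -
  obtain i where i: "i \<le> n" "q \<in> layer l F i" using filtration_layer[OF filt q] .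
  show ?thesis
  proof (rule layer_chart[OF strat i openin_topspace q])
    fix U b \<epsilon> A J G e
    assume c: "conical_chart l n Q F i U b \<epsilon> A J G e" "U \<inter> F (int (l + i) - 1) = {}"
      "\<And>y. y \<in> topspace A \<Longrightarrow> e (b, (y, 0)) = q" "0 \<in> J"
    note iq = i
    interpret chart l n Q F i U b \<epsilon> A J G e
      by unfold_locales (use filt i c in auto)
    obtain y where y: "y \<in> topspace A" using A(2) by blast
    have qU: "q \<in> U" using e_in[OF b_in y c(4)] c(3)[OF y] by simp
    have "\<mu> q' \<subseteq> \<mu> q" if "q' \<in> U" for q'
    proof -
      have q': "q' \<in> topspace Q" using that U_subset by blast
      have "U \<inter> stratum q' \<noteq> {}" using stratum_in[OF q'] that by blast
      then have "U \<inter> layer l F i \<subseteq> Q closure_of (stratum q')"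
        using core_subset_closure stratum_in[OF q'] by blast
      then have "stratum q \<inter> Q closure_of (stratum q') \<noteq> {}" using qU iq(2) stratum_in[OF q] by blast
      then have "stratum q \<subseteq> Q closure_of (stratum q')"
        using strata_frontier[OF strat] stratum_in[OF q] stratum_in[OF q'] by blast
      then show ?thesis
        using char_functor stratum_in[OF q] stratum_in[OF q'] unfolding characteristic_functor_def \<mu>_def by blast
    qed
    then show ?thesis using open_U qU by blast
  qed
qed

lemma xi_cont: "continuous_map P Q \<xi>" and rho_action: "torus_action m P \<rho>"
  using torus_bundle by (auto simp: principal_torus_bundle_def)

lemma rho_cont: "continuous_map (prod_topology (torus_space m) P) P (\<lambda>(t, x). \<rho> t x)"
  and rho_one: "x \<in> topspace P \<Longrightarrow> \<rho> (\<lambda>_. 1) x = x"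
  and rho_mult: "\<lbrakk>s \<in> torus m; t \<in> torus m; x \<in> topspace P\<rbrakk> \<Longrightarrow> \<rho> (cmult s t) x = \<rho> s (\<rho> t x)"
  using rho_action by (simp_all add: torus_action_def)

lemma rho_in: "t \<in> torus m \<Longrightarrow> x \<in> topspace P \<Longrightarrow> \<rho> t x \<in> topspace P"
  using continuous_map_image_subset_topspace[OF rho_cont] by auto

lemma xi_in: "x \<in> topspace P \<Longrightarrow> \<xi> x \<in> topspace Q"
  using continuous_map_image_subset_topspace[OF xi_cont] by blast

lemma trivialization:
  assumes "q \<in> topspace Q"
  obtains U h where "openin Q U" "q \<in> U"
    "homeomorphic_map (subtopology P {x \<in> topspace P. \<xi> x \<in> U}) (prod_topology (subtopology Q U) (torus_space m)) h"
    "\<And>x. \<lbrakk>x \<in> topspace P; \<xi> x \<in> U\<rbrakk> \<Longrightarrow> fst (h x) = \<xi> x"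
    "\<And>x t. \<lbrakk>x \<in> topspace P; \<xi> x \<in> U; t \<in> torus m\<rbrakk> \<Longrightarrow> h (\<rho> t x) = (\<xi> x, cmult t (snd (h x)))"
proof -
  have "\<exists>U h. openin Q U \<and> q \<in> U \<and>
      homeomorphic_map (subtopology P {x \<in> topspace P. \<xi> x \<in> U}) (prod_topology (subtopology Q U) (torus_space m)) h \<and>
      (\<forall>x\<in>topspace P. \<xi> x \<in> U \<longrightarrow> fst (h x) = \<xi> x \<and>
         (\<forall>t\<in>torus m. h (\<rho> t x) = (\<xi> x, cmult t (snd (h x)))))"
    using torus_bundle[unfolded principal_torus_bundle_def, THEN conjunct2, THEN conjunct2] assms by (rule bspec)
  then obtain U h where *: "openin Q U" "q \<in> U"
    "homeomorphic_map (subtopology P {x \<in> topspace P. \<xi> x \<in> U}) (prod_topology (subtopology Q U) (torus_space m)) h"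
    "\<forall>x\<in>topspace P. \<xi> x \<in> U \<longrightarrow> fst (h x) = \<xi> x \<and>
         (\<forall>t\<in>torus m. h (\<rho> t x) = (\<xi> x, cmult t (snd (h x))))"
    by (elim exE conjE)
  show thesis by (rule that[OF *(1-3)]) (use *(4) in simp_all)
qed

text \<open>
  The trivialisations determine \<open>\<xi> (\<rho> t x)\<close> only while this point stays in their domain; by
  connectedness of the torus it never leaves the fibre.
\<close>

lemma xi_rho:
  assumes t: "t \<in> torus m" and x: "x \<in> topspace P"
  shows "\<xi> (\<rho> t x) = \<xi> x"
proof -
  obtain U h where U: "openin Q U" "\<xi> x \<in> U"
    "\<And>x. \<lbrakk>x \<in> topspace P; \<xi> x \<in> U\<rbrakk> \<Longrightarrow> fst (h x) = \<xi> x"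
    "\<And>x t. \<lbrakk>x \<in> topspace P; \<xi> x \<in> U; t \<in> torus m\<rbrakk> \<Longrightarrow> h (\<rho> t x) = (\<xi> x, cmult t (snd (h x)))"
    by (rule trivialization[OF xi_in[OF x]]) (rule that)
  have "continuous_map (torus_space m) (prod_topology (torus_space m) P) (\<lambda>t. (t, x))"
    using x by (intro continuous_map_pairI continuous_map_id[unfolded id_def]) simp
  from continuous_map_compose[OF continuous_map_compose[OF this rho_cont] xi_cont]
  have c: "continuous_map (torus_space m) Q (\<lambda>t. \<xi> (\<rho> t x))" by (simp add: o_def)
  have eq: "\<xi> (\<rho> t x) = \<xi> x" if "t \<in> torus m" "\<xi> (\<rho> t x) \<in> U" for t
    using U(3)[OF rho_in[OF that(1) x] that(2)] U(4)[OF x U(2) that(1)] by simp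
  let ?T = "{t \<in> topspace (torus_space m). \<xi> (\<rho> t x) \<in> U}"
  have T: "?T = {t \<in> topspace (torus_space m). \<xi> (\<rho> t x) \<in> {\<xi> x}}"
  proof (rule Collect_cong, rule conj_cong[OF refl])
    fix t assume "t \<in> topspace (torus_space m)"
    then have "t \<in> torus m" by simp
    then show "\<xi> (\<rho> t x) \<in> U \<longleftrightarrow> \<xi> (\<rho> t x) \<in> {\<xi> x}"
      using eq[of t] U(2) by (metis singletonD singletonI)
  qed
  have "closedin (torus_space m) ?T"
    unfolding T by (rule closedin_continuous_map_preimage[OF c]) (simp add: closedin_Hausdorff_singleton Hausdorff_Q xi_in x)
  moreover have "openin (torus_space m) ?T" by (rule openin_continuous_map_preimage[OF c U(1)])
  ultimately have "?T = {} \<or> ?T = topspace (torus_space m)"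
    using connected_torus_space[of m] unfolding connected_space_clopen_in by blast
  moreover have "(\<lambda>_. 1) \<in> ?T" using rho_one[OF x] U(2) by simp
  ultimately have "?T = topspace (torus_space m)" by blast
  then have "t \<in> ?T" using t by simp
  then have "\<xi> (\<rho> t x) \<in> U" by simp
  then show ?thesis by (rule eq[OF t])
qed

lemma rho_free:
  assumes "s \<in> torus m" "t \<in> torus m" "x \<in> topspace P" "\<rho> s x = \<rho> t x"
  shows "s = t"
proof -
  obtain U h where U: "\<xi> x \<in> U"
    "homeomorphic_map (subtopology P {x \<in> topspace P. \<xi> x \<in> U}) (prod_topology (subtopology Q U) (torus_space m)) h"
    "\<And>x t. \<lbrakk>x \<in> topspace P; \<xi> x \<in> U; t \<in> torus m\<rbrakk> \<Longrightarrow> h (\<rho> t x) = (\<xi> x, cmult t (snd (h x)))"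
    by (rule trivialization[OF xi_in[OF assms(3)]]) (rule that)
  have "h x \<in> topspace (prod_topology (subtopology Q U) (torus_space m))"
    using homeomorphic_imp_surjective_map[OF U(2)] assms(3) U(1) by (metis (mono_tags, lifting) IntI imageI mem_Collect_eq topspace_subtopology)
  then have "snd (h x) \<in> torus m" by auto
  moreover have "cmult s (snd (h x)) = cmult t (snd (h x))"
    using U(3)[OF assms(3) U(1) assms(1)] U(3)[OF assms(3) U(1) assms(2)] assms(4) by simp
  ultimately show ?thesis by (metis cmult_commute cmult_left_cancel)
qed

lemma rho_transitive:
  assumes "x \<in> topspace P" "y \<in> topspace P" "\<xi> x = \<xi> y"
  obtains t where "t \<in> torus m" "y = \<rho> t x"
proof -
  obtain U h where U: "\<xi> x \<in> U"
    "homeomorphic_map (subtopology P {x \<in> topspace P. \<xi> x \<in> U}) (prod_topology (subtopology Q U) (torus_space m)) h"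
    "\<And>x. \<lbrakk>x \<in> topspace P; \<xi> x \<in> U\<rbrakk> \<Longrightarrow> fst (h x) = \<xi> x"
    "\<And>x t. \<lbrakk>x \<in> topspace P; \<xi> x \<in> U; t \<in> torus m\<rbrakk> \<Longrightarrow> h (\<rho> t x) = (\<xi> x, cmult t (snd (h x)))"
    by (rule trivialization[OF xi_in[OF assms(1)]]) (rule that)
  have mem: "z \<in> topspace (subtopology P {x \<in> topspace P. \<xi> x \<in> U})" if "z \<in> topspace P" "\<xi> z = \<xi> x" for z
    using that U(1) by simp
  have hz: "snd (h z) \<in> torus m" if "z \<in> topspace P" "\<xi> z = \<xi> x" for z
  proof -
    have "h z \<in> topspace (prod_topology (subtopology Q U) (torus_space m))"
      using homeomorphic_imp_surjective_map[OF U(2)] mem[OF that] by blast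
    then show ?thesis by auto
  qed
  define t where "t = cmult (snd (h y)) (cinv (snd (h x)))"
  have t: "t \<in> torus m" unfolding t_def using hz assms by simp
  have "h (\<rho> t x) = (\<xi> x, snd (h y))"
    using U(4)[OF assms(1) U(1) t] hz[OF assms(1) refl] by (simp add: t_def cmult_assoc cmult_cinv)
  also have "\<dots> = h y" using U(3)[OF assms(2)] assms(3) U(1) by (simp add: prod_eq_iff)
  finally have "\<rho> t x = y"
    using homeomorphic_imp_injective_map[OF U(2)] mem[OF rho_in[OF t assms(1)] xi_rho[OF t assms(1)]] mem[OF assms(2) assms(3)[symmetric]]
    by (meson inj_onD)
  then show thesis using that t by blast
qed

text \<open>By regularity of \<open>Q\<close> each point has an open \<open>V\<close> inside a
  closed \<open>K\<close> inside a trivialising \<open>U\<close>. The bundle is compact over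
  \<open>K\<close> and second countable over \<open>U\<close>, and finitely many \<open>V\<close>
  cover \<open>Q\<close>.\<close>

lemma compact_P: "compact_space P" and sc_P: "second_countable P"
proof -
  define good where "good q V K U \<longleftrightarrow> openin Q V \<and> q \<in> V \<and> V \<subseteq> K \<and> compactin P {x \<in> topspace P. \<xi> x \<in> K} \<and>
      openin Q U \<and> V \<subseteq> U \<and> second_countable (subtopology P {x \<in> topspace P. \<xi> x \<in> U})" for q V K U
  have "\<exists>V K U. good q V K U" if q: "q \<in> topspace Q" for q
  proof -
    obtain U h where U: "openin Q U" "q \<in> U"
      "homeomorphic_map (subtopology P {x \<in> topspace P. \<xi> x \<in> U}) (prod_topology (subtopology Q U) (torus_space m)) h"
      "\<And>x. \<lbrakk>x \<in> topspace P; \<xi> x \<in> U\<rbrakk> \<Longrightarrow> fst (h x) = \<xi> x"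
      by (rule trivialization[OF q]) (rule that)
    have "regular_space Q" using compact_Q Hausdorff_Q by (rule compact_Hausdorff_imp_regular_space)
    then obtain V K where V: "openin Q V" "closedin Q K" "q \<in> V" "V \<subseteq> K" "K \<subseteq> U"
      using U(1,2) unfolding neighbourhood_base_of_closedin[symmetric] neighbourhood_base_of by metis
    let ?PU = "subtopology P {x \<in> topspace P. \<xi> x \<in> U}" and ?QT = "prod_topology (subtopology Q U) (torus_space m)"
    have "compactin Q K" using V(2) compact_Q closedin_compact_space by blast
    then have "compactin ?QT (K \<times> torus m)"
      using V(5) by (simp add: compactin_Times compactin_subtopology compact_torus)
    then have "compactin ?PU {x \<in> topspace ?PU. h x \<in> K \<times> torus m}"
      by (rule compactin_proper_map_preimage[OF homeomorphic_imp_proper_map[OF U(3)]])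
    moreover have "{x \<in> topspace ?PU. h x \<in> K \<times> torus m} = {x \<in> topspace P. \<xi> x \<in> K}"
    proof (intro Set.set_eqI iffI)
      fix x assume x: "x \<in> {x \<in> topspace P. \<xi> x \<in> K}"
      then have xU: "x \<in> topspace P" "\<xi> x \<in> U" "x \<in> topspace ?PU" using V(5) by auto
      have "h x \<in> topspace ?QT" using homeomorphic_imp_surjective_map[OF U(3)] xU(3) by blast
      then have "snd (h x) \<in> torus m" by auto
      then show "x \<in> {x \<in> topspace ?PU. h x \<in> K \<times> torus m}"
        using x xU U(4)[OF xU(1,2)] by (simp add: mem_Times_iff)
    next
      fix x assume x: "x \<in> {x \<in> topspace ?PU. h x \<in> K \<times> torus m}"
      then have "x \<in> topspace P" "\<xi> x \<in> U" by auto
      then show "x \<in> {x \<in> topspace P. \<xi> x \<in> K}" using x U(4)[of x] by (simp add: mem_Times_iff)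
    qed
    ultimately have "compactin P {x \<in> topspace P. \<xi> x \<in> K}" by (simp add: compactin_subtopology)
    moreover have "second_countable ?PU"
      using homeomorphic_space_second_countability[OF homeomorphic_map_imp_homeomorphic_space[OF U(3)]]
        second_countable_prod_topology[OF second_countable_subtopology[OF sc_Q] second_countable_torus_space] by blast
    moreover have "V \<subseteq> U" using V(4,5) by blast
    ultimately have "good q V K U" using U(1) V(1,3,4) unfolding good_def by (intro conjI)
    then show ?thesis by blast
  qed
  then obtain V K U where good: "\<And>q. q \<in> topspace Q \<Longrightarrow> good q (V q) (K q) (U q)"
    by metis
  then have VKU: "\<And>q. q \<in> topspace Q \<Longrightarrow> openin Q (V q) \<and> q \<in> V q \<and> V q \<subseteq> K q \<and>
      compactin P {x \<in> topspace P. \<xi> x \<in> K q} \<and> openin Q (U q) \<and> V q \<subseteq> U q \<and>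
      second_countable (subtopology P {x \<in> topspace P. \<xi> x \<in> U q})"
    unfolding good_def .
  have oV: "openin Q (V q)" and mem: "q \<in> V q" and VK: "V q \<subseteq> K q" and cK: "compactin P {x \<in> topspace P. \<xi> x \<in> K q}"
    and oU: "openin Q (U q)" and VU: "V q \<subseteq> U q" and scU: "second_countable (subtopology P {x \<in> topspace P. \<xi> x \<in> U q})"
    if "q \<in> topspace Q" for q
    using VKU[OF that] by blast+
  have "\<forall>W\<in>V ` topspace Q. openin Q W" "topspace Q \<subseteq> \<Union>(V ` topspace Q)" using oV mem by blast+
  from compact_Q[unfolded compact_space_alt, THEN spec, THEN mp, OF conjI[OF this]]
  obtain \<F> where "finite \<F>" "\<F> \<subseteq> V ` topspace Q" "topspace Q \<subseteq> \<Union>\<F>"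
    by (elim exE conjE)
  then obtain A where A: "finite A" "A \<subseteq> topspace Q" "topspace Q \<subseteq> \<Union>(V ` A)"
    by (metis finite_subset_image)
  have cover: "\<exists>a\<in>A. \<xi> x \<in> V a" if "x \<in> topspace P" for x
    using A(3) xi_in[OF that] by blast
  have "compactin P (\<Union>a\<in>A. {x \<in> topspace P. \<xi> x \<in> K a})"
    using A(1,2) cK by (intro compactin_Union) auto
  moreover have "(\<Union>a\<in>A. {x \<in> topspace P. \<xi> x \<in> K a}) = topspace P"
  proof (intro subset_antisym subsetI)
    fix x assume x: "x \<in> topspace P"
    obtain a where "a \<in> A" "\<xi> x \<in> V a" using cover[OF x] by blast
    then show "x \<in> (\<Union>a\<in>A. {x \<in> topspace P. \<xi> x \<in> K a})" using VK A(2) x by blast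
  qed blast
  ultimately show "compact_space P" by (simp add: compact_space_def)
  show "second_countable P"
  proof (rule second_countable_finite_open_cover)
    show "finite ((\<lambda>a. {x \<in> topspace P. \<xi> x \<in> U a}) ` A)" using A(1) by simp
    show "topspace P \<subseteq> \<Union>((\<lambda>a. {x \<in> topspace P. \<xi> x \<in> U a}) ` A)"
    proof
      fix x assume x: "x \<in> topspace P"
      obtain a where "a \<in> A" "\<xi> x \<in> V a" using cover[OF x] by blast
      then show "x \<in> \<Union>((\<lambda>a. {x \<in> topspace P. \<xi> x \<in> U a}) ` A)" using VU A(2) x by blast
    qed
    fix W assume "W \<in> (\<lambda>a. {x \<in> topspace P. \<xi> x \<in> U a}) ` A"
    then obtain a where a: "a \<in> topspace Q" "W = {x \<in> topspace P. \<xi> x \<in> U a}" using A(2) by blast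
    show "openin P W \<and> second_countable (subtopology P W)"
      unfolding a(2) using openin_continuous_map_preimage[OF xi_cont oU[OF a(1)]] scU[OF a(1)] by blast
  qed
qed

section \<open>The quotient of the bundle by the isotropy groups\<close>

abbreviation "cls \<equiv> model_class l n Q F lam P \<xi> \<rho>"
abbreviation "X \<equiv> canonical_model l n Q F lam P \<xi> \<rho>"

text \<open>The stratum through a point is unique, so the choice of a stratum in
  \<open>model_class\<close> is no choice, and a class is an orbit of a single subtorus.\<close>

lemma cls_eq:
  assumes x: "x \<in> topspace P"
  shows "cls x = (\<lambda>t. \<rho> t x) ` \<mu> (\<xi> x)"
proof -
  obtain k where k: "subtorus_of_dim m k (\<mu> (\<xi> x))" using mu_subtorus[OF xi_in[OF x]] .
  have sub: "\<mu> (\<xi> x) \<subseteq> torus m" by (rule subtorus_of_dim_subset[OF k])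
  have st: "\<xi> x \<in> stratum (\<xi> x)" "stratum (\<xi> x) \<in> strata l n Q F" using stratum_in[OF xi_in[OF x]] by auto
  show ?thesis
  proof (intro subset_antisym subsetI)
    fix y assume "y \<in> cls x"
    then obtain S t where "S \<in> strata l n Q F" "\<xi> x \<in> S" "t \<in> lam S" "y = \<rho> t x"
      unfolding model_class_def by blast
    then show "y \<in> (\<lambda>t. \<rho> t x) ` \<mu> (\<xi> x)" using stratum_eq by (auto simp: \<mu>_def)
  next
    fix y assume "y \<in> (\<lambda>t. \<rho> t x) ` \<mu> (\<xi> x)"
    then obtain t where t: "t \<in> \<mu> (\<xi> x)" "y = \<rho> t x" by blast
    then have "y \<in> topspace P" "\<xi> x = \<xi> y" using sub rho_in xi_rho x by auto
    then show "y \<in> cls x" unfolding model_class_def using t st by (auto simp: \<mu>_def)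
  qed
qed

lemma cls_eq_iff:
  assumes x: "x \<in> topspace P" and y: "y \<in> topspace P"
  shows "cls x = cls y \<longleftrightarrow> (\<exists>t\<in>\<mu> (\<xi> x). y = \<rho> t x)"
proof
  obtain k where k: "subtorus_of_dim m k (\<mu> (\<xi> y))" using mu_subtorus[OF xi_in[OF y]] .
  have "\<rho> (\<lambda>_. 1) y \<in> cls y" unfolding cls_eq[OF y] using subtorus_of_dim_one[OF k] by blast
  then have "y \<in> cls y" using rho_one[OF y] by simp
  moreover assume "cls x = cls y"
  ultimately show "\<exists>t\<in>\<mu> (\<xi> x). y = \<rho> t x" using cls_eq[OF x] by auto
next
  obtain k where k: "subtorus_of_dim m k (\<mu> (\<xi> x))" using mu_subtorus[OF xi_in[OF x]] .
  have sub: "\<mu> (\<xi> x) \<subseteq> torus m" by (rule subtorus_of_dim_subset[OF k])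
  assume "\<exists>t\<in>\<mu> (\<xi> x). y = \<rho> t x"
  then obtain t where t: "t \<in> \<mu> (\<xi> x)" "y = \<rho> t x" by blast
  then have tm: "t \<in> torus m" using sub by blast
  have xy: "\<xi> y = \<xi> x" using xi_rho[OF tm x] t(2) by simp
  have 1: "\<rho> s y = \<rho> (cmult s t) x" if "s \<in> \<mu> (\<xi> x)" for s
    using rho_mult[of s t x] that sub tm x t(2) by auto
  show "cls x = cls y"
    unfolding cls_eq[OF x] cls_eq[OF y] xy
  proof (intro subset_antisym subsetI)
    fix z assume "z \<in> (\<lambda>t. \<rho> t x) ` \<mu> (\<xi> x)"
    then obtain s where s: "s \<in> \<mu> (\<xi> x)" "z = \<rho> s x" by blast
    define s' where "s' = cmult s (cinv t)"
    have "s' \<in> \<mu> (\<xi> x)"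
      unfolding s'_def by (rule subtorus_of_dim_cmult[OF k s(1) subtorus_of_dim_cinv[OF k t(1)]])
    moreover have "cmult s' t = s" using tm by (simp add: s'_def cmult_assoc cmult_cinv)
    then have "z = \<rho> s' y" using 1[OF calculation] s(2) by simp
    ultimately show "z \<in> (\<lambda>t. \<rho> t y) ` \<mu> (\<xi> x)" by blast
  next
    fix z assume "z \<in> (\<lambda>t. \<rho> t y) ` \<mu> (\<xi> x)"
    then obtain s where s: "s \<in> \<mu> (\<xi> x)" "z = \<rho> s y" by blast
    then have "z = \<rho> (cmult s t) x" using 1 by simp
    moreover have "cmult s t \<in> \<mu> (\<xi> x)" by (rule subtorus_of_dim_cmult[OF k s(1) t(1)])
    ultimately show "z \<in> (\<lambda>t. \<rho> t x) ` \<mu> (\<xi> x)" by blast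
  qed
qed

lemma openin_X: "openin X V \<longleftrightarrow> V \<subseteq> cls ` topspace P \<and> openin P {x \<in> topspace P. cls x \<in> V}"
  unfolding canonical_model_def by (rule openin_quotient_topology)

lemma topspace_X: "topspace X = cls ` topspace P"
proof -
  have "{x \<in> topspace P. cls x \<in> cls ` topspace P} = topspace P" by blast
  then have "openin X (cls ` topspace P)" unfolding openin_X by simp
  then show ?thesis using openin_X openin_subset openin_topspace by (metis subset_antisym)
qed

lemma quotient_cls: "quotient_map P X cls"
  unfolding quotient_map_def topspace_X openin_X by blast

lemma cls_cont: "continuous_map P X cls"
  by (rule quotient_imp_continuous_map[OF quotient_cls])

definition "\<pi> C = \<xi> (SOME x. x \<in> topspace P \<and> cls x = C)"

lemma pi_cls: "x \<in> topspace P \<Longrightarrow> \<pi> (cls x) = \<xi> x"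
proof -
  assume x: "x \<in> topspace P"
  define y where "y = (SOME y. y \<in> topspace P \<and> cls y = cls x)"
  have y: "y \<in> topspace P" "cls y = cls x" using someI[of "\<lambda>y. y \<in> topspace P \<and> cls y = cls x" x] x by (auto simp: y_def)
  then obtain t where t: "t \<in> \<mu> (\<xi> y)" "x = \<rho> t y" using cls_eq_iff[OF y(1) x] by blast
  obtain k where "subtorus_of_dim m k (\<mu> (\<xi> y))" using mu_subtorus[OF xi_in[OF y(1)]] .
  then have "t \<in> torus m" using subtorus_of_dim_subset t(1) by blast
  then have "\<xi> x = \<xi> y" using xi_rho y(1) t(2) by simp
  then show "\<pi> (cls x) = \<xi> x" by (simp add: \<pi>_def y_def)
qed

lemma pi_cont: "continuous_map X Q \<pi>"
proof -
  have "continuous_map P Q (\<pi> \<circ> cls)"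
    by (rule continuous_map_eq[OF xi_cont]) (simp add: pi_cls)
  then show ?thesis by (rule continuous_compose_quotient_map[OF quotient_cls])
qed

lemma xi_onto: "\<xi> ` topspace P = topspace Q"
proof (intro subset_antisym subsetI)
  fix q assume q: "q \<in> topspace Q"
  obtain U h where U: "q \<in> U" "openin Q U"
    "homeomorphic_map (subtopology P {x \<in> topspace P. \<xi> x \<in> U}) (prod_topology (subtopology Q U) (torus_space m)) h"
    "\<And>x. \<lbrakk>x \<in> topspace P; \<xi> x \<in> U\<rbrakk> \<Longrightarrow> fst (h x) = \<xi> x"
    by (rule trivialization[OF q]) (rule that)
  have "(q, (\<lambda>_. 1)) \<in> topspace (prod_topology (subtopology Q U) (torus_space m))" using U(1) q by simp
  then obtain x where "x \<in> topspace (subtopology P {x \<in> topspace P. \<xi> x \<in> U})" "h x = (q, (\<lambda>_. 1))"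
    using homeomorphic_imp_surjective_map[OF U(3)] by (metis (no_types, lifting) imageE)
  then have "x \<in> topspace P" "\<xi> x = q" using U(4)[of x] by auto
  then show "q \<in> \<xi> ` topspace P" by blast
qed (use xi_in in blast)

text \<open>Different fibres are separated in \<open>Q\<close>. Within one fibre, separation depends
  on the isotropy groups not growing nearby, that is, on the semicontinuity of
  \<open>\<mu>\<close>.\<close>

lemma Hausdorff_X: "Hausdorff_space X"
  unfolding Hausdorff_space_def
proof (intro allI impI)
  fix C C' assume CC: "C \<in> topspace X \<and> C' \<in> topspace X \<and> C \<noteq> C'"
  then obtain x x' where x: "x \<in> topspace P" "C = cls x" "x' \<in> topspace P" "C' = cls x'"
    unfolding topspace_X by blast
  show "\<exists>U V. openin X U \<and> openin X V \<and> C \<in> U \<and> C' \<in> V \<and> disjnt U V"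
  proof (cases "\<xi> x = \<xi> x'")
    case False
    then obtain U V where UV: "openin Q U" "openin Q V" "\<xi> x \<in> U" "\<xi> x' \<in> V" "disjnt U V"
      using Hausdorff_Q xi_in x unfolding Hausdorff_space_def by metis
    show ?thesis
    proof (intro exI conjI)
      show "openin X {C \<in> topspace X. \<pi> C \<in> U}" "openin X {C \<in> topspace X. \<pi> C \<in> V}"
        using openin_continuous_map_preimage[OF pi_cont] UV by blast+
      show "C \<in> {C \<in> topspace X. \<pi> C \<in> U}" "C' \<in> {C \<in> topspace X. \<pi> C \<in> V}"
        using CC x UV pi_cls by auto
      show "disjnt {C \<in> topspace X. \<pi> C \<in> U} {C \<in> topspace X. \<pi> C \<in> V}"
        using UV(5) by (auto simp: disjnt_def)
    qed
  next
    case True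
    \<comment> \<open>Over a neighbourhood where all isotropy groups lie in \<open>\<mu> (\<xi> x)\<close>, the component of a
      trivialisation complementary to \<open>\<mu> (\<xi> x)\<close> is constant on classes and separates them.\<close>
    have q: "\<xi> x \<in> topspace Q" by (rule xi_in[OF x(1)])
    obtain i where i: "i \<le> n" "\<xi> x \<in> layer l F i" using filtration_layer[OF filt q] .
    obtain U1 h where U1: "openin Q U1" "\<xi> x \<in> U1"
      "homeomorphic_map (subtopology P {x \<in> topspace P. \<xi> x \<in> U1}) (prod_topology (subtopology Q U1) (torus_space m)) h"
      "\<And>x t. \<lbrakk>x \<in> topspace P; \<xi> x \<in> U1; t \<in> torus m\<rbrakk> \<Longrightarrow> h (\<rho> t x) = (\<xi> x, cmult t (snd (h x)))"
      by (rule trivialization[OF q]) (rule that)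
    obtain U2 where U2: "openin Q U2" "\<xi> x \<in> U2" "\<forall>q'\<in>U2. \<mu> q' \<subseteq> \<mu> (\<xi> x)" using mu_semicont[OF q] by blast
    have md: "m = i + (m - n) + (n - i)" using i(1) nm by simp
    obtain \<alpha> f where "split_torus m (n - i) i (m - n) (\<mu> (\<xi> x)) \<alpha> f"
      by (rule split_torus_exists[OF mu_dim[OF i] md]) (rule that)
    then interpret S: split_torus m "n - i" i "m - n" "\<mu> (\<xi> x)" \<alpha> f .
    let ?PU = "subtopology P {x \<in> topspace P. \<xi> x \<in> U1}"
    let ?T = "prod_topology (torus_space i) (torus_space (m - n))"
    define \<theta> where "\<theta> y = (fst (\<alpha> (snd (h y))), fst (snd (\<alpha> (snd (h y)))))" for y
    have "continuous_map ?PU (torus_space m) (\<lambda>y. snd (h y))"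
      by (rule continuous_map_sndI[OF homeomorphic_imp_continuous_map[OF U1(3)]])
    moreover have "continuous_map (torus_space m) (prod_topology (torus_space i) (prod_topology (torus_space (m - n)) (torus_space (n - i)))) \<alpha>"
      using S.maps by (simp only: homeomorphic_maps_def)
    ultimately have "continuous_map ?PU (prod_topology (torus_space i) (prod_topology (torus_space (m - n)) (torus_space (n - i)))) (\<alpha> \<circ> (\<lambda>y. snd (h y)))"
      by (rule continuous_map_compose)
    then have "continuous_map ?PU ?T (\<lambda>y. (fst ((\<alpha> \<circ> (\<lambda>y. snd (h y))) y), fst (snd ((\<alpha> \<circ> (\<lambda>y. snd (h y))) y))))"
      by (intro continuous_map_pairI continuous_map_fstI continuous_map_sndI)
    then have \<theta>c: "continuous_map ?PU ?T \<theta>" by (simp only: \<theta>_def[abs_def] o_def)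
    have snd_h: "snd (h y) \<in> torus m" if "y \<in> topspace P" "\<xi> y \<in> U1" for y
    proof -
      have "y \<in> topspace ?PU" using that by simp
      then have "h y \<in> topspace (prod_topology (subtopology Q U1) (torus_space m))"
        using homeomorphic_imp_surjective_map[OF U1(3)] by blast
      then show ?thesis by auto
    qed
    have \<theta>_iff: "\<theta> y = \<theta> (\<rho> t y) \<longleftrightarrow> t \<in> \<mu> (\<xi> x)" if y: "y \<in> topspace P" "\<xi> y \<in> U1" "t \<in> torus m" for y t
    proof -
      have a: "snd (h y) \<in> torus m" by (rule snd_h[OF y(1,2)])
      have "snd (h (\<rho> t y)) = cmult t (snd (h y))" using U1(4)[OF y] by simp
      moreover have "cmult (cinv (snd (h y))) (cmult t (snd (h y))) = t"
        using a by (simp add: cmult_left_commute cmult_cinv)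
      ultimately show ?thesis
        using S.\<alpha>_cinv_cmult[OF a cmult_in_torus[OF y(3) a]] by (simp add: \<theta>_def)
    qed
    obtain t where t: "t \<in> torus m" "x' = \<rho> t x" using rho_transitive[OF x(1,3) True] .
    have "t \<notin> \<mu> (\<xi> x)" using CC cls_eq_iff[OF x(1,3)] t(2) x by auto
    then have ne: "\<theta> x \<noteq> \<theta> x'" using \<theta>_iff[OF x(1) U1(2) t(1)] t(2) by simp
    have xPU: "x \<in> topspace ?PU" "x' \<in> topspace ?PU" using x U1(2) True by auto
    have \<theta>T: "\<theta> x \<in> topspace ?T" "\<theta> x' \<in> topspace ?T"
      using continuous_map_image_subset_topspace[OF \<theta>c] xPU by blast+
    have "Hausdorff_space ?T" by (simp only: Hausdorff_space_prod_topology Hausdorff_torus_space simp_thms)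
    then obtain N N' where N: "openin ?T N" "openin ?T N'" "\<theta> x \<in> N" "\<theta> x' \<in> N'" "disjnt N N'"
      using ne \<theta>T unfolding Hausdorff_space_def by metis
    define Z where "Z M = {y \<in> topspace P. \<xi> y \<in> U1 \<inter> U2 \<and> \<theta> y \<in> M}" for M
    have oZ: "openin P (Z M)" if "openin ?T M" for M
    proof -
      have "openin ?PU {y \<in> topspace ?PU. \<theta> y \<in> M}" by (rule openin_continuous_map_preimage[OF \<theta>c that])
      moreover have "openin P {x \<in> topspace P. \<xi> x \<in> U1}" "openin P {x \<in> topspace P. \<xi> x \<in> U2}"
        by (rule openin_continuous_map_preimage[OF xi_cont], fact)+
      ultimately have "openin P ({y \<in> topspace ?PU. \<theta> y \<in> M} \<inter> {x \<in> topspace P. \<xi> x \<in> U2})"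
        using openin_trans_full by blast
      moreover have "{y \<in> topspace ?PU. \<theta> y \<in> M} \<inter> {x \<in> topspace P. \<xi> x \<in> U2} = Z M" by (auto simp: Z_def)
      ultimately show ?thesis by simp
    qed
    \<comment> \<open>Over \<open>U2\<close> two equivalent points differ by an element of
      \<open>\<mu> (\<xi> x)\<close>, which does not change \<open>\<theta>\<close>. The sets
      \<open>Z M\<close> are therefore unions of classes and have open images.\<close>
    have sat: "\<xi> y' = \<xi> y \<and> \<theta> y' = \<theta> y" if y: "y \<in> topspace P" "\<xi> y \<in> U1 \<inter> U2" "y' \<in> topspace P" "cls y = cls y'" for y y'
    proof -
      obtain s where s: "s \<in> \<mu> (\<xi> y)" "y' = \<rho> s y" using cls_eq_iff[OF y(1,3)] y(4) by blast
      then have sx: "s \<in> \<mu> (\<xi> x)" using U2(3) y(2) by blast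
      then have "s \<in> torus m" using subtorus_of_dim_subset[OF S.H] by blast
      then show ?thesis using \<theta>_iff[of y s] xi_rho[of s y] y s(2) sx by auto
    qed
    have oX: "openin X (cls ` Z M)" if "openin ?T M" for M
    proof -
      have "{y \<in> topspace P. cls y \<in> cls ` Z M} = Z M"
      proof (intro subset_antisym subsetI)
        fix y' assume "y' \<in> {y \<in> topspace P. cls y \<in> cls ` Z M}"
        then obtain y where y: "y' \<in> topspace P" "y \<in> Z M" "cls y' = cls y" by blast
        then show "y' \<in> Z M" using sat[of y y'] by (auto simp: Z_def)
      qed (auto simp: Z_def)
      then show ?thesis using oZ[OF that] unfolding openin_X by (auto simp: Z_def)
    qed
    show ?thesis
    proof (intro exI conjI)
      show "openin X (cls ` Z N)" "openin X (cls ` Z N')" using oX N by blast+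
      show "C \<in> cls ` Z N" "C' \<in> cls ` Z N'" using x N U1(2) U2(2) True by (auto simp: Z_def)
      show "disjnt (cls ` Z N) (cls ` Z N')"
      proof (rule ccontr)
        assume "\<not> disjnt (cls ` Z N) (cls ` Z N')"
        then obtain y y' where "y \<in> Z N" "y' \<in> Z N'" "cls y = cls y'" by (auto simp: disjnt_def)
        then show False using sat[of y y'] N(5) by (auto simp: Z_def disjnt_def)
      qed
    qed
  qed
qed

lemma perfect_cls: "perfect_map P X cls"
  by (rule perfect_map_compact_Hausdorff[OF cls_cont compact_P Hausdorff_X topspace_X[symmetric]])

lemma model_action_cls:
  assumes t: "t \<in> torus m" and x: "x \<in> topspace P"
  shows "model_action \<rho> t (cls x) = cls (\<rho> t x)"
proof -
  obtain k where k: "subtorus_of_dim m k (\<mu> (\<xi> x))" using mu_subtorus[OF xi_in[OF x]] .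
  have "\<rho> t (\<rho> s x) = \<rho> s (\<rho> t x)" if "s \<in> \<mu> (\<xi> x)" for s
  proof -
    have "s \<in> torus m" using subtorus_of_dim_subset[OF k] that by blast
    then show ?thesis using rho_mult[of t s x] rho_mult[of s t x] t x by (simp add: cmult_commute)
  qed
  then show ?thesis
    unfolding model_action_def cls_eq[OF x] cls_eq[OF rho_in[OF t x]] xi_rho[OF t x] image_image
    by (intro image_cong refl)
qed

theorem canonical_orbit_model: "orbit_model l n m Q F X (model_action \<rho>) \<pi> \<mu>"
proof
  show "compact_space X"
    using image_compactin[OF _ cls_cont, of "topspace P"] compact_P unfolding compact_space_def topspace_X by blast
  show "Hausdorff_space X" by (rule Hausdorff_X)
  show "second_countable X" by (rule second_countable_perfect_image[OF perfect_cls sc_P])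
  show "torus_action m X (model_action \<rho>)"
    unfolding torus_action_def
  proof (intro conjI ballI)
    \<comment> \<open>Continuity of the action is tested on torus x \<open>P\<close>. The product of
      the identity with \<open>cls\<close> is a quotient map because both factors are
      perfect.\<close>
    have q: "quotient_map (prod_topology (torus_space m) P) (prod_topology (torus_space m) X) (\<lambda>(t, x). (id t, cls x))"
      by (rule perfect_imp_quotient_map[OF perfect_map_prod[OF perfect_map_id perfect_cls]])
    have "continuous_map (prod_topology (torus_space m) P) X (cls \<circ> (\<lambda>(t, x). \<rho> t x))"
      by (rule continuous_map_compose[OF rho_cont cls_cont])
    then have "continuous_map (prod_topology (torus_space m) P) X
        ((\<lambda>(t, C). model_action \<rho> t C) \<circ> (\<lambda>(t, x). (id t, cls x)))"
      by (rule continuous_map_eq) (auto simp: model_action_cls)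
    then show "continuous_map (prod_topology (torus_space m) X) X (\<lambda>(t, C). model_action \<rho> t C)"
      by (rule continuous_compose_quotient_map[OF q])
    show "model_action \<rho> (\<lambda>_. 1) C = C" if "C \<in> topspace X" for C
      using that model_action_cls[OF one_in_torus] rho_one unfolding topspace_X by auto
    show "model_action \<rho> (cmult s t) C = model_action \<rho> s (model_action \<rho> t C)"
      if "s \<in> torus m" "t \<in> torus m" "C \<in> topspace X" for s t C
      using that model_action_cls rho_in rho_mult unfolding topspace_X by auto
  qed
  show "\<pi> ` topspace X = topspace Q"
    unfolding topspace_X image_image using xi_onto pi_cls by simp
  show "\<pi> C = \<pi> C' \<longleftrightarrow> (\<exists>t\<in>torus m. C' = model_action \<rho> t C)" if CC: "C \<in> topspace X" "C' \<in> topspace X" for C C'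
  proof -
    obtain x x' where x: "x \<in> topspace P" "C = cls x" "x' \<in> topspace P" "C' = cls x'"
      using CC unfolding topspace_X by blast
    show ?thesis
    proof
      assume "\<pi> C = \<pi> C'"
      then have "\<xi> x = \<xi> x'" using x pi_cls by simp
      then obtain t where t: "t \<in> torus m" "x' = \<rho> t x" using rho_transitive[OF x(1,3)] by blast
      then have "C' = model_action \<rho> t C" using model_action_cls[OF t(1) x(1)] x(2,4) by simp
      then show "\<exists>t\<in>torus m. C' = model_action \<rho> t C" using t(1) by blast
    next
      assume "\<exists>t\<in>torus m. C' = model_action \<rho> t C"
      then obtain t where "t \<in> torus m" "C' = cls (\<rho> t x)" using model_action_cls x by auto
      then show "\<pi> C = \<pi> C'" using pi_cls rho_in xi_rho x by simp
    qed
  qed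
  show "\<exists>U s. openin Q U \<and> q \<in> U \<and> continuous_map (subtopology Q U) X s \<and> (\<forall>u\<in>U. \<pi> (s u) = u)"
    if q: "q \<in> topspace Q" for q
  proof -
    obtain U h where U: "openin Q U" "q \<in> U"
      "homeomorphic_map (subtopology P {x \<in> topspace P. \<xi> x \<in> U}) (prod_topology (subtopology Q U) (torus_space m)) h"
      "\<And>x. \<lbrakk>x \<in> topspace P; \<xi> x \<in> U\<rbrakk> \<Longrightarrow> fst (h x) = \<xi> x"
      by (rule trivialization[OF q]) (rule that)
    let ?PU = "subtopology P {x \<in> topspace P. \<xi> x \<in> U}" and ?QT = "prod_topology (subtopology Q U) (torus_space m)"
    obtain k where k: "homeomorphic_maps ?PU ?QT h k" using U(3) homeomorphic_map_maps by blast
    have kc: "continuous_map ?QT ?PU k" and hk: "\<And>z. z \<in> topspace ?QT \<Longrightarrow> h (k z) = z"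
      using k by (simp_all only: homeomorphic_maps_def)
    have Ut: "topspace (subtopology Q U) = U" using openin_subset[OF U(1)] by auto
    have "continuous_map (subtopology Q U) ?QT (\<lambda>u. (u, (\<lambda>_. 1)))"
      by (intro continuous_map_pairI continuous_map_id[unfolded id_def]) simp
    from continuous_map_compose[OF this kc] have "continuous_map (subtopology Q U) P (k \<circ> (\<lambda>u. (u, (\<lambda>_. 1))))"
      using continuous_map_in_subtopology by blast
    from continuous_map_compose[OF this cls_cont]
    have "continuous_map (subtopology Q U) X (\<lambda>u. cls (k (u, (\<lambda>_. 1))))" by (simp add: o_def)
    moreover have "\<pi> (cls (k (u, (\<lambda>_. 1)))) = u" if u: "u \<in> U" for u
    proof -
      have z: "(u, (\<lambda>_. 1)) \<in> topspace ?QT" using u Ut by simp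
      then have "k (u, (\<lambda>_. 1)) \<in> topspace ?PU" using continuous_map_image_subset_topspace[OF kc] by blast
      then have kp: "k (u, (\<lambda>_. 1)) \<in> topspace P" "\<xi> (k (u, (\<lambda>_. 1))) \<in> U" by auto
      show ?thesis using pi_cls[OF kp(1)] U(4)[OF kp] hk[OF z] by simp
    qed
    ultimately show ?thesis using U(1,2) by blast
  qed
  show "isotropy m (model_action \<rho>) C = \<mu> (\<pi> C)" if C: "C \<in> topspace X" for C
  proof -
    obtain x where x: "x \<in> topspace P" "C = cls x" using C unfolding topspace_X by blast
    obtain k where k: "subtorus_of_dim m k (\<mu> (\<xi> x))" using mu_subtorus[OF xi_in[OF x(1)]] .
    have sub: "\<mu> (\<xi> x) \<subseteq> torus m" by (rule subtorus_of_dim_subset[OF k])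
    \<comment> \<open>The torus acts freely on \<open>P\<close>, so the stabiliser of a class is
      exactly the subtorus whose orbit the class is.\<close>
    have "model_action \<rho> t C = C \<longleftrightarrow> t \<in> \<mu> (\<xi> x)" if t: "t \<in> torus m" for t
    proof -
      have "model_action \<rho> t C = C \<longleftrightarrow> cls x = cls (\<rho> t x)" using model_action_cls[OF t x(1)] x(2) by auto
      also have "\<dots> \<longleftrightarrow> (\<exists>s\<in>\<mu> (\<xi> x). \<rho> t x = \<rho> s x)" by (rule cls_eq_iff[OF x(1) rho_in[OF t x(1)]])
      also have "\<dots> \<longleftrightarrow> t \<in> \<mu> (\<xi> x)" using rho_free[OF t _ x(1)] sub by blast
      finally show ?thesis .
    qed
    then show ?thesis using sub pi_cls[OF x(1)] x(2) by (auto simp: isotropy_def)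
  qed
qed (rule nm strat pi_cont mu_dim mu_const mu_semicont; assumption)+

end

theorem theorem12p1:
  fixes Q :: "'q topology" and F :: "int \<Rightarrow> 'q set"
    and lam :: "'q set \<Rightarrow> (nat \<Rightarrow> complex) set"
    and c :: "('q chain \<Rightarrow> nat \<Rightarrow> int) set"
    and P :: "'p topology" and \<xi> :: "'p \<Rightarrow> 'q"
    and \<rho> :: "(nat \<Rightarrow> complex) \<Rightarrow> 'p \<Rightarrow> 'p"
    and l n m :: nat
  assumes "second_countable Q" and "compact_space Q" and "Hausdorff_space Q"
    and "stratified_pseudomanifold l n Q F"
    and "n \<le> m"
    and "characteristic_functor m l n Q F lam"
    and "c \<in> carrier (cohomology_group 2 Q (int_power m))"
    and "principal_torus_bundle m Q P \<xi> \<rho>"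
    and "has_chern_class m Q P \<xi> \<rho> c"
  shows "locally_standard l n m (canonical_model l n Q F lam P \<xi> \<rho>) (model_action \<rho>)"
proof -
  interpret model_data l n m Q F lam P \<xi> \<rho>
    by unfold_locales (use assms in auto)
  show ?thesis by (rule orbit_model_locally_standard[OF canonical_orbit_model])
qed

end
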